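(* Let $P$ be a finite poset equipped with a sheaf $F$, and let $P=\bigcup_{\alpha\in K}P_\alpha$ be a covering of $P$ by upper convex subposets, indexed by a finite set $K$. For nonempty $X\subseteq K$ put $P_X=\bigcap_{\alpha\in X}P_\alpha$, and let the nerve $N$ be the subposet of the Boolean lattice of subsets of $K$ (ordered by inclusion) consisting of those nonempty $X$ with $P_X\ne\varnothing$. For each $q\ge0$ let $\mathcal{H}_q$ be the sheaf on $N$ with $\mathcal{H}_q(X)=\mathrm{HS}_q(P_X;F)$ and, for $X\subseteq Y$, structure map $\mathrm{HS}_q(P_Y;F)\to\mathrm{HS}_q(P_X;F)$ induced by the inclusion $P_Y\hookrightarrow P_X$. Then there is a spectral sequence $$E^2_{p,q}=\mathrm{HS}_p(N;\mathcal{H}_q)\Rightarrow\mathrm{HS}_{p+q}(P;F).$$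
   Context: A subset $K'\subseteq P$ is upper convex if $x\in K'$ and $x\le y$ imply $y\in K'$. A sheaf $F$ on a poset assigns an $R$-module $F(x)$ ($R$ commutative with $1$) to each element and a homomorphism $F^y_x:F(y)\to F(x)$ to each $x\le y$, functorially (contravariant functor); it restricts to subposets. Sheaf homology $\mathrm{HS}_*(Q;G)$ of a finite poset $Q$ with sheaf $G$: the left derived functors of the colimit functor evaluated at $G$, computed as the homology of $S_n(Q;G)=\bigoplus_\sigma G(x_0)$ over chains $\sigma=(x_n\le\cdots\le x_0)$ in $Q$, with $d(s_\sigma)=G^{x_0}_{x_1}(s)_{d_0\sigma}+\sum_{i=1}^n(-1)^is_{d_i\sigma}$, where $s_\sigma$ is $s\in G(x_0)$ in the summand indexed by $\sigma$ and $d_i\sigma$ omits $x_i$. *)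

theory Defs
  imports "HOL-Algebra.Module" "HOL-Algebra.AbelCoset"
begin

definition lin_maps :: "'r ring \<Rightarrow> ('r,'a) module \<Rightarrow> ('r,'b) module \<Rightarrow> ('a \<Rightarrow> 'b) set" where
  "lin_maps R M N = {f. f \<in> carrier M \<rightarrow> carrier N
      \<and> (\<forall>x\<in>carrier M. \<forall>y\<in>carrier M. f (x \<oplus>\<^bsub>M\<^esub> y) = f x \<oplus>\<^bsub>N\<^esub> f y)
      \<and> (\<forall>a\<in>carrier R. \<forall>x\<in>carrier M. f (a \<odot>\<^bsub>M\<^esub> x) = a \<odot>\<^bsub>N\<^esub> f x)}"

definition mod_iso :: "'r ring \<Rightarrow> ('r,'a) module \<Rightarrow> ('r,'b) module \<Rightarrow> bool" where
  "mod_iso R M N \<longleftrightarrow> (\<exists>f\<in>lin_maps R M N. bij_betw f (carrier M) (carrier N))"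

definition quot_mod :: "('r,'a) module \<Rightarrow> 'a set \<Rightarrow> 'a set \<Rightarrow> ('r,'a set) module" where
  "quot_mod M A B = \<lparr>carrier = (\<lambda>a. B +>\<^bsub>M\<^esub> a) ` A,
     monoid.mult = (\<lambda>C D. undefined), one = undefined,
     zero = B,
     add = (\<lambda>C D. C <+>\<^bsub>M\<^esub> D),
     smult = (\<lambda>r C. B <+>\<^bsub>M\<^esub> ((\<lambda>c. r \<odot>\<^bsub>M\<^esub> c) ` C))\<rparr>"

text \<open>A poset is a subset Q of a type with a partial order (induced order).
  A sheaf assigns a module G x to each x in Q and a linear map rho y x : G y \<rightarrow> G x
  to each x \<le> y, contravariantly functorially.\<close>
definition is_sheaf :: "'r ring \<Rightarrow> 'a::order set \<Rightarrow> ('a \<Rightarrow> ('r,'m) module) \<Rightarrow> ('a \<Rightarrow> 'a \<Rightarrow> 'm \<Rightarrow> 'm) \<Rightarrow> bool" where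
  "is_sheaf R Q G rho \<longleftrightarrow>
     (\<forall>x\<in>Q. module R (G x))
   \<and> (\<forall>x\<in>Q. \<forall>y\<in>Q. x \<le> y \<longrightarrow> rho y x \<in> lin_maps R (G y) (G x))
   \<and> (\<forall>x\<in>Q. \<forall>s\<in>carrier (G x). rho x x s = s)
   \<and> (\<forall>x\<in>Q. \<forall>y\<in>Q. \<forall>z\<in>Q. x \<le> y \<longrightarrow> y \<le> z \<longrightarrow>
        (\<forall>s\<in>carrier (G z). rho y x (rho z y s) = rho z x s))"

definition upper_convex :: "'a::order set \<Rightarrow> 'a set \<Rightarrow> bool" where
  "upper_convex P S \<longleftrightarrow> S \<subseteq> P \<and> (\<forall>x\<in>S. \<forall>y\<in>P. x \<le> y \<longrightarrow> y \<in> S)"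

text \<open>n-chains x_n \<le> ... \<le> x_0 in Q, represented as the list [x_0, x_1, ..., x_n].\<close>
definition chains :: "'a::order set \<Rightarrow> nat \<Rightarrow> 'a list set" where
  "chains Q n = {\<sigma>. length \<sigma> = Suc n \<and> set \<sigma> \<subseteq> Q \<and> (\<forall>i<n. \<sigma> ! (Suc i) \<le> \<sigma> ! i)}"

definition face :: "nat \<Rightarrow> 'a list \<Rightarrow> 'a list" where
  "face i \<sigma> = take i \<sigma> @ drop (Suc i) \<sigma>"

text \<open>S_n(Q;G) = direct sum over n-chains \<sigma> of G(x_0).\<close>
definition chain_mod :: "'a::order set \<Rightarrow> ('a \<Rightarrow> ('r,'m) module) \<Rightarrow> nat \<Rightarrow> ('r, 'a list \<Rightarrow> 'm) module" where
  "chain_mod Q G n = \<lparr>carrier = {s. (\<forall>\<sigma>\<in>chains Q n. s \<sigma> \<in> carrier (G (hd \<sigma>)))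
                                   \<and> (\<forall>\<sigma>. \<sigma> \<notin> chains Q n \<longrightarrow> s \<sigma> = undefined)},
     monoid.mult = (\<lambda>s t. undefined), one = undefined,
     zero = (\<lambda>\<sigma>. if \<sigma> \<in> chains Q n then \<zero>\<^bsub>G (hd \<sigma>)\<^esub> else undefined),
     add = (\<lambda>s t \<sigma>. if \<sigma> \<in> chains Q n then s \<sigma> \<oplus>\<^bsub>G (hd \<sigma>)\<^esub> t \<sigma> else undefined),
     smult = (\<lambda>a s \<sigma>. if \<sigma> \<in> chains Q n then a \<odot>\<^bsub>G (hd \<sigma>)\<^esub> s \<sigma> else undefined)\<rparr>"

definition gen :: "'a::order set \<Rightarrow> ('a \<Rightarrow> ('r,'m) module) \<Rightarrow> nat \<Rightarrow> 'a list \<Rightarrow> 'm \<Rightarrow> 'a list \<Rightarrow> 'm" where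
  "gen Q G n \<sigma> m = (\<lambda>\<tau>. if \<tau> \<in> chains Q n then (if \<tau> = \<sigma> then m else \<zero>\<^bsub>G (hd \<tau>)\<^esub>) else undefined)"

definition bdry :: "'a::order set \<Rightarrow> ('a \<Rightarrow> ('r,'m) module) \<Rightarrow> ('a \<Rightarrow> 'a \<Rightarrow> 'm \<Rightarrow> 'm) \<Rightarrow> nat
                    \<Rightarrow> ('a list \<Rightarrow> 'm) \<Rightarrow> ('a list \<Rightarrow> 'm)" where
  "bdry Q G rho n s = finsum (chain_mod Q G n)
     (\<lambda>\<sigma>. gen Q G n (face 0 \<sigma>) (rho (\<sigma> ! 0) (\<sigma> ! 1) (s \<sigma>))
          \<oplus>\<^bsub>chain_mod Q G n\<^esub>
          finsum (chain_mod Q G n)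
            (\<lambda>i. if even i then gen Q G n (face i \<sigma>) (s \<sigma>)
                 else \<ominus>\<^bsub>chain_mod Q G n\<^esub> gen Q G n (face i \<sigma>) (s \<sigma>))
            {1..Suc n})
     (chains Q (Suc n))"

definition cycles :: "'a::order set \<Rightarrow> ('a \<Rightarrow> ('r,'m) module) \<Rightarrow> ('a \<Rightarrow> 'a \<Rightarrow> 'm \<Rightarrow> 'm) \<Rightarrow> nat \<Rightarrow> ('a list \<Rightarrow> 'm) set" where
  "cycles Q G rho n = (if n = 0 then carrier (chain_mod Q G 0)
     else {s \<in> carrier (chain_mod Q G n). bdry Q G rho (n - 1) s = \<zero>\<^bsub>chain_mod Q G (n - 1)\<^esub>})"

definition boundaries :: "'a::order set \<Rightarrow> ('a \<Rightarrow> ('r,'m) module) \<Rightarrow> ('a \<Rightarrow> 'a \<Rightarrow> 'm \<Rightarrow> 'm) \<Rightarrow> nat \<Rightarrow> ('a list \<Rightarrow> 'm) set" where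
  "boundaries Q G rho n = bdry Q G rho n ` carrier (chain_mod Q G (Suc n))"

definition HS :: "'a::order set \<Rightarrow> ('a \<Rightarrow> ('r,'m) module) \<Rightarrow> ('a \<Rightarrow> 'a \<Rightarrow> 'm \<Rightarrow> 'm) \<Rightarrow> nat
                  \<Rightarrow> ('r, ('a list \<Rightarrow> 'm) set) module" where
  "HS Q G rho n = quot_mod (chain_mod Q G n) (cycles Q G rho n) (boundaries Q G rho n)"

definition ext_chain :: "'a::order set \<Rightarrow> 'a set \<Rightarrow> ('a \<Rightarrow> ('r,'m) module) \<Rightarrow> nat
                         \<Rightarrow> ('a list \<Rightarrow> 'm) \<Rightarrow> ('a list \<Rightarrow> 'm)" where
  "ext_chain Q' Q G n s = (\<lambda>\<tau>. if \<tau> \<in> chains Q' n then s \<tau>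
                              else if \<tau> \<in> chains Q n then \<zero>\<^bsub>G (hd \<tau>)\<^esub> else undefined)"

definition HS_map :: "'a::order set \<Rightarrow> 'a set \<Rightarrow> ('a \<Rightarrow> ('r,'m) module) \<Rightarrow> ('a \<Rightarrow> 'a \<Rightarrow> 'm \<Rightarrow> 'm) \<Rightarrow> nat
                      \<Rightarrow> ('a list \<Rightarrow> 'm) set \<Rightarrow> ('a list \<Rightarrow> 'm) set" where
  "HS_map Q' Q G rho n C = boundaries Q G rho n <+>\<^bsub>chain_mod Q G n\<^esub> (ext_chain Q' Q G n ` C)"

definition PX :: "('k \<Rightarrow> 'a set) \<Rightarrow> 'k set \<Rightarrow> 'a set" where
  "PX Pa X = (\<Inter>\<alpha>\<in>X. Pa \<alpha>)"

definition nerve :: "'k set \<Rightarrow> ('k \<Rightarrow> 'a set) \<Rightarrow> 'k set set" where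
  "nerve K Pa = {X. X \<subseteq> K \<and> X \<noteq> {} \<and> PX Pa X \<noteq> {}}"

definition Hsheaf :: "('k \<Rightarrow> 'a::order set) \<Rightarrow> ('a \<Rightarrow> ('r,'m) module) \<Rightarrow> ('a \<Rightarrow> 'a \<Rightarrow> 'm \<Rightarrow> 'm) \<Rightarrow> nat
                      \<Rightarrow> 'k set \<Rightarrow> ('r, ('a list \<Rightarrow> 'm) set) module" where
  "Hsheaf Pa F rho q X = HS (PX Pa X) F rho q"

definition Hsheaf_map :: "('k \<Rightarrow> 'a::order set) \<Rightarrow> ('a \<Rightarrow> ('r,'m) module) \<Rightarrow> ('a \<Rightarrow> 'a \<Rightarrow> 'm \<Rightarrow> 'm) \<Rightarrow> nat
                      \<Rightarrow> 'k set \<Rightarrow> 'k set \<Rightarrow> ('a list \<Rightarrow> 'm) set \<Rightarrow> ('a list \<Rightarrow> 'm) set" where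
  "Hsheaf_map Pa F rho q Y X = HS_map (PX Pa Y) (PX Pa X) F rho q"

definition ss_pages :: "'r ring \<Rightarrow> (nat \<Rightarrow> int \<Rightarrow> int \<Rightarrow> ('r,'e) module) \<Rightarrow> (nat \<Rightarrow> int \<Rightarrow> int \<Rightarrow> 'e \<Rightarrow> 'e) \<Rightarrow> bool" where
  "ss_pages R E d \<longleftrightarrow> (\<forall>r\<ge>2. \<forall>p q.
      module R (E r p q)
    \<and> d r p q \<in> lin_maps R (E r p q) (E r (p - int r) (q + int r - 1))
    \<and> (\<forall>x\<in>carrier (E r p q). d r (p - int r) (q + int r - 1) (d r p q x)
                              = \<zero>\<^bsub>E r (p - 2 * int r) (q + 2 * int r - 2)\<^esub>)
    \<and> mod_iso R (E (Suc r) p q)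
        (quot_mod (E r p q) {x \<in> carrier (E r p q). d r p q x = \<zero>\<^bsub>E r (p - int r) (q + int r - 1)\<^esub>}
                  (d r (p + int r) (q - int r + 1) ` carrier (E r (p + int r) (q - int r + 1)))))"

text \<open>E^\<infinity>_{p,q}: for a first quadrant spectral sequence the page stabilises once r > p and r > q+1.\<close>
definition E_inf :: "(nat \<Rightarrow> int \<Rightarrow> int \<Rightarrow> ('r,'e) module) \<Rightarrow> int \<Rightarrow> int \<Rightarrow> ('r,'e) module" where
  "E_inf E p q = E (nat (max (p + 1) (q + 2))) p q"

definition converging_ss :: "'r ring \<Rightarrow> (nat \<Rightarrow> int \<Rightarrow> int \<Rightarrow> ('r,'e) module) \<Rightarrow> (nat \<Rightarrow> int \<Rightarrow> int \<Rightarrow> 'e \<Rightarrow> 'e)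
                             \<Rightarrow> (nat \<Rightarrow> nat \<Rightarrow> ('r,'g) module) \<Rightarrow> (nat \<Rightarrow> ('r,'h) module) \<Rightarrow> bool" where
  "converging_ss R E d E2 H \<longleftrightarrow>
     ss_pages R E d
   \<and> (\<forall>p q. (0 \<le> p \<and> 0 \<le> q \<longrightarrow> mod_iso R (E 2 p q) (E2 (nat p) (nat q)))
          \<and> (\<not> (0 \<le> p \<and> 0 \<le> q) \<longrightarrow> carrier (E 2 p q) = {\<zero>\<^bsub>E 2 p q\<^esub>}))
   \<and> (\<forall>n. \<exists>\<Phi> :: int \<Rightarrow> 'h set.
          \<Phi> (-1) = {\<zero>\<^bsub>H n\<^esub>} \<and> \<Phi> (int n) = carrier (H n)
        \<and> (\<forall>p. 0 \<le> p \<and> p \<le> int n \<longrightarrow>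
              submodule (\<Phi> p) R (H n) \<and> \<Phi> (p - 1) \<subseteq> \<Phi> p
            \<and> mod_iso R (quot_mod (H n) (\<Phi> p) (\<Phi> (p - 1))) (E_inf E p (int n - p))))"

end

theory Submission
  imports Defs
begin

text \<open>The chains \<open>S\<^sub>q(P\<^sub>X)\<close> over the chains of the nerve form a double complex
  \<open>D\<^sub>p\<^sub>q = S\<^sub>p(N; X \<mapsto> S\<^sub>q(P\<^sub>X; F))\<close>.  Filtering its total complex by \<open>p\<close> gives the second page
  \<open>HS\<^sub>p(N; H\<^sub>q)\<close>.  Split along a fixed chain \<open>\<sigma>\<close> of \<open>P\<close>, the row of index \<open>q\<close> is the chain complex of
  the poset of all nonempty sets of indices \<open>\<alpha>\<close> with \<open>\<sigma>\<close> contained in \<open>P\<^sub>\<alpha>\<close>.  This poset is nonempty because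
  \<open>P\<^sub>\<alpha>\<close> is upper convex and so contains \<open>\<sigma>\<close> as soon as it contains the least element of \<open>\<sigma>\<close>, and it has
  a greatest element, hence it is contractible.  So the rows resolve \<open>S\<^sub>q(P; F)\<close> and the total complex computes
  \<open>HS(P; F)\<close>.

  The page \<open>E\<^sup>r\<^sub>p\<^sub>q\<close> is realised as a subquotient of \<open>D\<^sub>p\<^sub>q\<close> itself: leading terms of the elements of
  filtration \<open>p\<close> whose boundary has filtration \<open>p - r\<close>, modulo leading terms of the boundaries of elements of
  filtration \<open>p + r - 1\<close>.\<close>

section \<open>Linear maps and subquotients\<close>

context abelian_group
begin

lemma minus_eq_zero_iff: "\<lbrakk>x \<in> carrier G; y \<in> carrier G\<rbrakk> \<Longrightarrow> x \<ominus> y = \<zero> \<longleftrightarrow> x = y"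
  by (metis a_minus_def a_inv_closed minus_equality minus_minus r_neg)

lemma minus_zero_right [simp]: "x \<in> carrier G \<Longrightarrow> x \<ominus> \<zero> = x"
  using minus_equality[of \<zero> \<zero>] by (simp add: a_minus_def)

lemma minus_plus_cancel: "\<lbrakk>x \<in> carrier G; y \<in> carrier G\<rbrakk> \<Longrightarrow> (x \<ominus> y) \<oplus> y = x"
  by (simp add: a_minus_def a_assoc l_neg)

lemma minus_minus_cancel: "\<lbrakk>x \<in> carrier G; y \<in> carrier G\<rbrakk> \<Longrightarrow> x \<ominus> (x \<ominus> y) = y"
  by (simp add: a_minus_def minus_add r_neg2)

lemma plus_minus_cancel: "\<lbrakk>x \<in> carrier G; y \<in> carrier G\<rbrakk> \<Longrightarrow> (x \<oplus> y) \<ominus> y = x"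
  by (simp add: a_minus_def a_assoc r_neg)

end

context module
begin

lemma uminus_eq_smult: "x \<in> carrier M \<Longrightarrow> \<ominus>\<^bsub>M\<^esub> x = (\<ominus>\<^bsub>R\<^esub> \<one>\<^bsub>R\<^esub>) \<odot>\<^bsub>M\<^esub> x"
  by (simp add: smult_l_minus)

lemma submoduleI_add_smult:
  assumes "H \<subseteq> carrier M" "\<zero>\<^bsub>M\<^esub> \<in> H"
    and "\<And>x y. \<lbrakk>x \<in> H; y \<in> H\<rbrakk> \<Longrightarrow> x \<oplus>\<^bsub>M\<^esub> y \<in> H"
    and "\<And>a x. \<lbrakk>a \<in> carrier R; x \<in> H\<rbrakk> \<Longrightarrow> a \<odot>\<^bsub>M\<^esub> x \<in> H"
  shows "submodule H R M"
  using assms by (intro submoduleI) (auto simp: uminus_eq_smult subset_iff)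

lemma submodule_mem_carrier: "\<lbrakk>submodule H R M; x \<in> H\<rbrakk> \<Longrightarrow> x \<in> carrier M"
  using submoduleE(1) by blast

lemma submodule_zero: "submodule H R M \<Longrightarrow> \<zero>\<^bsub>M\<^esub> \<in> H"
  using subgroup.one_closed[OF submodule.axioms(1)] by fastforce

lemma submodule_minus: "\<lbrakk>submodule H R M; x \<in> H; y \<in> H\<rbrakk> \<Longrightarrow> x \<ominus>\<^bsub>M\<^esub> y \<in> H"
  using submoduleE(3,5) by (simp add: a_minus_def)

lemma submodule_zero_set: "submodule {\<zero>\<^bsub>M\<^esub>} R M"
  by (rule submoduleI_add_smult) auto

lemma mem_coset_iff:
  assumes "submodule B R M" "x \<in> carrier M" "y \<in> carrier M"
  shows "y \<in> B +>\<^bsub>M\<^esub> x \<longleftrightarrow> y \<ominus>\<^bsub>M\<^esub> x \<in> B"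
proof
  assume "y \<in> B +>\<^bsub>M\<^esub> x"
  then obtain b where "b \<in> B" "y = b \<oplus>\<^bsub>M\<^esub> x" by (auto simp: a_r_coset_def')
  then show "y \<ominus>\<^bsub>M\<^esub> x \<in> B" using assms submodule_mem_carrier by (simp add: plus_minus_cancel)
next
  assume "y \<ominus>\<^bsub>M\<^esub> x \<in> B"
  moreover have "y = (y \<ominus>\<^bsub>M\<^esub> x) \<oplus>\<^bsub>M\<^esub> x" using assms by (simp add: minus_plus_cancel)
  ultimately show "y \<in> B +>\<^bsub>M\<^esub> x" by (auto simp: a_r_coset_def')
qed

lemma coset_eq_iff:
  assumes "submodule B R M" "x \<in> carrier M" "y \<in> carrier M"
  shows "B +>\<^bsub>M\<^esub> x = B +>\<^bsub>M\<^esub> y \<longleftrightarrow> x \<ominus>\<^bsub>M\<^esub> y \<in> B"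
proof -
  have "x \<in> B +>\<^bsub>M\<^esub> x"
    using assms submodule_zero[OF assms(1)] minus_eq_zero_iff[of x x] by (simp add: mem_coset_iff)
  moreover have "B +>\<^bsub>M\<^esub> y = B +>\<^bsub>M\<^esub> x" if "x \<in> B +>\<^bsub>M\<^esub> y"
    using a_repr_independence[OF that assms(3) submodule.axioms(1)[OF assms(1)]] .
  ultimately have "B +>\<^bsub>M\<^esub> x = B +>\<^bsub>M\<^esub> y \<longleftrightarrow> x \<in> B +>\<^bsub>M\<^esub> y" by auto
  then show ?thesis using assms by (simp add: mem_coset_iff)
qed

lemma coset_eq_submodule_iff:
  assumes "submodule B R M" "x \<in> carrier M"
  shows "B +>\<^bsub>M\<^esub> x = B +>\<^bsub>M\<^esub> \<zero>\<^bsub>M\<^esub> \<longleftrightarrow> x \<in> B"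
  using coset_eq_iff[OF assms] assms by simp

end

locale linear_map = M: module R M + N: module R N
  for R :: "'r ring" and M :: "('r,'a) module" and N :: "('r,'b) module" +
  fixes f :: "'a \<Rightarrow> 'b"
  assumes lin_maps: "f \<in> lin_maps R M N"
begin

lemma map_closed [simp, intro]: "x \<in> carrier M \<Longrightarrow> f x \<in> carrier N"
  and map_add: "\<lbrakk>x \<in> carrier M; y \<in> carrier M\<rbrakk> \<Longrightarrow> f (x \<oplus>\<^bsub>M\<^esub> y) = f x \<oplus>\<^bsub>N\<^esub> f y"
  and map_smult: "\<lbrakk>a \<in> carrier R; x \<in> carrier M\<rbrakk> \<Longrightarrow> f (a \<odot>\<^bsub>M\<^esub> x) = a \<odot>\<^bsub>N\<^esub> f x"
  using lin_maps by (auto simp: lin_maps_def)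

lemma map_zero [simp]: "f \<zero>\<^bsub>M\<^esub> = \<zero>\<^bsub>N\<^esub>"
  using map_smult[of "\<zero>\<^bsub>R\<^esub>" "\<zero>\<^bsub>M\<^esub>"] by simp

lemma map_uminus: "x \<in> carrier M \<Longrightarrow> f (\<ominus>\<^bsub>M\<^esub> x) = \<ominus>\<^bsub>N\<^esub> f x"
  by (simp add: M.uminus_eq_smult N.uminus_eq_smult map_smult)

lemma map_minus: "\<lbrakk>x \<in> carrier M; y \<in> carrier M\<rbrakk> \<Longrightarrow> f (x \<ominus>\<^bsub>M\<^esub> y) = f x \<ominus>\<^bsub>N\<^esub> f y"
  by (simp add: a_minus_def map_add map_uminus)

lemma map_finsum:
  assumes "\<And>i. i \<in> A \<Longrightarrow> g i \<in> carrier M"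
  shows "f (\<Oplus>\<^bsub>M\<^esub>i\<in>A. g i) = (\<Oplus>\<^bsub>N\<^esub>i\<in>A. f (g i))"
  using assms
proof (induction A rule: infinite_finite_induct)
  case (infinite A)
  then show ?case by (simp add: M.finsum_infinite N.finsum_infinite)
next
  case (insert a A)
  then show ?case by (simp add: M.finsum_insert N.finsum_insert Pi_def map_add)
qed simp

lemma submodule_image:
  assumes "submodule H R M"
  shows "submodule (f ` H) R N"
proof (rule N.submoduleI_add_smult)
  note H = M.submoduleE[OF assms] M.submodule_mem_carrier[OF assms]
  show "f ` H \<subseteq> carrier N" using H by blast
  show "\<zero>\<^bsub>N\<^esub> \<in> f ` H" using map_zero M.submodule_zero[OF assms] by (metis imageI)
  show "x \<oplus>\<^bsub>N\<^esub> y \<in> f ` H" if "x \<in> f ` H" "y \<in> f ` H" for x y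
    using that H by (auto simp: map_add[symmetric])
  show "a \<odot>\<^bsub>N\<^esub> x \<in> f ` H" if "a \<in> carrier R" "x \<in> f ` H" for a x
    using that H by (auto simp: map_smult[symmetric])
qed

lemma submodule_preimage:
  assumes "submodule H R M" "submodule H' R N"
  shows "submodule {x \<in> H. f x \<in> H'} R M"
  using M.submoduleE[OF assms(1)] M.submodule_mem_carrier[OF assms(1)] M.submodule_zero[OF assms(1)]
    N.submoduleE[OF assms(2)] N.submodule_zero[OF assms(2)]
  by (intro M.submoduleI_add_smult) (auto simp: map_add map_smult)

lemma submodule_range: "submodule (f ` carrier M) R N"
  by (rule submodule_image[OF M.carrier_is_submodule])

lemma submodule_kernel: "submodule {x \<in> carrier M. f x = \<zero>\<^bsub>N\<^esub>} R M"
  using submodule_preimage[OF M.carrier_is_submodule N.submodule_zero_set] by simp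

lemma coset_image:
  assumes B: "submodule B R M" and D: "submodule D R N" and "f ` B \<subseteq> D" and x: "x \<in> carrier M"
  shows "D <+>\<^bsub>N\<^esub> f ` (B +>\<^bsub>M\<^esub> x) = D +>\<^bsub>N\<^esub> f x"
proof (intro subset_antisym subsetI)
  note mem_carrier = M.submodule_mem_carrier[OF B] N.submodule_mem_carrier[OF D]
  fix y
  assume "y \<in> D <+>\<^bsub>N\<^esub> f ` (B +>\<^bsub>M\<^esub> x)"
  then obtain u v where "u \<in> D" "v \<in> B" "y = u \<oplus>\<^bsub>N\<^esub> f (v \<oplus>\<^bsub>M\<^esub> x)"
    by (auto simp: set_add_def' a_r_coset_def')
  then have "y = (u \<oplus>\<^bsub>N\<^esub> f v) \<oplus>\<^bsub>N\<^esub> f x" "u \<oplus>\<^bsub>N\<^esub> f v \<in> D"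
    using x mem_carrier assms(3) N.submoduleE(5)[OF D] by (auto simp: map_add N.a_assoc)
  then show "y \<in> D +>\<^bsub>N\<^esub> f x" by (auto simp: a_r_coset_def')
next
  fix y
  assume "y \<in> D +>\<^bsub>N\<^esub> f x"
  then obtain u where "u \<in> D" "y = u \<oplus>\<^bsub>N\<^esub> f (\<zero>\<^bsub>M\<^esub> \<oplus>\<^bsub>M\<^esub> x)"
    using x by (auto simp: a_r_coset_def')
  then show "y \<in> D <+>\<^bsub>N\<^esub> f ` (B +>\<^bsub>M\<^esub> x)"
    using M.submodule_zero[OF B] by (fastforce simp: set_add_def' a_r_coset_def')
qed

end

lemma linear_mapI:
  assumes "module R M" "module R N"
    and "\<And>x. x \<in> carrier M \<Longrightarrow> f x \<in> carrier N"
    and "\<And>x y. \<lbrakk>x \<in> carrier M; y \<in> carrier M\<rbrakk> \<Longrightarrow> f (x \<oplus>\<^bsub>M\<^esub> y) = f x \<oplus>\<^bsub>N\<^esub> f y"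
    and "\<And>a x. \<lbrakk>a \<in> carrier R; x \<in> carrier M\<rbrakk> \<Longrightarrow> f (a \<odot>\<^bsub>M\<^esub> x) = a \<odot>\<^bsub>N\<^esub> f x"
  shows "linear_map R M N f"
  using assms by (intro linear_map.intro linear_map_axioms.intro) (auto simp: lin_maps_def)

lemma linear_map_cong:
  assumes "linear_map R M N f" "\<And>x. x \<in> carrier M \<Longrightarrow> g x = f x"
  shows "linear_map R M N g"
proof -
  interpret linear_map R M N f by fact
  show ?thesis
    using assms(2)
    by (intro linear_mapI M.module_axioms N.module_axioms) (auto simp: map_add map_smult)
qed

lemma linear_map_comp:
  assumes "linear_map R M N f" "linear_map R N L g"
  shows "linear_map R M L (\<lambda>x. g (f x))"
proof -
  interpret f: linear_map R M N f by fact
  interpret g: linear_map R N L g by fact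
  show ?thesis
    by (intro linear_mapI f.M.module_axioms g.N.module_axioms)
      (auto simp: f.map_add f.map_smult g.map_add g.map_smult)
qed

lemma linear_map_zero:
  assumes "module R M" "module R N"
  shows "linear_map R M N (\<lambda>x. \<zero>\<^bsub>N\<^esub>)"
proof -
  interpret N: module R N by fact
  show ?thesis by (intro linear_mapI assms) auto
qed

lemma linear_map_plus:
  assumes "linear_map R M N f" "linear_map R M N g"
  shows "linear_map R M N (\<lambda>x. f x \<oplus>\<^bsub>N\<^esub> g x)"
proof -
  interpret f: linear_map R M N f by fact
  interpret g: linear_map R M N g by fact
  show ?thesis
    by (intro linear_mapI f.M.module_axioms f.N.module_axioms)
      (auto simp: f.map_add f.map_smult g.map_add g.map_smult f.N.smult_r_distr f.N.a_ac)
qed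

lemma linear_map_finsum:
  assumes "module R M" "module R N" "\<And>i. i \<in> A \<Longrightarrow> linear_map R M N (f i)"
  shows "linear_map R M N (\<lambda>x. \<Oplus>\<^bsub>N\<^esub>i\<in>A. f i x)"
proof -
  interpret N: module R N by fact
  show ?thesis
    using assms(3)
  proof (induction A rule: infinite_finite_induct)
    case (insert i A)
    have "linear_map R M N (\<lambda>x. f i x \<oplus>\<^bsub>N\<^esub> (\<Oplus>\<^bsub>N\<^esub>j\<in>A. f j x))"
      using insert by (intro linear_map_plus) auto
    then show ?case
      using insert(1,2) linear_map.map_closed[OF insert.prems]
      by (elim linear_map_cong) (auto intro!: N.finsum_insert)
  qed (simp_all add: N.finsum_infinite linear_map_zero[OF assms(1,2)])
qed

context
  fixes R :: "'r ring" and M :: "('r,'a) module"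
  assumes module_M: "module R M"
begin

interpretation module R M by (rule module_M)

lemma linear_map_id: "linear_map R M M (\<lambda>x. x)"
  by (rule linear_mapI) (auto intro: module_M)

lemma linear_map_uminus: "linear_map R M M (\<lambda>x. \<ominus>\<^bsub>M\<^esub> x)"
  by (rule linear_mapI) (auto intro: module_M simp: minus_add smult_r_minus)

lemma linear_map_smult: "a \<in> carrier R \<Longrightarrow> linear_map R M M (\<lambda>x. a \<odot>\<^bsub>M\<^esub> x)"
  by (rule linear_mapI)
    (auto intro: module_M simp: smult_r_distr smult_assoc1[symmetric] m_comm)

lemma linear_map_inclusion:
  assumes "submodule H R M"
  shows "linear_map R (M\<lparr>carrier := H\<rparr>) M (\<lambda>x. x)"
  by (rule linear_mapI)
    (use assms in \<open>auto intro: module_M submodule.submodule_is_module submodule_mem_carrier\<close>)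

end

lemma linear_map_restrict:
  assumes "module R M" "linear_map R (M\<lparr>carrier := A\<rparr>) N f" "submodule B R M" "B \<subseteq> A"
  shows "linear_map R (M\<lparr>carrier := B\<rparr>) N f"
proof -
  interpret f: linear_map R "M\<lparr>carrier := A\<rparr>" N f by fact
  have "x \<in> carrier (M\<lparr>carrier := A\<rparr>)" if "x \<in> B" for x using that assms(4) by auto
  then show ?thesis
    using f.map_add f.map_smult
    by (intro linear_mapI f.N.module_axioms submodule.submodule_is_module[OF assms(3,1)]) simp_all
qed

lemma linear_map_restricted_minus:
  assumes "module R M" "linear_map R (M\<lparr>carrier := A\<rparr>) N f" "submodule A R M"
    and xy: "x \<in> A" "y \<in> A"
  shows "f (x \<ominus>\<^bsub>M\<^esub> y) = f x \<ominus>\<^bsub>N\<^esub> f y"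
proof -
  interpret M: module R M by fact
  interpret f: linear_map R "M\<lparr>carrier := A\<rparr>" N f by fact
  let ?neg = "(\<ominus>\<^bsub>R\<^esub> \<one>\<^bsub>R\<^esub>) \<odot>\<^bsub>M\<^esub> y"
  have neg: "\<ominus>\<^bsub>M\<^esub> y = ?neg" "?neg \<in> A"
    using M.uminus_eq_smult M.submodule_mem_carrier M.submoduleE(4) assms(3) xy(2) by auto
  have "f ?neg = \<ominus>\<^bsub>N\<^esub> f y"
    using f.map_smult[of "\<ominus>\<^bsub>R\<^esub> \<one>\<^bsub>R\<^esub>" y] f.map_closed[of y] xy(2) by (simp add: f.N.uminus_eq_smult)
  then show ?thesis using f.map_add[of x ?neg] xy(1) neg by (simp add: a_minus_def)
qed

locale subquotient = module R M
  for R :: "'r ring" and M :: "('r,'a) module" (structure) +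
  fixes A B :: "'a set"
  assumes submodule_A: "submodule A R M" and submodule_B: "submodule B R M" and B_subset_A: "B \<subseteq> A"
begin

abbreviation quot :: "('r, 'a set) module" where "quot \<equiv> quot_mod M A B"

lemma A_carrier [simp, intro]: "x \<in> A \<Longrightarrow> x \<in> carrier M"
  by (rule submodule_mem_carrier[OF submodule_A])

lemma A_closed [simp, intro]:
  "\<zero>\<^bsub>M\<^esub> \<in> A" "x \<in> A \<Longrightarrow> y \<in> A \<Longrightarrow> x \<oplus>\<^bsub>M\<^esub> y \<in> A" "x \<in> A \<Longrightarrow> \<ominus>\<^bsub>M\<^esub> x \<in> A"
  "a \<in> carrier R \<Longrightarrow> x \<in> A \<Longrightarrow> a \<odot>\<^bsub>M\<^esub> x \<in> A"
  using submoduleE[OF submodule_A] submodule_zero[OF submodule_A] by auto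

lemma carrier_quot: "carrier quot = (\<lambda>x. B +>\<^bsub>M\<^esub> x) ` A"
  by (simp add: quot_mod_def)

lemma coset_mem_quot [simp, intro]: "x \<in> A \<Longrightarrow> B +>\<^bsub>M\<^esub> x \<in> carrier quot"
  by (simp add: carrier_quot)

lemma zero_quot: "\<zero>\<^bsub>quot\<^esub> = B +>\<^bsub>M\<^esub> \<zero>\<^bsub>M\<^esub>"
  using submoduleE(1)[OF submodule_B] by (simp add: quot_mod_def)

lemma add_quot:
  assumes "x \<in> A" "y \<in> A"
  shows "(B +>\<^bsub>M\<^esub> x) \<oplus>\<^bsub>quot\<^esub> (B +>\<^bsub>M\<^esub> y) = B +>\<^bsub>M\<^esub> (x \<oplus>\<^bsub>M\<^esub> y)"
proof -
  interpret B: abelian_subgroup B M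
    using submodule.axioms(1)[OF submodule_B] M.abelian_group_axioms
    by (intro abelian_subgroupI3 additive_subgroupI)
  show ?thesis using assms by (simp add: quot_mod_def B.a_rcos_sum)
qed

lemma smult_quot:
  assumes "a \<in> carrier R" "x \<in> A"
  shows "a \<odot>\<^bsub>quot\<^esub> (B +>\<^bsub>M\<^esub> x) = B +>\<^bsub>M\<^esub> (a \<odot>\<^bsub>M\<^esub> x)"
proof -
  interpret smult: linear_map R M M "\<lambda>x. a \<odot>\<^bsub>M\<^esub> x"
    by (rule linear_map_smult[OF module_axioms assms(1)])
  have "(\<lambda>x. a \<odot>\<^bsub>M\<^esub> x) ` B \<subseteq> B" using submoduleE(4)[OF submodule_B assms(1)] by blast
  then show ?thesis
    using smult.coset_image[OF submodule_B submodule_B] assms(2) by (simp add: quot_mod_def)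
qed

lemma module_quot: "module R quot"
proof (rule moduleI)
  show "abelian_group quot"
  proof (rule abelian_groupI)
    show "\<exists>Y\<in>carrier quot. Y \<oplus>\<^bsub>quot\<^esub> X = \<zero>\<^bsub>quot\<^esub>" if X: "X \<in> carrier quot" for X
    proof -
      obtain x where "x \<in> A" "X = B +>\<^bsub>M\<^esub> x" using X by (auto simp: carrier_quot)
      then have "(B +>\<^bsub>M\<^esub> \<ominus>\<^bsub>M\<^esub> x) \<oplus>\<^bsub>quot\<^esub> X = \<zero>\<^bsub>quot\<^esub>"
        by (simp add: add_quot zero_quot l_neg)
      then show ?thesis using \<open>x \<in> A\<close> coset_mem_quot[OF A_closed(3)] by (intro bexI)
    qed
  qed (auto simp: carrier_quot add_quot zero_quot a_ac)
qed (rule cring_axioms,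
    auto simp: carrier_quot add_quot smult_quot smult_l_distr smult_r_distr smult_assoc1)

lemma linear_map_proj: "linear_map R (M\<lparr>carrier := A\<rparr>) quot (\<lambda>x. B +>\<^bsub>M\<^esub> x)"
  by (rule linear_mapI)
    (auto simp: add_quot smult_quot module_quot
      intro: submodule.submodule_is_module submodule_A module_axioms)

lemma coset_eq_zero_iff: "x \<in> A \<Longrightarrow> B +>\<^bsub>M\<^esub> x = \<zero>\<^bsub>quot\<^esub> \<longleftrightarrow> x \<in> B"
  using coset_eq_submodule_iff[OF submodule_B] by (auto simp: zero_quot)

end

text \<open>A span \<open>M \<leftarrow> V \<rightarrow> N\<close> of linear maps is an additive relation in the sense of Mac Lane.
  It induces maps between subquotients without a choice of lifts.\<close>

definition span_map ::
    "('r,'b) module \<Rightarrow> 'b set \<Rightarrow> ('r,'v) module \<Rightarrow> ('v \<Rightarrow> 'a) \<Rightarrow> ('v \<Rightarrow> 'b) \<Rightarrow> 'a set \<Rightarrow> 'b set" where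
  "span_map N D V f g X = D <+>\<^bsub>N\<^esub> g ` {v \<in> carrier V. f v \<in> X}"

locale subquotient_span = S: subquotient R M A B + T: subquotient R N C D +
    f: linear_map R V M f + g: linear_map R V N g
  for R :: "'r ring" and M :: "('r,'a) module" and A B
    and N :: "('r,'b) module" and C D and V :: "('r,'v) module" and f g +
  assumes f_onto: "f ` carrier V = A" and g_into: "g ` carrier V \<subseteq> C"
    and f_to_B_imp_g_to_D: "\<lbrakk>v \<in> carrier V; f v \<in> B\<rbrakk> \<Longrightarrow> g v \<in> D"
begin

lemma f_mem_A [simp, intro]: "v \<in> carrier V \<Longrightarrow> f v \<in> A"
  using f_onto by blast

lemma g_mem_C [simp, intro]: "v \<in> carrier V \<Longrightarrow> g v \<in> C"
  using g_into by blast

lemma quot_coset_cases: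
  assumes "X \<in> carrier S.quot"
  obtains v where "v \<in> carrier V" "X = B +>\<^bsub>M\<^esub> f v"
  using assms f_onto by (auto simp: S.carrier_quot)

lemma span_map_coset:
  assumes v: "v \<in> carrier V"
  shows "span_map N D V f g (B +>\<^bsub>M\<^esub> f v) = D +>\<^bsub>N\<^esub> g v"
proof -
  let ?preimage = "{u \<in> carrier V. f u \<in> B}"
  have preimage: "submodule ?preimage R V"
    by (rule f.submodule_preimage[OF f.M.carrier_is_submodule S.submodule_B])
  have "f u \<in> B +>\<^bsub>M\<^esub> f v \<longleftrightarrow> u \<in> ?preimage +>\<^bsub>V\<^esub> v" if "u \<in> carrier V" for u
    using that v
    by (simp add: S.mem_coset_iff[OF S.submodule_B] f.M.mem_coset_iff[OF preimage] f.map_minus)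
  then have "{u \<in> carrier V. f u \<in> B +>\<^bsub>M\<^esub> f v} = ?preimage +>\<^bsub>V\<^esub> v"
    using f.M.a_r_coset_subset_G[of ?preimage v] v by blast
  moreover have "g ` ?preimage \<subseteq> D" using f_to_B_imp_g_to_D by blast
  ultimately show ?thesis
    unfolding span_map_def by (simp add: g.coset_image[OF preimage T.submodule_B _ v])
qed

lemma linear_map_quotI:
  assumes "\<And>v. v \<in> carrier V \<Longrightarrow> h (B +>\<^bsub>M\<^esub> f v) = D +>\<^bsub>N\<^esub> g v"
  shows "linear_map R S.quot T.quot h"
proof (rule linear_mapI[OF S.module_quot T.module_quot])
  show "h X \<in> carrier T.quot" if "X \<in> carrier S.quot" for X
    using that assms by (elim quot_coset_cases) auto
  show "h (X \<oplus>\<^bsub>S.quot\<^esub> Y) = h X \<oplus>\<^bsub>T.quot\<^esub> h Y"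
    if X: "X \<in> carrier S.quot" and Y: "Y \<in> carrier S.quot" for X Y
  proof -
    obtain u v where "u \<in> carrier V" "X = B +>\<^bsub>M\<^esub> f u" "v \<in> carrier V" "Y = B +>\<^bsub>M\<^esub> f v"
      using X Y by (elim quot_coset_cases)
    then show ?thesis
      using assms[of "u \<oplus>\<^bsub>V\<^esub> v"] by (simp add: assms S.add_quot T.add_quot f.map_add g.map_add)
  qed
  show "h (a \<odot>\<^bsub>S.quot\<^esub> X) = a \<odot>\<^bsub>T.quot\<^esub> h X" if a: "a \<in> carrier R" and X: "X \<in> carrier S.quot" for a X
  proof -
    obtain v where "v \<in> carrier V" "X = B +>\<^bsub>M\<^esub> f v" using X by (elim quot_coset_cases)
    then show ?thesis
      using a assms[of "a \<odot>\<^bsub>V\<^esub> v"]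
      by (simp add: assms S.smult_quot T.smult_quot f.map_smult g.map_smult)
  qed
qed

lemma linear_map_span_map: "linear_map R S.quot T.quot (span_map N D V f g)"
  by (rule linear_map_quotI[OF span_map_coset])

lemma mod_iso_quot:
  assumes g_onto: "g ` carrier V = C"
    and g_to_D_imp_f_to_B: "\<And>v. \<lbrakk>v \<in> carrier V; g v \<in> D\<rbrakk> \<Longrightarrow> f v \<in> B"
  shows "mod_iso R S.quot T.quot"
  unfolding mod_iso_def
proof (intro bexI[OF _ linear_map.lin_maps[OF linear_map_span_map]] bij_betw_imageI inj_onI)
  let ?h = "span_map N D V f g"
  fix X Y
  assume "X \<in> carrier S.quot" "Y \<in> carrier S.quot" and eq: "?h X = ?h Y"
  then obtain u v where uv: "u \<in> carrier V" "X = B +>\<^bsub>M\<^esub> f u" "v \<in> carrier V" "Y = B +>\<^bsub>M\<^esub> f v"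
    by (elim quot_coset_cases)
  then have "g (u \<ominus>\<^bsub>V\<^esub> v) \<in> D"
    using eq T.coset_eq_iff[OF T.submodule_B] by (simp add: span_map_coset g.map_minus)
  then have "f (u \<ominus>\<^bsub>V\<^esub> v) \<in> B" using uv g_to_D_imp_f_to_B by simp
  then show "X = Y" using uv S.coset_eq_iff[OF S.submodule_B] by (simp add: f.map_minus)
next
  have "carrier S.quot = (\<lambda>v. B +>\<^bsub>M\<^esub> f v) ` carrier V"
    using f_onto by (auto simp: S.carrier_quot)
  moreover have "carrier T.quot = (\<lambda>v. D +>\<^bsub>N\<^esub> g v) ` carrier V"
    using g_onto by (auto simp: T.carrier_quot)
  ultimately show "span_map N D V f g ` carrier S.quot = carrier T.quot"
    by (simp add: image_image span_map_coset)
qed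

end

lemma (in subquotient) mod_iso_quot_quot:
  assumes A': "submodule A' R M" "A' \<subseteq> A" and B': "submodule B' R M" "B' \<subseteq> A'" "B \<subseteq> B'"
  shows "mod_iso R (quot_mod M A' B') (quot_mod quot ((\<lambda>x. B +>\<^bsub>M\<^esub> x) ` A') ((\<lambda>x. B +>\<^bsub>M\<^esub> x) ` B'))"
proof -
  let ?proj = "\<lambda>x. B +>\<^bsub>M\<^esub> x"
  let ?A = "M\<lparr>carrier := A\<rparr>"
  interpret proj: linear_map R ?A quot ?proj by (rule linear_map_proj)
  have submodule_of_A: "submodule H R ?A" if "submodule H R M" "H \<subseteq> A" for H
    using that submoduleE[OF that(1)] submodule_zero[OF that(1)]
    by (intro proj.M.submoduleI_add_smult) auto
  have S: "subquotient R M A' B'"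
    by (intro subquotient.intro subquotient_axioms.intro module_axioms assms)
  have T: "subquotient R quot (?proj ` A') (?proj ` B')"
    by (intro subquotient.intro subquotient_axioms.intro module_quot proj.submodule_image
      submodule_of_A image_mono subset_trans[OF B'(2) A'(2)] assms)
  interpret span: subquotient_span R M A' B' quot "?proj ` A'" "?proj ` B'" "M\<lparr>carrier := A'\<rparr>"
      "\<lambda>x. x" ?proj
  proof (intro subquotient_span.intro subquotient_span_axioms.intro S T)
    show inclusion: "linear_map R (M\<lparr>carrier := A'\<rparr>) M (\<lambda>x. x)"
      by (rule linear_map_inclusion[OF module_axioms A'(1)])
    show "linear_map R (M\<lparr>carrier := A'\<rparr>) quot ?proj"
      by (rule linear_map_restrict[OF module_axioms linear_map_proj A'])
  qed auto
  show ?thesis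
  proof (rule span.mod_iso_quot)
    fix x assume x: "x \<in> carrier (M\<lparr>carrier := A'\<rparr>)" and "?proj x \<in> ?proj ` B'"
    then obtain y where y: "y \<in> B'" "?proj x = ?proj y" by blast
    have "x \<in> A" "y \<in> A" using x y(1) assms by auto
    then have "x \<ominus>\<^bsub>M\<^esub> y \<in> B'" using y(2) B'(3) coset_eq_iff[OF submodule_B] by auto
    then have "(x \<ominus>\<^bsub>M\<^esub> y) \<oplus>\<^bsub>M\<^esub> y \<in> B'" using y(1) submoduleE(5)[OF B'(1)] by blast
    then show "x \<in> B'" using \<open>x \<in> A\<close> \<open>y \<in> A\<close> by (simp add: minus_plus_cancel)
  qed simp
qed

section \<open>The spectral sequence of a filtered complex\<close>

lemma target_degree: "p - r + (q + r - 1) = p + q - (1::int)"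
  by simp

text \<open>The total complex is one module \<open>T\<close>, and \<open>Fil p n\<close> is its part of degree \<open>n\<close> and filtration at
  most \<open>p\<close>.  The leading term map \<open>lead p q\<close>
  embeds \<open>Fil p (p + q) / Fil (p - 1) (p + q)\<close> into \<open>D p q\<close>.\<close>

locale filtered_complex = d: linear_map R T T d
  for R :: "'r ring" and T :: "('r,'t) module" and d +
  fixes Fil :: "int \<Rightarrow> int \<Rightarrow> 't set"
    and D :: "int \<Rightarrow> int \<Rightarrow> ('r,'e) module" and lead :: "int \<Rightarrow> int \<Rightarrow> 't \<Rightarrow> 'e"
  assumes submodule_Fil: "submodule (Fil p n) R T"
    and Fil_step: "Fil (p - 1) n \<subseteq> Fil p n"
    and Fil_neg: "p < 0 \<Longrightarrow> Fil p n = {\<zero>\<^bsub>T\<^esub>}"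
    and Fil_top: "n \<le> p \<Longrightarrow> Fil p n = Fil n n"
    and d_Fil: "x \<in> Fil p n \<Longrightarrow> d x \<in> Fil p (n - 1)"
    and d_d: "x \<in> carrier T \<Longrightarrow> d (d x) = \<zero>\<^bsub>T\<^esub>"
    and linear_map_lead: "linear_map R T (D p q) (lead p q)"
    and lead_eq_zero_iff: "x \<in> Fil p (p + q) \<Longrightarrow> lead p q x = \<zero>\<^bsub>D p q\<^esub> \<longleftrightarrow> x \<in> Fil (p - 1) (p + q)"
begin

sublocale lead: linear_map R T "D p q" "lead p q" for p q
  by (rule linear_map_lead)

lemmas Fil_minus = d.M.submodule_minus[OF submodule_Fil]
  and Fil_zero = d.M.submodule_zero[OF submodule_Fil]

lemma Fil_carrier: "x \<in> Fil p n \<Longrightarrow> x \<in> carrier T"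
  by (rule d.M.submodule_mem_carrier[OF submodule_Fil])

lemma Fil_mono:
  assumes "p \<le> p'"
  shows "Fil p n \<subseteq> Fil p' n"
proof -
  have "Fil p n \<subseteq> Fil (p + int k) n" for k
    by (induction k) (use Fil_step[of "p + 1 + int _" n] in \<open>auto simp: algebra_simps\<close>)
  from this[of "nat (p' - p)"] show ?thesis using assms by simp
qed

lemma lead_eq_iff:
  assumes "x \<in> Fil p (p + q)" "y \<in> Fil p (p + q)"
  shows "lead p q x = lead p q y \<longleftrightarrow> x \<ominus>\<^bsub>T\<^esub> y \<in> Fil (p - 1) (p + q)"
  using lead_eq_zero_iff[OF Fil_minus[OF assms]] assms
  by (simp add: lead.map_minus lead.N.minus_eq_zero_iff Fil_carrier)

lemma lead_minus_lower:
  assumes "x \<in> Fil p (p + q)" "y \<in> Fil (p - 1) (p + q)"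
  shows "lead p q (x \<ominus>\<^bsub>T\<^esub> y) = lead p q x"
proof -
  have "lead p q y = \<zero>\<^bsub>D p q\<^esub>" using assms(2) Fil_step lead_eq_zero_iff by blast
  then show ?thesis using assms by (simp add: lead.map_minus Fil_carrier)
qed

definition approx_cycles :: "int \<Rightarrow> int \<Rightarrow> int \<Rightarrow> 't set" where
  "approx_cycles r p n = {x \<in> Fil p n. d x \<in> Fil (p - r) (n - 1)}"

definition page_cycles :: "int \<Rightarrow> int \<Rightarrow> int \<Rightarrow> 'e set" where
  "page_cycles r p q = lead p q ` approx_cycles r p (p + q)"

definition page_boundaries :: "int \<Rightarrow> int \<Rightarrow> int \<Rightarrow> 'e set" where
  "page_boundaries r p q = lead p q ` d ` approx_cycles (r - 1) (p + r - 1) (p + q + 1)"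

definition page :: "nat \<Rightarrow> int \<Rightarrow> int \<Rightarrow> ('r, 'e set) module" where
  "page r p q = quot_mod (D p q) (page_cycles (int r) p q) (page_boundaries (int r) p q)"

definition dpage :: "nat \<Rightarrow> int \<Rightarrow> int \<Rightarrow> 'e set \<Rightarrow> 'e set" where
  "dpage r p q =
     span_map (D (p - int r) (q + int r - 1)) (page_boundaries (int r) (p - int r) (q + int r - 1))
       (T\<lparr>carrier := approx_cycles (int r) p (p + q)\<rparr>)
       (lead p q) (\<lambda>x. lead (p - int r) (q + int r - 1) (d x))"

lemma submodule_approx_cycles: "submodule (approx_cycles r p n) R T"
  unfolding approx_cycles_def by (rule d.submodule_preimage[OF submodule_Fil submodule_Fil])

lemma approx_cycles_carrier: "x \<in> approx_cycles r p n \<Longrightarrow> x \<in> carrier T"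
  by (rule d.M.submodule_mem_carrier[OF submodule_approx_cycles])

lemma approx_cycles_mono: "\<lbrakk>p \<le> p'; p - r \<le> p' - r'\<rbrakk> \<Longrightarrow> approx_cycles r p n \<subseteq> approx_cycles r' p' n"
  using Fil_mono unfolding approx_cycles_def by blast

lemma d_approx_cycles: "x \<in> approx_cycles r p n \<Longrightarrow> d x \<in> approx_cycles s (p - r) (n - 1)"
  using Fil_zero by (auto simp: approx_cycles_def d_d Fil_carrier)

lemma page_cycles_antimono: "r \<le> s \<Longrightarrow> page_cycles s p q \<subseteq> page_cycles r p q"
  unfolding page_cycles_def using approx_cycles_mono[of p p s r] by auto

lemma page_boundaries_mono: "r \<le> s \<Longrightarrow> page_boundaries r p q \<subseteq> page_boundaries s p q"
  unfolding page_boundaries_def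
  using approx_cycles_mono[of "p + r - 1" "p + s - 1" "r - 1" "s - 1"] by auto

lemma page_boundaries_subset_page_cycles: "page_boundaries r p q \<subseteq> page_cycles s p q"
  unfolding page_cycles_def page_boundaries_def
  using d_approx_cycles[of _ "r - 1" "p + r - 1" "p + q + 1" s] by fastforce

lemma subquotient_page: "subquotient R (D p q) (page_cycles r p q) (page_boundaries s p q)"
  unfolding page_cycles_def page_boundaries_def
  by (intro subquotient.intro subquotient_axioms.intro lead.N.module_axioms lead.submodule_image
      d.submodule_image submodule_approx_cycles
      page_boundaries_subset_page_cycles[unfolded page_cycles_def page_boundaries_def])

text \<open>Both directions subtract a correction of filtration \<open>p - 1\<close>, which
  does not change leading terms.\<close>

lemma lead_d_mem_page_boundaries_iff:
  assumes x: "x \<in> approx_cycles r p (p + q)"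
  shows "lead (p - r) (q + r - 1) (d x) \<in> page_boundaries r (p - r) (q + r - 1) \<longleftrightarrow>
    lead p q x \<in> page_cycles (r + 1) p q"
proof -
  let ?lead = "lead (p - r) (q + r - 1)"
  have boundaries: "page_boundaries r (p - r) (q + r - 1)
      = ?lead ` d ` approx_cycles (r - 1) (p - 1) (p + q)"
    by (simp add: page_boundaries_def)
  have x_Fil: "x \<in> Fil p (p + q)" "d x \<in> Fil (p - r) (p + q - 1)"
    using x by (auto simp: approx_cycles_def)
  note lead_d_eq_iff = lead_eq_iff[of _ "p - r" "q + r - 1", unfolded target_degree, OF x_Fil(2)]
  note lead_d_minus_lower =
    lead_minus_lower[of _ "p - r" "q + r - 1", unfolded target_degree, OF x_Fil(2)]
  show ?thesis
  proof
    assume "?lead (d x) \<in> page_boundaries r (p - r) (q + r - 1)"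
    then obtain w where w: "w \<in> Fil (p - 1) (p + q)" "d w \<in> Fil (p - r) (p + q - 1)"
        "?lead (d x) = ?lead (d w)"
      unfolding boundaries by (auto simp: approx_cycles_def)
    then have "d x \<ominus>\<^bsub>T\<^esub> d w \<in> Fil (p - r - 1) (p + q - 1)" using lead_d_eq_iff by blast
    moreover have "x \<ominus>\<^bsub>T\<^esub> w \<in> Fil p (p + q)" using x_Fil w(1) Fil_step by (blast intro: Fil_minus)
    ultimately have "x \<ominus>\<^bsub>T\<^esub> w \<in> approx_cycles (r + 1) p (p + q)"
      using x_Fil w by (simp add: approx_cycles_def d.map_minus Fil_carrier diff_diff_eq)
    then show "lead p q x \<in> page_cycles (r + 1) p q"
      using lead_minus_lower[OF x_Fil(1) w(1)] unfolding page_cycles_def by (metis imageI)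
  next
    assume "lead p q x \<in> page_cycles (r + 1) p q"
    then obtain y where y: "y \<in> Fil p (p + q)" "d y \<in> Fil (p - r - 1) (p + q - 1)"
        "lead p q x = lead p q y"
      by (auto simp: page_cycles_def approx_cycles_def diff_diff_eq)
    then have "x \<ominus>\<^bsub>T\<^esub> y \<in> Fil (p - 1) (p + q)" using lead_eq_iff x_Fil(1) by blast
    moreover have d_minus: "d (x \<ominus>\<^bsub>T\<^esub> y) = d x \<ominus>\<^bsub>T\<^esub> d y"
      using x_Fil y by (simp add: d.map_minus Fil_carrier)
    moreover have "d x \<ominus>\<^bsub>T\<^esub> d y \<in> Fil (p - r) (p + q - 1)"
      using x_Fil y(2) Fil_step by (blast intro: Fil_minus)
    ultimately have "x \<ominus>\<^bsub>T\<^esub> y \<in> approx_cycles (r - 1) (p - 1) (p + q)"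
      by (simp add: approx_cycles_def)
    moreover have "?lead (d (x \<ominus>\<^bsub>T\<^esub> y)) = ?lead (d x)"
      using lead_d_minus_lower[OF y(2)] d_minus by simp
    ultimately show "?lead (d x) \<in> page_boundaries r (p - r) (q + r - 1)"
      unfolding boundaries by (metis imageI)
  qed
qed

lemma subquotient_span_page:
  "subquotient_span R (D p q) (page_cycles r p q) (page_boundaries r p q)
     (D (p - r) (q + r - 1)) (page_cycles r (p - r) (q + r - 1))
       (page_boundaries r (p - r) (q + r - 1))
     (T\<lparr>carrier := approx_cycles r p (p + q)\<rparr>) (lead p q) (\<lambda>x. lead (p - r) (q + r - 1) (d x))"
proof (intro subquotient_span.intro subquotient_span_axioms.intro subquotient_page)
  have inclusion: "linear_map R (T\<lparr>carrier := approx_cycles r p (p + q)\<rparr>) T (\<lambda>x. x)"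
    by (rule linear_map_inclusion[OF d.M.module_axioms submodule_approx_cycles])
  then show "linear_map R (T\<lparr>carrier := approx_cycles r p (p + q)\<rparr>) (D p q) (lead p q)"
    by (rule linear_map_comp[OF _ linear_map_lead])
  show "linear_map R (T\<lparr>carrier := approx_cycles r p (p + q)\<rparr>) (D (p - r) (q + r - 1))
     (\<lambda>x. lead (p - r) (q + r - 1) (d x))"
    by (rule linear_map_comp[OF linear_map_comp[OF inclusion d.linear_map_axioms] linear_map_lead])
  show "lead (p - r) (q + r - 1) (d x) \<in> page_boundaries r (p - r) (q + r - 1)"
    if "x \<in> carrier (T\<lparr>carrier := approx_cycles r p (p + q)\<rparr>)"
      "lead p q x \<in> page_boundaries r p q" for x
    using that lead_d_mem_page_boundaries_iff subsetD[OF page_boundaries_subset_page_cycles] by simp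
  show "(\<lambda>x. lead (p - r) (q + r - 1) (d x)) ` carrier (T\<lparr>carrier := approx_cycles r p (p + q)\<rparr>)
      \<subseteq> page_cycles r (p - r) (q + r - 1)"
    unfolding page_cycles_def target_degree using d_approx_cycles by auto
qed (simp add: page_cycles_def)

lemma module_page: "module R (page r p q)"
  unfolding page_def by (rule subquotient.module_quot[OF subquotient_page])

lemma carrier_page:
  "carrier (page r p q) =
     (\<lambda>x. page_boundaries (int r) p q +>\<^bsub>D p q\<^esub> lead p q x) ` approx_cycles (int r) p (p + q)"
  unfolding page_def subquotient.carrier_quot[OF subquotient_page]
  by (simp add: page_cycles_def image_image)

lemma dpage_coset:
  assumes "x \<in> approx_cycles (int r) p (p + q)"
  shows "dpage r p q (page_boundaries (int r) p q +>\<^bsub>D p q\<^esub> lead p q x) =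
    page_boundaries (int r) (p - int r) (q + int r - 1) +>\<^bsub>D (p - int r) (q + int r - 1)\<^esub>
      lead (p - int r) (q + int r - 1) (d x)"
  using assms subquotient_span.span_map_coset[OF subquotient_span_page, of x "int r" p q]
  by (simp add: dpage_def)

lemma linear_map_dpage:
  "linear_map R (page r p q) (page r (p - int r) (q + int r - 1)) (dpage r p q)"
  unfolding dpage_def page_def
  by (rule subquotient_span.linear_map_span_map[OF subquotient_span_page])

lemma dpage_dpage:
  assumes "X \<in> carrier (page r p q)"
  shows "dpage r (p - int r) (q + int r - 1) (dpage r p q X)
    = \<zero>\<^bsub>page r (p - 2 * int r) (q + 2 * int r - 2)\<^esub>"
proof -
  obtain x where x: "x \<in> approx_cycles (int r) p (p + q)"
    "X = page_boundaries (int r) p q +>\<^bsub>D p q\<^esub> lead p q x"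
    using assms unfolding carrier_page by blast
  have dx: "d x \<in> approx_cycles (int r) (p - int r) (p - int r + (q + int r - 1))"
    unfolding target_degree by (rule d_approx_cycles[OF x(1)])
  have target: "p - int r - int r = p - 2 * int r" "q + int r - 1 + int r - 1 = q + 2 * int r - 2"
    by simp_all
  show ?thesis
    using dpage_coset[OF dx] unfolding target d_d[OF approx_cycles_carrier[OF x(1)]] lead.map_zero
    by (simp only: x(2) dpage_coset[OF x(1)] page_def subquotient.zero_quot[OF subquotient_page])
qed

lemma dpage_kernel:
  "{X \<in> carrier (page r p q). dpage r p q X = \<zero>\<^bsub>page r (p - int r) (q + int r - 1)\<^esub>}
    = (\<lambda>a. page_boundaries (int r) p q +>\<^bsub>D p q\<^esub> a) ` page_cycles (int (Suc r)) p q"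
proof -
  let ?proj = "\<lambda>a. page_boundaries (int r) p q +>\<^bsub>D p q\<^esub> a"
  have zero_iff: "dpage r p q (?proj (lead p q x)) = \<zero>\<^bsub>page r (p - int r) (q + int r - 1)\<^esub>
      \<longleftrightarrow> lead p q x \<in> page_cycles (int (Suc r)) p q"
    if "x \<in> approx_cycles (int r) p (p + q)" for x
    using that lead_d_mem_page_boundaries_iff[OF that]
      subquotient_span.g_mem_C[OF subquotient_span_page, of x "int r" p q]
    by (simp add: dpage_coset page_def subquotient.coset_eq_zero_iff[OF subquotient_page]
      add.commute)
  have "page_cycles (int (Suc r)) p q \<subseteq> lead p q ` approx_cycles (int r) p (p + q)"
    using page_cycles_antimono[of "int r" "int (Suc r)"] by (simp add: page_cycles_def)
  then show ?thesis unfolding carrier_page using zero_iff by blast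
qed

lemma dpage_image:
  "dpage r (p + int r) (q - int r + 1) ` carrier (page r (p + int r) (q - int r + 1))
    = (\<lambda>a. page_boundaries (int r) p q +>\<^bsub>D p q\<^esub> a) ` page_boundaries (int (Suc r)) p q"
proof -
  have "dpage r (p + int r) (q - int r + 1) ` carrier (page r (p + int r) (q - int r + 1))
    = (\<lambda>x. page_boundaries (int r) p q +>\<^bsub>D p q\<^esub> lead p q (d x)) ` approx_cycles (int r) (p + int r)
      (p + q + 1)"
    unfolding carrier_page image_image
    by (rule image_cong)
      (use dpage_coset[of _ r "p + int r" "q - int r + 1"] in \<open>simp_all add: algebra_simps\<close>)
  then show ?thesis by (simp add: page_boundaries_def image_image)
qed

lemma page_Suc_iso:
  "mod_iso R (page (Suc r) p q)
     (quot_mod (page r p q)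
        {X \<in> carrier (page r p q). dpage r p q X = \<zero>\<^bsub>page r (p - int r) (q + int r - 1)\<^esub>}
        (dpage r (p + int r) (q - int r + 1) ` carrier (page r (p + int r) (q - int r + 1))))"
proof -
  interpret Suc_r: subquotient R "D p q" "page_cycles (int (Suc r)) p q"
      "page_boundaries (int (Suc r)) p q"
    by (rule subquotient_page)
  show ?thesis
    unfolding dpage_kernel dpage_image unfolding page_def
    by (rule subquotient.mod_iso_quot_quot[OF subquotient_page Suc_r.submodule_A _
      Suc_r.submodule_B Suc_r.B_subset_A])
      (simp_all add: page_cycles_antimono page_boundaries_mono)
qed

theorem ss_pages_page: "ss_pages R page dpage"
  unfolding ss_pages_def
  using module_page linear_map.lin_maps[OF linear_map_dpage] dpage_dpage page_Suc_iso by blast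

lemma page_trivial:
  assumes "\<not> (0 \<le> p \<and> 0 \<le> q)"
  shows "carrier (page r p q) = {\<zero>\<^bsub>page r p q\<^esub>}"
proof -
  have "Fil p (p + q) \<subseteq> Fil (p - 1) (p + q)"
    using assms Fil_neg[of p] Fil_neg[of "p - 1"] Fil_top[of "p + q" p] Fil_top[of "p + q" "p - 1"]
    by (cases "p < 0") auto
  then have "lead p q x = \<zero>\<^bsub>D p q\<^esub>" if "x \<in> approx_cycles (int r) p (p + q)" for x
    using that lead_eq_zero_iff by (auto simp: approx_cycles_def)
  then have "carrier (page r p q) \<subseteq> {\<zero>\<^bsub>page r p q\<^esub>}"
    unfolding carrier_page by (auto simp: page_def subquotient.zero_quot[OF subquotient_page])
  then show ?thesis
    using abelian_monoid.zero_closed module_page unfolding module_def abelian_group_def by blast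
qed

definition filtered_cycles :: "int \<Rightarrow> int \<Rightarrow> 't set" where
  "filtered_cycles p n = {x \<in> Fil p n. d x = \<zero>\<^bsub>T\<^esub>}"

lemma submodule_filtered_cycles: "submodule (filtered_cycles p n) R T"
  using d.submodule_preimage[OF submodule_Fil d.M.submodule_zero_set]
  by (simp add: filtered_cycles_def)

lemma filtered_cycles_mono: "p \<le> p' \<Longrightarrow> filtered_cycles p n \<subseteq> filtered_cycles p' n"
  using Fil_mono by (auto simp: filtered_cycles_def)

lemma filtered_cycles_carrier: "x \<in> filtered_cycles p n \<Longrightarrow> x \<in> carrier T"
  by (rule d.M.submodule_mem_carrier[OF submodule_filtered_cycles])

lemma d_filtered_cycles: "x \<in> Fil n n \<Longrightarrow> d x \<in> filtered_cycles (n - 1) (n - 1)"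
  using d_Fil[of x n n] Fil_top[of "n - 1" n] by (simp add: filtered_cycles_def d_d Fil_carrier)

end

locale filtered_complex_homology = filtered_complex R T d Fil D lead
  for R :: "'r ring" and T :: "('r,'t) module" and d Fil
    and D :: "int \<Rightarrow> int \<Rightarrow> ('r,'e) module" and lead +
  fixes H :: "nat \<Rightarrow> ('r,'h) module" and h :: "nat \<Rightarrow> 't \<Rightarrow> 'h"
  assumes linear_map_h: "linear_map R (T\<lparr>carrier := filtered_cycles (int n) (int n)\<rparr>) (H n) (h n)"
    and h_onto: "h n ` filtered_cycles (int n) (int n) = carrier (H n)"
    and h_eq_zero_iff: "x \<in> filtered_cycles (int n) (int n) \<Longrightarrow>
      h n x = \<zero>\<^bsub>H n\<^esub> \<longleftrightarrow> x \<in> d ` Fil (int n + 1) (int n + 1)"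
begin

definition homology_Fil :: "nat \<Rightarrow> int \<Rightarrow> 'h set" where
  "homology_Fil n p = h n ` filtered_cycles p (int n)"

sublocale h: linear_map R "T\<lparr>carrier := filtered_cycles (int n) (int n)\<rparr>" "H n" "h n" for n
  by (rule linear_map_h)

lemma linear_map_h_restrict:
  assumes "p \<le> int n"
  shows "linear_map R (T\<lparr>carrier := filtered_cycles p (int n)\<rparr>) (H n) (h n)"
  by (rule linear_map_restrict[OF d.M.module_axioms linear_map_h submodule_filtered_cycles
        filtered_cycles_mono[OF assms]])

lemma submodule_homology_Fil: "p \<le> int n \<Longrightarrow> submodule (homology_Fil n p) R (H n)"
  unfolding homology_Fil_def using linear_map.submodule_range[OF linear_map_h_restrict] by simp

lemma homology_Fil_mono: "p \<le> p' \<Longrightarrow> homology_Fil n p \<subseteq> homology_Fil n p'"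
  unfolding homology_Fil_def using filtered_cycles_mono by blast

lemma homology_Fil_neg: "homology_Fil n (-1) = {\<zero>\<^bsub>H n\<^esub>}"
  using h.map_zero[of n] by (auto simp: homology_Fil_def filtered_cycles_def Fil_neg)

lemma homology_Fil_top: "homology_Fil n (int n) = carrier (H n)"
  by (simp add: homology_Fil_def h_onto)

lemma filtered_cycles_minus:
  "\<lbrakk>x \<in> filtered_cycles p n; y \<in> filtered_cycles p n\<rbrakk> \<Longrightarrow> x \<ominus>\<^bsub>T\<^esub> y \<in> filtered_cycles p n"
  by (rule d.M.submodule_minus[OF submodule_filtered_cycles])

lemma h_minus_eq_zero_iff:
  assumes "x \<in> filtered_cycles (int n) (int n)" "y \<in> filtered_cycles (int n) (int n)"
  shows "h n (x \<ominus>\<^bsub>T\<^esub> y) = \<zero>\<^bsub>H n\<^esub> \<longleftrightarrow> h n x = h n y"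
  using linear_map_restricted_minus[OF d.M.module_axioms linear_map_h submodule_filtered_cycles
      assms] h.map_closed[of _ n] assms
  by (simp add: h.N.minus_eq_zero_iff)

lemma page_boundaries_stable:
  assumes "int n \<le> p + r - 2"
  shows "page_boundaries r p (int n - p) =
    lead p (int n - p) ` (d ` Fil (int n + 1) (int n + 1) \<inter> Fil p (int n))"
  using assms Fil_top[of "int n + 1" "p + r - 1"]
  by (auto simp: page_boundaries_def approx_cycles_def)

lemma h_mem_homology_Fil_iff:
  assumes p: "p \<le> int n" and r: "int n \<le> p + r - 2"
    and z: "z \<in> filtered_cycles p (int n)"
  shows "h n z \<in> homology_Fil n (p - 1) \<longleftrightarrow> lead p (int n - p) z \<in> page_boundaries r p (int n - p)"
proof -
  let ?lead = "lead p (int n - p)"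
  note boundaries = page_boundaries_stable[OF r]
  have z_Fil: "z \<in> Fil p (int n)" "d z = \<zero>\<^bsub>T\<^esub>" using z by (auto simp: filtered_cycles_def)
  note top_cycle = subsetD[OF filtered_cycles_mono[OF p]]
  show ?thesis
  proof
    assume "h n z \<in> homology_Fil n (p - 1)"
    then obtain z' where z': "z' \<in> filtered_cycles (p - 1) (int n)" "h n z = h n z'"
      by (auto simp: homology_Fil_def)
    then have "z' \<in> filtered_cycles p (int n)" using filtered_cycles_mono[of "p - 1" p] by auto
    then have minus: "z \<ominus>\<^bsub>T\<^esub> z' \<in> filtered_cycles p (int n)"
      and "h n (z \<ominus>\<^bsub>T\<^esub> z') = \<zero>\<^bsub>H n\<^esub>"
      using z z'(2) h_minus_eq_zero_iff by (auto intro: filtered_cycles_minus top_cycle)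
    then have "z \<ominus>\<^bsub>T\<^esub> z' \<in> d ` Fil (int n + 1) (int n + 1)"
      using h_eq_zero_iff top_cycle by blast
    moreover have "z \<ominus>\<^bsub>T\<^esub> z' \<in> Fil p (int n)" using minus by (simp add: filtered_cycles_def)
    moreover have "?lead (z \<ominus>\<^bsub>T\<^esub> z') = ?lead z"
      by (rule lead_minus_lower) (use z_Fil z' in \<open>auto simp: filtered_cycles_def\<close>)
    ultimately show "?lead z \<in> page_boundaries r p (int n - p)"
      unfolding boundaries by (metis IntI imageI)
  next
    assume "?lead z \<in> page_boundaries r p (int n - p)"
    then obtain y where y: "y \<in> Fil (int n + 1) (int n + 1)" "d y \<in> Fil p (int n)"
        "?lead z = ?lead (d y)"
      unfolding boundaries by blast
    then have dy: "d y \<in> filtered_cycles p (int n)"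
      by (simp add: filtered_cycles_def d_d Fil_carrier)
    have "z \<ominus>\<^bsub>T\<^esub> d y \<in> Fil (p - 1) (int n)"
      using lead_eq_iff[of z p "int n - p" "d y"] z_Fil y by simp
    then have lower: "z \<ominus>\<^bsub>T\<^esub> d y \<in> filtered_cycles (p - 1) (int n)"
      using filtered_cycles_minus[OF z dy] by (simp add: filtered_cycles_def)
    have "h n (d y) = \<zero>\<^bsub>H n\<^esub>" using h_eq_zero_iff dy y(1) top_cycle by blast
    then have "h n (z \<ominus>\<^bsub>T\<^esub> (z \<ominus>\<^bsub>T\<^esub> d y)) = \<zero>\<^bsub>H n\<^esub>"
      using z dy by (simp add: d.M.minus_minus_cancel filtered_cycles_carrier)
    then have "h n z = h n (z \<ominus>\<^bsub>T\<^esub> d y)"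
      using h_minus_eq_zero_iff z filtered_cycles_minus[OF z dy] top_cycle by blast
    then show "h n z \<in> homology_Fil n (p - 1)" using lower by (auto simp: homology_Fil_def)
  qed
qed

lemma graded_homology_iso:
  assumes p: "0 \<le> p" "p \<le> int n"
  shows "mod_iso R (quot_mod (H n) (homology_Fil n p) (homology_Fil n (p - 1)))
    (E_inf page p (int n - p))"
proof -
  let ?q = "int n - p"
  define r where "r = max (p + 1) (?q + 2)"
  have r: "p - r < 0" "int n \<le> p + r - 2" by (auto simp: r_def)
  have "approx_cycles r p (p + ?q) = filtered_cycles p (int n)"
    using Fil_neg[OF r(1)] by (auto simp: approx_cycles_def filtered_cycles_def)
  then have cycles: "page_cycles r p ?q = lead p ?q ` filtered_cycles p (int n)"
    by (simp add: page_cycles_def)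
  interpret S: subquotient R "H n" "homology_Fil n p" "homology_Fil n (p - 1)"
    using p by (intro subquotient.intro subquotient_axioms.intro h.N.module_axioms
        submodule_homology_Fil homology_Fil_mono) auto
  interpret T: subquotient R "D p ?q" "page_cycles r p ?q" "page_boundaries r p ?q"
    by (rule subquotient_page)
  interpret span: subquotient_span R "H n" "homology_Fil n p" "homology_Fil n (p - 1)"
    "D p ?q" "page_cycles r p ?q" "page_boundaries r p ?q" "T\<lparr>carrier := filtered_cycles p (int n)\<rparr>"
      "h n" "lead p ?q"
  proof (intro subquotient_span.intro subquotient_span_axioms.intro S.subquotient_axioms
    T.subquotient_axioms)
    show "linear_map R (T\<lparr>carrier := filtered_cycles p (int n)\<rparr>) (H n) (h n)"
      by (rule linear_map_h_restrict[OF p(2)])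
    show "linear_map R (T\<lparr>carrier := filtered_cycles p (int n)\<rparr>) (D p ?q) (lead p ?q)"
      by (rule linear_map_comp[OF linear_map_inclusion[OF d.M.module_axioms submodule_filtered_cycles]
        linear_map_lead])
  qed (use h_mem_homology_Fil_iff[OF p(2) r(2)] cycles in \<open>auto simp: homology_Fil_def\<close>)
  have "mod_iso R S.quot T.quot"
    by (rule span.mod_iso_quot) (use h_mem_homology_Fil_iff[OF p(2) r(2)] cycles in auto)
  moreover have "int (nat (max (p + 1) (?q + 2))) = r" using p by (simp add: r_def)
  ultimately show ?thesis by (simp add: E_inf_def page_def)
qed

theorem converging_ss_page:
  assumes "\<And>p q. mod_iso R (page 2 (int p) (int q)) (E2 p q)"
  shows "converging_ss R page dpage E2 H"
  unfolding converging_ss_def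
proof (intro conjI allI ss_pages_page)
  show "0 \<le> p \<and> 0 \<le> q \<longrightarrow> mod_iso R (page 2 p q) (E2 (nat p) (nat q))" for p q
    using assms[of "nat p" "nat q"] by auto
  show "\<not> (0 \<le> p \<and> 0 \<le> q) \<longrightarrow> carrier (page 2 p q) = {\<zero>\<^bsub>page 2 p q\<^esub>}" for p q
    using page_trivial by blast
  show "\<exists>\<Phi>. \<Phi> (-1) = {\<zero>\<^bsub>H n\<^esub>} \<and> \<Phi> (int n) = carrier (H n)
      \<and> (\<forall>p. 0 \<le> p \<and> p \<le> int n \<longrightarrow> submodule (\<Phi> p) R (H n) \<and> \<Phi> (p - 1) \<subseteq> \<Phi> p
          \<and> mod_iso R (quot_mod (H n) (\<Phi> p) (\<Phi> (p - 1))) (E_inf page p (int n - p)))" for n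
    by (intro exI[of _ "homology_Fil n"] conjI allI impI)
      (simp_all add: homology_Fil_neg homology_Fil_top submodule_homology_Fil homology_Fil_mono
        graded_homology_iso)
qed

end

section \<open>Products and signs\<close>

definition prod_mod :: "'i set \<Rightarrow> ('i \<Rightarrow> ('r,'m) module) \<Rightarrow> ('r, 'i \<Rightarrow> 'm) module" where
  "prod_mod I M = \<lparr>carrier = {s. (\<forall>i\<in>I. s i \<in> carrier (M i)) \<and> (\<forall>i. i \<notin> I \<longrightarrow> s i = undefined)},
     monoid.mult = (\<lambda>s t. undefined), one = undefined,
     zero = (\<lambda>i. if i \<in> I then \<zero>\<^bsub>M i\<^esub> else undefined),
     add = (\<lambda>s t i. if i \<in> I then s i \<oplus>\<^bsub>M i\<^esub> t i else undefined),
     smult = (\<lambda>a s i. if i \<in> I then a \<odot>\<^bsub>M i\<^esub> s i else undefined)\<rparr>"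

definition prod_single :: "'i set \<Rightarrow> ('i \<Rightarrow> ('r,'m) module) \<Rightarrow> 'i \<Rightarrow> 'm \<Rightarrow> 'i \<Rightarrow> 'm" where
  "prod_single I M i m = (\<lambda>j. if j \<in> I then (if j = i then m else \<zero>\<^bsub>M j\<^esub>) else undefined)"

lemma prod_mod_simps:
  "s \<in> carrier (prod_mod I M) \<longleftrightarrow> (\<forall>i\<in>I. s i \<in> carrier (M i)) \<and> (\<forall>i. i \<notin> I \<longrightarrow> s i = undefined)"
  "\<zero>\<^bsub>prod_mod I M\<^esub> = (\<lambda>i. if i \<in> I then \<zero>\<^bsub>M i\<^esub> else undefined)"
  "s \<oplus>\<^bsub>prod_mod I M\<^esub> t = (\<lambda>i. if i \<in> I then s i \<oplus>\<^bsub>M i\<^esub> t i else undefined)"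
  "a \<odot>\<^bsub>prod_mod I M\<^esub> s = (\<lambda>i. if i \<in> I then a \<odot>\<^bsub>M i\<^esub> s i else undefined)"
  by (auto simp: prod_mod_def)

lemma prod_mod_eqI:
  assumes "s \<in> carrier (prod_mod I M)" "t \<in> carrier (prod_mod I M)" "\<And>i. i \<in> I \<Longrightarrow> s i = t i"
  shows "s = t"
proof
  show "s i = t i" for i using assms by (cases "i \<in> I") (auto simp: prod_mod_simps)
qed

locale module_family =
  fixes R :: "'r ring" and I :: "'i set" and M :: "'i \<Rightarrow> ('r,'m) module"
  assumes cring: "cring R" and module: "i \<in> I \<Longrightarrow> module R (M i)"
begin

lemma module_prod: "module R (prod_mod I M)"
proof (rule moduleI)
  note abelian_group = module.axioms(2)[OF module]
  note abelian_group_laws = abelian_groupE[OF abelian_group]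
  show "cring R" by (rule cring)
  show "abelian_group (prod_mod I M)"
  proof (rule abelian_groupI)
    show "\<exists>y\<in>carrier (prod_mod I M). y \<oplus>\<^bsub>prod_mod I M\<^esub> x = \<zero>\<^bsub>prod_mod I M\<^esub>"
      if "x \<in> carrier (prod_mod I M)" for x
      using that abelian_group.a_inv_closed[OF abelian_group] abelian_group.l_neg[OF abelian_group]
      by (intro bexI[of _ "\<lambda>i. if i \<in> I then \<ominus>\<^bsub>M i\<^esub> x i else undefined"]) (auto simp: prod_mod_simps)
  qed (auto simp: prod_mod_simps fun_eq_iff abelian_group_laws(1-3,5) intro: abelian_group_laws(4))
qed (auto simp: prod_mod_simps fun_eq_iff module.smult_closed[OF module]
  module.smult_l_distr[OF module] module.smult_r_distr[OF module]
  module.smult_assoc1[OF module] module.smult_one[OF module])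

lemma linear_map_entry: "i \<in> I \<Longrightarrow> linear_map R (prod_mod I M) (M i) (\<lambda>s. s i)"
  by (rule linear_mapI) (auto simp: prod_mod_simps module_prod module)

lemma linear_map_prodI:
  assumes "module R N" "\<And>i. i \<in> I \<Longrightarrow> linear_map R N (M i) (\<lambda>x. f x i)"
    and "\<And>x i. i \<notin> I \<Longrightarrow> f x i = undefined"
  shows "linear_map R N (prod_mod I M) f"
  by (rule linear_mapI)
    (auto simp: prod_mod_simps fun_eq_iff assms(1,3) module_prod linear_map.map_closed[OF assms(2)]
      linear_map.map_add[OF assms(2)] linear_map.map_smult[OF assms(2)])

lemma linear_map_prod_single:
  assumes "i \<in> I"
  shows "linear_map R (M i) (prod_mod I M) (prod_single I M i)"
proof (rule linear_map_prodI[OF module[OF assms]])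
  show "linear_map R (M i) (M j) (\<lambda>m. prod_single I M i m j)" if "j \<in> I" for j
    using that linear_map_id[OF module[OF assms]]
      linear_map_zero[OF module[OF assms] module[OF that]]
    by (cases "j = i") (simp_all add: prod_single_def)
qed (simp add: prod_single_def)

lemma finsum_prod_entry:
  assumes "\<And>j. j \<in> A \<Longrightarrow> f j \<in> carrier (prod_mod I M)" "i \<in> I"
  shows "(\<Oplus>\<^bsub>prod_mod I M\<^esub>j\<in>A. f j) i = (\<Oplus>\<^bsub>M i\<^esub>j\<in>A. f j i)"
  by (rule linear_map.map_finsum[OF linear_map_entry[OF assms(2)] assms(1)])

lemma prod_eq_finsum_single:
  assumes "finite I" and s: "s \<in> carrier (prod_mod I M)"
  shows "s = (\<Oplus>\<^bsub>prod_mod I M\<^esub>j\<in>I. prod_single I M j (s j))"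
proof -
  interpret P: module R "prod_mod I M" by (rule module_prod)
  have single_closed: "prod_single I M j (s j) \<in> carrier (prod_mod I M)" if "j \<in> I" for j
    using that s
    by (intro linear_map.map_closed[OF linear_map_prod_single]) (auto simp: prod_mod_simps)
  show ?thesis
  proof (rule prod_mod_eqI[OF s])
    show "(\<Oplus>\<^bsub>prod_mod I M\<^esub>j\<in>I. prod_single I M j (s j)) \<in> carrier (prod_mod I M)"
      using single_closed by (intro P.finsum_closed) auto
    fix i assume i: "i \<in> I"
    interpret Mi: module R "M i" by (rule module[OF i])
    have "(\<Oplus>\<^bsub>prod_mod I M\<^esub>j\<in>I. prod_single I M j (s j)) i = (\<Oplus>\<^bsub>M i\<^esub>j\<in>I. prod_single I M j (s j) i)"
      by (rule finsum_prod_entry[OF single_closed i])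
    also have "\<dots> = (\<Oplus>\<^bsub>M i\<^esub>j\<in>I. if i = j then s i else \<zero>\<^bsub>M i\<^esub>)"
      using s i by (intro Mi.finsum_cong') (auto simp: prod_single_def prod_mod_simps)
    also have "\<dots> = s i"
      using s i assms(1) by (intro Mi.finsum_singleton) (auto simp: prod_mod_simps)
    finally show "s i = (\<Oplus>\<^bsub>prod_mod I M\<^esub>j\<in>I. prod_single I M j (s j)) i" by simp
  qed
qed

lemma linear_map_prod_eqI:
  assumes "finite I" and f: "linear_map R (prod_mod I M) N f"
    and g: "linear_map R (prod_mod I M) N g"
    and eq: "\<And>i m. \<lbrakk>i \<in> I; m \<in> carrier (M i)\<rbrakk> \<Longrightarrow> f (prod_single I M i m) = g (prod_single I M i m)"
    and s: "s \<in> carrier (prod_mod I M)"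
  shows "f s = g s"
proof -
  interpret f: linear_map R "prod_mod I M" N f by fact
  interpret g: linear_map R "prod_mod I M" N g by fact
  have s_entry: "s j \<in> carrier (M j)" if "j \<in> I" for j using s that by (simp add: prod_mod_simps)
  have single_closed: "prod_single I M j (s j) \<in> carrier (prod_mod I M)" if "j \<in> I" for j
    by (rule linear_map.map_closed[OF linear_map_prod_single[OF that] s_entry[OF that]])
  have "f s = (\<Oplus>\<^bsub>N\<^esub>j\<in>I. f (prod_single I M j (s j)))"
    by (subst prod_eq_finsum_single[OF assms(1) s]) (rule f.map_finsum[OF single_closed])
  also have "\<dots> = (\<Oplus>\<^bsub>N\<^esub>j\<in>I. g (prod_single I M j (s j)))"
    using single_closed by (intro f.N.finsum_cong') (auto simp: eq s_entry)
  also have "\<dots> = g s"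
    by (subst (2) prod_eq_finsum_single[OF assms(1) s])
      (rule g.map_finsum[OF single_closed, symmetric])
  finally show ?thesis .
qed

lemma finsum_prod_single:
  assumes "finite I" "\<And>i. i \<in> I \<Longrightarrow> linear_map R (M i) N (f i)" "i \<in> I" "m \<in> carrier (M i)"
  shows "(\<Oplus>\<^bsub>N\<^esub>j\<in>I. f j (prod_single I M i m j)) = f i m"
proof -
  interpret f_i: linear_map R "M i" N "f i" by (rule assms(2)[OF assms(3)])
  have "(\<Oplus>\<^bsub>N\<^esub>j\<in>I. f j (prod_single I M i m j)) = (\<Oplus>\<^bsub>N\<^esub>j\<in>I. if i = j then f i m else \<zero>\<^bsub>N\<^esub>)"
    using assms(4) linear_map.map_zero[OF assms(2)]
    by (intro f_i.N.finsum_cong') (auto simp: prod_single_def)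
  also have "\<dots> = f i m" using assms(1,3,4) by (intro f_i.N.finsum_singleton) auto
  finally show ?thesis .
qed

end

definition signed :: "('a,'b) ring_scheme \<Rightarrow> nat \<Rightarrow> 'a \<Rightarrow> 'a" where
  "signed M i x = (if even i then x else \<ominus>\<^bsub>M\<^esub> x)"

context abelian_group
begin

lemma signed_closed [simp, intro]: "x \<in> carrier G \<Longrightarrow> signed G i x \<in> carrier G"
  by (simp add: signed_def)

lemma signed_0 [simp]: "signed G 0 x = x"
  by (simp add: signed_def)

lemma signed_Suc: "x \<in> carrier G \<Longrightarrow> signed G (Suc i) x = \<ominus> signed G i x"
  by (simp add: signed_def)

lemma signed_uminus: "x \<in> carrier G \<Longrightarrow> signed G i (\<ominus> x) = \<ominus> signed G i x"
  by (simp add: signed_def)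

lemma signed_involution [simp]: "x \<in> carrier G \<Longrightarrow> signed G i (signed G i x) = x"
  by (simp add: signed_def)

lemma signed_commute: "x \<in> carrier G \<Longrightarrow> signed G i (signed G j x) = signed G j (signed G i x)"
  by (simp add: signed_def)

end

lemma linear_map_signed: "module R M \<Longrightarrow> linear_map R M M (signed M i)"
  unfolding signed_def
  using linear_map_id[of R M] linear_map_uminus[of R M] by (cases "even i") auto

lemma (in linear_map) map_signed: "x \<in> carrier M \<Longrightarrow> f (signed M i x) = signed N i (f x)"
  by (simp add: signed_def map_uminus)

text \<open>The cancellation behind \<open>d d = 0\<close> in a simplicial module, where \<open>g i j\<close> is the \<open>i\<close>-th face of
  the \<open>j\<close>-th face.\<close>

lemma alternating_double_sum_eq_zero:
  fixes R :: "'r ring" and M :: "('r,'a) module"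
  assumes "module R M" and g_closed: "\<And>i j. g i j \<in> carrier M"
    and "\<And>i j. \<lbrakk>i < j; j \<le> Suc n\<rbrakk> \<Longrightarrow> g i j = g (j - 1) i"
  shows "(\<Oplus>\<^bsub>M\<^esub>j\<in>{..Suc n}. signed M j (\<Oplus>\<^bsub>M\<^esub>i\<in>{..n}. signed M i (g i j))) = \<zero>\<^bsub>M\<^esub>"
  using assms(3)
proof (induction n)
  interpret M: module R M by fact
  case 0
  have "g 0 1 = g 0 0" using 0[of 0 1] by simp
  then show ?case using g_closed by (simp add: M.signed_Suc M.l_neg)
next
  interpret M: module R M by fact
  case (Suc n)
  let ?s = "signed M"
  let ?row = "\<lambda>j. \<Oplus>\<^bsub>M\<^esub>i\<in>{..n}. ?s i (g i j)"
  let ?last = "\<Oplus>\<^bsub>M\<^esub>j\<in>{..Suc n}. ?s j (g (Suc n) j)"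
  interpret sign: linear_map R M M "?s i" for i by (rule linear_map_signed[OF assms(1)])
  have row_closed: "?row j \<in> carrier M" for j using g_closed by (intro M.finsum_closed) auto
  have last_closed: "?last \<in> carrier M" using g_closed by (intro M.finsum_closed) auto
  have row_Suc: "(\<Oplus>\<^bsub>M\<^esub>i\<in>{..Suc n}. ?s i (g i j)) = ?s (Suc n) (g (Suc n) j) \<oplus>\<^bsub>M\<^esub> ?row j" for j
    using g_closed by (intro M.finsum_Suc) auto
  have "(\<Oplus>\<^bsub>M\<^esub>j\<in>{..Suc n}. ?s j (?s (Suc n) (g (Suc n) j) \<oplus>\<^bsub>M\<^esub> ?row j))
    = (\<Oplus>\<^bsub>M\<^esub>j\<in>{..Suc n}. ?s (Suc n) (?s j (g (Suc n) j)) \<oplus>\<^bsub>M\<^esub> ?s j (?row j))"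
    using g_closed row_closed by (intro M.finsum_cong') (auto simp: sign.map_add M.signed_commute)
  also have "\<dots> = (\<Oplus>\<^bsub>M\<^esub>j\<in>{..Suc n}. ?s (Suc n) (?s j (g (Suc n) j))) \<oplus>\<^bsub>M\<^esub> (\<Oplus>\<^bsub>M\<^esub>j\<in>{..Suc n}. ?s j (?row j))"
    using g_closed row_closed by (intro M.finsum_addf) auto
  also have "(\<Oplus>\<^bsub>M\<^esub>j\<in>{..Suc n}. ?s (Suc n) (?s j (g (Suc n) j))) = ?s (Suc n) ?last"
    by (rule sign.map_finsum[symmetric]) (use g_closed in auto)
  also have "(\<Oplus>\<^bsub>M\<^esub>j\<in>{..Suc n}. ?s j (?row j)) = \<zero>\<^bsub>M\<^esub>"
    by (rule Suc.IH) (use Suc.prems in auto)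
  finally have lower: "(\<Oplus>\<^bsub>M\<^esub>j\<in>{..Suc n}. ?s j (?s (Suc n) (g (Suc n) j) \<oplus>\<^bsub>M\<^esub> ?row j))
      = ?s (Suc n) ?last"
    using last_closed by simp
  have top: "(\<Oplus>\<^bsub>M\<^esub>i\<in>{..Suc n}. ?s i (g i (Suc (Suc n)))) = ?last"
    using g_closed by (intro M.finsum_cong') (auto simp: Suc.prems)
  have "(\<Oplus>\<^bsub>M\<^esub>j\<in>{..Suc (Suc n)}. ?s j (\<Oplus>\<^bsub>M\<^esub>i\<in>{..Suc n}. ?s i (g i j)))
    = ?s (Suc (Suc n)) ?last \<oplus>\<^bsub>M\<^esub> (\<Oplus>\<^bsub>M\<^esub>j\<in>{..Suc n}. ?s j (\<Oplus>\<^bsub>M\<^esub>i\<in>{..Suc n}. ?s i (g i j)))"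
    unfolding top[symmetric] using g_closed row_closed by (intro M.finsum_Suc) (auto simp: row_Suc)
  then show ?case unfolding row_Suc lower
    using last_closed by (simp add: M.signed_Suc[of _ "Suc n"] M.l_neg)
qed

section \<open>Double complexes\<close>

definition complex_cycles :: "(nat \<Rightarrow> ('r,'a) module) \<Rightarrow> (nat \<Rightarrow> 'a \<Rightarrow> 'a) \<Rightarrow> nat \<Rightarrow> 'a set" where
  "complex_cycles C d n =
     (if n = 0 then carrier (C 0) else {x \<in> carrier (C n). d (n - 1) x = \<zero>\<^bsub>C (n - 1)\<^esub>})"

definition complex_boundaries :: "(nat \<Rightarrow> ('r,'a) module) \<Rightarrow> (nat \<Rightarrow> 'a \<Rightarrow> 'a) \<Rightarrow> nat \<Rightarrow> 'a set" where
  "complex_boundaries C d n = d n ` carrier (C (Suc n))"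

definition complex_homology ::
    "(nat \<Rightarrow> ('r,'a) module) \<Rightarrow> (nat \<Rightarrow> 'a \<Rightarrow> 'a) \<Rightarrow> nat \<Rightarrow> ('r,'a set) module" where
  "complex_homology C d n = quot_mod (C n) (complex_cycles C d n) (complex_boundaries C d n)"

locale chain_complex =
  fixes R :: "'r ring" and C :: "nat \<Rightarrow> ('r,'a) module" and d :: "nat \<Rightarrow> 'a \<Rightarrow> 'a"
  assumes linear_map_d: "linear_map R (C (Suc n)) (C n) (d n)"
    and d_d: "x \<in> carrier (C (Suc (Suc n))) \<Longrightarrow> d n (d (Suc n) x) = \<zero>\<^bsub>C n\<^esub>"
begin

sublocale d: linear_map R "C (Suc n)" "C n" "d n" for n
  by (rule linear_map_d)

lemma complex_cycles_Suc:
  "x \<in> complex_cycles C d (Suc n) \<longleftrightarrow> x \<in> carrier (C (Suc n)) \<and> d n x = \<zero>\<^bsub>C n\<^esub>"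
  by (simp add: complex_cycles_def)

lemma subquotient_homology: "subquotient R (C n) (complex_cycles C d n) (complex_boundaries C d n)"
proof (intro subquotient.intro subquotient_axioms.intro d.N.module_axioms)
  show "submodule (complex_cycles C d n) R (C n)"
    using d.N.carrier_is_submodule[of 0] d.submodule_kernel
    by (cases n) (simp_all add: complex_cycles_def)
  show "submodule (complex_boundaries C d n) R (C n)"
    unfolding complex_boundaries_def by (rule d.submodule_range)
  show "complex_boundaries C d n \<subseteq> complex_cycles C d n"
    by (cases n) (auto simp: complex_boundaries_def complex_cycles_def d_d)
qed

sublocale homology: subquotient R "C n" "complex_cycles C d n" "complex_boundaries C d n" for n
  by (rule subquotient_homology)

end

lemma (in module) submodule_signed: "\<lbrakk>submodule H R M; x \<in> H\<rbrakk> \<Longrightarrow> signed M i x \<in> H"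
  using submoduleE(3) by (simp add: signed_def)

locale double_complex =
  fixes R :: "'r ring" and D :: "nat \<Rightarrow> nat \<Rightarrow> ('r,'e) module"
    and dh dv :: "nat \<Rightarrow> nat \<Rightarrow> 'e \<Rightarrow> 'e"
  assumes linear_map_dh: "linear_map R (D (Suc p) q) (D p q) (dh p q)"
    and linear_map_dv: "linear_map R (D p (Suc q)) (D p q) (dv p q)"
    and dh_dh: "x \<in> carrier (D (Suc (Suc p)) q) \<Longrightarrow> dh p q (dh (Suc p) q x) = \<zero>\<^bsub>D p q\<^esub>"
    and dv_dv: "x \<in> carrier (D p (Suc (Suc q))) \<Longrightarrow> dv p q (dv p (Suc q) x) = \<zero>\<^bsub>D p q\<^esub>"
    and dh_dv: "x \<in> carrier (D (Suc p) (Suc q)) \<Longrightarrow> dh p q (dv (Suc p) q x) = dv p q (dh p (Suc q) x)"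
begin

sublocale dh: linear_map R "D (Suc p) q" "D p q" "dh p q" for p q
  by (rule linear_map_dh)

sublocale dv: linear_map R "D p (Suc q)" "D p q" "dv p q" for p q
  by (rule linear_map_dv)

sublocale vertical: chain_complex R "D p" "dv p" for p
  by unfold_locales (auto simp: dv_dv)

sublocale entries: module_family R UNIV "\<lambda>(p,q). D p q"
  by (rule module_family.intro)
    (auto intro: module.axioms(1)[OF dh.N.module_axioms] dh.N.module_axioms)

abbreviation Total :: "('r, nat \<times> nat \<Rightarrow> 'e) module" where
  "Total \<equiv> prod_mod UNIV (\<lambda>(p,q). D p q)"

abbreviation single :: "nat \<Rightarrow> nat \<Rightarrow> 'e \<Rightarrow> nat \<times> nat \<Rightarrow> 'e" where
  "single p q \<equiv> prod_single UNIV (\<lambda>(p,q). D p q) (p,q)"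

definition tot_d :: "(nat \<times> nat \<Rightarrow> 'e) \<Rightarrow> nat \<times> nat \<Rightarrow> 'e" where
  "tot_d x = (\<lambda>(p,q). dh p q (x (Suc p, q)) \<oplus>\<^bsub>D p q\<^esub> signed (D p q) p (dv p q (x (p, Suc q))))"

definition Fil :: "int \<Rightarrow> int \<Rightarrow> (nat \<times> nat \<Rightarrow> 'e) set" where
  "Fil p n = {x \<in> carrier Total. \<forall>i j. \<not> (int i \<le> p \<and> int i + int j = n) \<longrightarrow> x (i,j) = \<zero>\<^bsub>D i j\<^esub>}"

abbreviation vcycles :: "nat \<Rightarrow> nat \<Rightarrow> 'e set" where
  "vcycles p q \<equiv> complex_cycles (D p) (dv p) q"

abbreviation vboundaries :: "nat \<Rightarrow> nat \<Rightarrow> 'e set" where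
  "vboundaries p q \<equiv> complex_boundaries (D p) (dv p) q"

lemma Total_simps:
  "x \<in> carrier Total \<longleftrightarrow> (\<forall>p q. x (p,q) \<in> carrier (D p q))"
  "\<zero>\<^bsub>Total\<^esub> (p,q) = \<zero>\<^bsub>D p q\<^esub>" "(x \<oplus>\<^bsub>Total\<^esub> y) (p,q) = x (p,q) \<oplus>\<^bsub>D p q\<^esub> y (p,q)"
  "(a \<odot>\<^bsub>Total\<^esub> x) (p,q) = a \<odot>\<^bsub>D p q\<^esub> x (p,q)"
  by (auto simp: prod_mod_simps)

lemma Total_eqI: "(\<And>p q. x (p,q) = y (p,q)) \<Longrightarrow> x = y"
  by auto

lemma linear_map_entry: "linear_map R Total (D p q) (\<lambda>x. x (p,q))"
  using entries.linear_map_entry[of "(p,q)"] by simp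

lemma entry_closed [simp, intro]: "x \<in> carrier Total \<Longrightarrow> x (p,q) \<in> carrier (D p q)"
  by (simp add: Total_simps)

lemma Total_minus: "\<lbrakk>x \<in> carrier Total; y \<in> carrier Total\<rbrakk> \<Longrightarrow>
    (x \<ominus>\<^bsub>Total\<^esub> y) (p,q) = x (p,q) \<ominus>\<^bsub>D p q\<^esub> y (p,q)"
  by (rule linear_map.map_minus[OF linear_map_entry])

lemma single_entry: "single p q v (i,j) = (if i = p \<and> j = q then v else \<zero>\<^bsub>D i j\<^esub>)"
  by (auto simp: prod_single_def)

lemma tot_d_entry:
  "tot_d x (p,q) = dh p q (x (Suc p, q)) \<oplus>\<^bsub>D p q\<^esub> signed (D p q) p (dv p q (x (p, Suc q)))"
  by (simp add: tot_d_def)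

lemma signed_zero [simp]: "signed (D p q) i \<zero>\<^bsub>D p q\<^esub> = \<zero>\<^bsub>D p q\<^esub>"
  using linear_map.map_zero[OF linear_map_signed[OF dh.N.module_axioms]] .

lemma linear_map_tot_d: "linear_map R Total Total tot_d"
proof (rule entries.linear_map_prodI[OF entries.module_prod])
  show "linear_map R Total (case pq of (p,q) \<Rightarrow> D p q) (\<lambda>x. tot_d x pq)" for pq
  proof (cases pq)
    case (Pair p q)
    have "linear_map R Total (D p q)
        (\<lambda>x. dh p q (x (Suc p, q)) \<oplus>\<^bsub>D p q\<^esub> signed (D p q) p (dv p q (x (p, Suc q))))"
      by (intro linear_map_plus linear_map_comp[OF linear_map_entry linear_map_dh]
          linear_map_comp[OF linear_map_comp[OF linear_map_entry linear_map_dv] linear_map_signed]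
          dh.N.module_axioms)
    then show ?thesis by (simp add: Pair tot_d_entry)
  qed
qed simp

text \<open>The sign in \<^term>\<open>tot_d\<close> turns the commuting squares into anticommuting ones.\<close>

lemma tot_d_tot_d:
  assumes "x \<in> carrier Total"
  shows "tot_d (tot_d x) = \<zero>\<^bsub>Total\<^esub>"
proof (rule Total_eqI)
  fix p q
  let ?M = "D p q"
  let ?mixed = "signed ?M p (dv p q (dh p (Suc q) (x (Suc p, Suc q))))"
  interpret sign: linear_map R "D i j" "D i j" "signed (D i j) k" for i j k
    by (rule linear_map_signed[OF dh.N.module_axioms])
  have mixed_closed: "?mixed \<in> carrier ?M" using assms by simp
  have "dh p q (tot_d x (Suc p, q)) = \<ominus>\<^bsub>?M\<^esub> ?mixed"
    using assms
    by (simp add: tot_d_entry dh.map_add dh_dh dh.map_uminus dh.map_signed dh.N.signed_Suc dh_dv)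
  moreover have "signed ?M p (dv p q (tot_d x (p, Suc q))) = ?mixed"
    using assms by (simp add: tot_d_entry dv.map_add dv.map_signed dv_dv)
  ultimately show "tot_d (tot_d x) (p,q) = \<zero>\<^bsub>Total\<^esub> (p,q)"
    using mixed_closed by (simp add: tot_d_entry[of "tot_d x"] Total_simps dh.N.l_neg)
qed

lemma Fil_zero_entry: "\<lbrakk>x \<in> Fil p n; \<not> (int i \<le> p \<and> int i + int j = n)\<rbrakk> \<Longrightarrow> x (i,j) = \<zero>\<^bsub>D i j\<^esub>"
  by (simp add: Fil_def)

lemma submodule_Fil: "submodule (Fil p n) R Total"
proof -
  interpret Total: module R Total by (rule entries.module_prod)
  show ?thesis
    by (rule Total.submoduleI_add_smult) (auto simp: Fil_def Total_simps)
qed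

lemma Fil_neg: "p < 0 \<Longrightarrow> Fil p n = {\<zero>\<^bsub>Total\<^esub>}"
  by (auto simp: Fil_def Total_simps prod_mod_simps(2) fun_eq_iff)

lemma Fil_top: "n \<le> p \<Longrightarrow> Fil p n = Fil n n"
proof -
  assume "n \<le> p"
  then have "int i \<le> p \<and> int i + int j = n \<longleftrightarrow> int i \<le> n \<and> int i + int j = n" for i j by auto
  then show ?thesis by (simp add: Fil_def)
qed

lemma tot_d_Fil: "x \<in> Fil p n \<Longrightarrow> tot_d x \<in> Fil p (n - 1)"
  using linear_map.map_closed[OF linear_map_tot_d, of x]
  by (auto simp: Fil_def tot_d_entry)

lemma entry_eq_zero_iff_Fil:
  assumes x: "x \<in> Fil p (p + q)"
  shows "x (nat p, nat q) = \<zero>\<^bsub>D (nat p) (nat q)\<^esub> \<longleftrightarrow> x \<in> Fil (p - 1) (p + q)"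
proof
  assume zero: "x (nat p, nat q) = \<zero>\<^bsub>D (nat p) (nat q)\<^esub>"
  have "x (i,j) = \<zero>\<^bsub>D i j\<^esub>" if "\<not> (int i \<le> p - 1 \<and> int i + int j = p + q)" for i j
  proof (cases "int i = p \<and> int j = q")
    case True
    then have "i = nat p" "j = nat q" by auto
    then show ?thesis using zero by simp
  qed (use that Fil_zero_entry[OF x, of i j] in auto)
  then show "x \<in> Fil (p - 1) (p + q)" using x by (simp add: Fil_def)
next
  assume "x \<in> Fil (p - 1) (p + q)"
  then show "x (nat p, nat q) = \<zero>\<^bsub>D (nat p) (nat q)\<^esub>" by (rule Fil_zero_entry) linarith
qed

sublocale filtered_complex R Total tot_d Fil "\<lambda>p q. D (nat p) (nat q)" "\<lambda>p q x. x (nat p, nat q)"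
  by (intro filtered_complex.intro filtered_complex_axioms.intro linear_map_tot_d submodule_Fil
    Fil_neg Fil_top tot_d_Fil tot_d_tot_d linear_map_entry entry_eq_zero_iff_Fil) (auto simp:
    Fil_def)

lemma single_Fil: "\<lbrakk>v \<in> carrier (D p q); int p \<le> p'; int p + int q = n\<rbrakk> \<Longrightarrow> single p q v \<in> Fil p' n"
  by (auto simp: Fil_def Total_simps(1) single_entry)

section \<open>The second page of a double complex\<close>

lemma signed_dv_mem_vboundaries: "v \<in> carrier (D p (Suc q)) \<Longrightarrow>
    signed (D p q) i (dv p q v) \<in> vboundaries p q"
  by (intro dh.N.submodule_signed[OF vertical.homology.submodule_B])
    (simp add: complex_boundaries_def)

lemma approx_cycles_1_iff:
  "X \<in> approx_cycles 1 (int p) (int p + int q) \<longleftrightarrow>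
    X \<in> Fil (int p) (int p + int q) \<and> X (p,q) \<in> vcycles p q"
proof (cases "X \<in> Fil (int p) (int p + int q)")
  case True
  let ?degree = "int p + int q - 1"
  have X: "X \<in> carrier Total" by (rule Fil_carrier[OF True])
  have "tot_d X \<in> Fil (int p - 1) ?degree \<longleftrightarrow> X (p,q) \<in> vcycles p q"
  proof (cases q)
    case 0
    have "tot_d X \<in> Fil (int p - 1) ?degree"
      using d_Fil[OF True] Fil_top[of ?degree "int p"] by (simp add: 0)
    then show ?thesis using X by (simp add: 0 complex_cycles_def)
  next
    case (Suc l)
    have "X (Suc p, l) = \<zero>\<^bsub>D (Suc p) l\<^esub>" by (rule Fil_zero_entry[OF True]) simp
    then have "tot_d X (p,l) = signed (D p l) p (dv p l (X (p,q)))"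
      using X by (simp add: tot_d_entry Suc)
    moreover have "signed (D p l) p y = \<zero>\<^bsub>D p l\<^esub> \<longleftrightarrow> y = \<zero>\<^bsub>D p l\<^esub>" if "y \<in> carrier (D p l)" for y
      using dh.N.signed_involution[OF that, of p] by force
    ultimately show ?thesis
      using entry_eq_zero_iff_Fil[of "tot_d X" "int p" "int l"] d_Fil[OF True] X
      by (simp add: Suc vertical.complex_cycles_Suc)
  qed
  then show ?thesis using True by (simp add: approx_cycles_def)
qed (simp add: approx_cycles_def)

lemma approx_cycles_2_iff:
  "X \<in> approx_cycles 2 (int p) (int p + int q) \<longleftrightarrow>
     X \<in> approx_cycles 1 (int p) (int p + int q) \<and> (\<forall>k. p = Suc k \<longrightarrow> tot_d X (k,q) = \<zero>\<^bsub>D k q\<^esub>)"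
proof (cases p)
  case 0
  then show ?thesis by (simp add: approx_cycles_def Fil_neg)
next
  case (Suc k)
  have "tot_d X (k,q) = \<zero>\<^bsub>D k q\<^esub> \<longleftrightarrow> tot_d X \<in> Fil (int p - 2) (int p + int q - 1)"
    if "tot_d X \<in> Fil (int p - 1) (int p + int q - 1)"
    using that entry_eq_zero_iff_Fil[of "tot_d X" "int k" "int q"] by (simp add: Suc)
  moreover have "Fil (int p - 2) (int p + int q - 1) \<subseteq> Fil (int p - 1) (int p + int q - 1)"
    by (rule Fil_mono) simp
  ultimately show ?thesis unfolding approx_cycles_def using Suc by auto
qed

lemma approx_cycles_2_extend:
  assumes x: "x \<in> vcycles p q" and dx: "\<And>k. p = Suc k \<Longrightarrow> dh k q x \<in> vboundaries k q"
  obtains X where "X \<in> approx_cycles 2 (int p) (int p + int q)" "X (p,q) = x"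
proof -
  have x_closed: "x \<in> carrier (D p q)" using x by simp
  have "\<exists>X\<in>Fil (int p) (int p + int q). X (p,q) = x \<and> (\<forall>k. p = Suc k \<longrightarrow> tot_d X (k,q) = \<zero>\<^bsub>D k q\<^esub>)"
  proof (cases p)
    case 0
    then show ?thesis
      using x_closed
      by (intro bexI[of _ "single p q x"]) (auto simp: single_entry intro: single_Fil)
  next
    case (Suc k)
    then obtain w where w: "w \<in> carrier (D k (Suc q))" "dh k q x = dv k q w"
      using dx by (auto simp: complex_boundaries_def)
    let ?X = "single p q x \<oplus>\<^bsub>Total\<^esub> single k (Suc q) (signed (D k (Suc q)) p w)"
    have "?X \<in> Fil (int p) (int p + int q)"
      using x_closed w(1) d.M.submoduleE(5)[OF submodule_Fil] by (simp add: single_Fil Suc)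
    moreover have "?X (p,q) = x" "tot_d ?X (k,q) = \<zero>\<^bsub>D k q\<^esub>"
      using x_closed w
      by (simp_all add: Total_simps single_entry tot_d_entry Suc dv.map_signed dh.N.signed_Suc
          dh.N.signed_uminus dh.N.r_neg dv.map_uminus)
    ultimately show ?thesis using Suc by blast
  qed
  then obtain X where "X \<in> Fil (int p) (int p + int q)" "X (p,q) = x"
    "\<forall>k. p = Suc k \<longrightarrow> tot_d X (k,q) = \<zero>\<^bsub>D k q\<^esub>"
    by blast
  then show thesis
    using x by (intro that[of X]) (simp_all add: approx_cycles_2_iff approx_cycles_1_iff)
qed

lemma page_cycles_2_iff:
  "x \<in> page_cycles 2 (int p) (int q) \<longleftrightarrow>
     x \<in> vcycles p q \<and> (\<forall>k. p = Suc k \<longrightarrow> dh k q x \<in> vboundaries k q)"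
proof
  assume "x \<in> page_cycles 2 (int p) (int q)"
  then obtain X where X: "X \<in> approx_cycles 2 (int p) (int p + int q)" "x = X (p,q)"
    by (auto simp: page_cycles_def)
  have X_total: "X \<in> carrier Total" by (rule approx_cycles_carrier[OF X(1)])
  have "dh k q x \<in> vboundaries k q" if p: "p = Suc k" for k
  proof -
    let ?v = "signed (D k q) k (dv k q (X (k, Suc q)))"
    have "?v \<in> vboundaries k q" using X_total by (intro signed_dv_mem_vboundaries) simp
    moreover have "dh k q x \<oplus>\<^bsub>D k q\<^esub> ?v = \<zero>\<^bsub>D k q\<^esub>"
      using X(1) p unfolding approx_cycles_2_iff X(2) by (simp add: tot_d_entry)
    then have "dh k q x = \<ominus>\<^bsub>D k q\<^esub> ?v" using X_total p X(2) by (simp add: dh.N.minus_equality)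
    ultimately show ?thesis using dh.N.submoduleE(3)[OF vertical.homology.submodule_B] by simp
  qed
  then show "x \<in> vcycles p q \<and> (\<forall>k. p = Suc k \<longrightarrow> dh k q x \<in> vboundaries k q)"
    using X by (simp add: approx_cycles_2_iff approx_cycles_1_iff)
next
  assume "x \<in> vcycles p q \<and> (\<forall>k. p = Suc k \<longrightarrow> dh k q x \<in> vboundaries k q)"
  then obtain X where "X \<in> approx_cycles 2 (int p) (int p + int q)" "X (p,q) = x"
    using approx_cycles_2_extend by blast
  then show "x \<in> page_cycles 2 (int p) (int q)" by (force simp: page_cycles_def)
qed

lemma page_boundaries_2_iff:
  "x \<in> page_boundaries 2 (int p) (int q) \<longleftrightarrow>
     (\<exists>y\<in>vcycles (Suc p) q. \<exists>z\<in>vboundaries p q. x = dh p q y \<oplus>\<^bsub>D p q\<^esub> z)"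
proof -
  have cycles: "Y \<in> approx_cycles 1 (int p + 1) (int p + int q + 1) \<longleftrightarrow>
      Y \<in> Fil (int p + 1) (int p + int q + 1) \<and> Y (Suc p, q) \<in> vcycles (Suc p) q" for Y
    using approx_cycles_1_iff[of Y "Suc p" q] by (simp add: ac_simps)
  have boundaries: "x \<in> page_boundaries 2 (int p) (int q) \<longleftrightarrow>
      (\<exists>Y\<in>approx_cycles 1 (int p + 1) (int p + int q + 1). x = tot_d Y (p,q))"
    unfolding page_boundaries_def by (simp add: image_image image_iff ac_simps)
  show ?thesis
    unfolding boundaries
  proof
    assume "\<exists>Y\<in>approx_cycles 1 (int p + 1) (int p + int q + 1). x = tot_d Y (p,q)"
    then obtain Y where Y: "Y \<in> carrier Total" "Y (Suc p, q) \<in> vcycles (Suc p) q"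
        "x = tot_d Y (p,q)"
      using cycles Fil_carrier by blast
    have "signed (D p q) p (dv p q (Y (p, Suc q))) \<in> vboundaries p q"
      using Y(1) by (intro signed_dv_mem_vboundaries) simp
    then show "\<exists>y\<in>vcycles (Suc p) q. \<exists>z\<in>vboundaries p q. x = dh p q y \<oplus>\<^bsub>D p q\<^esub> z"
      using Y(2,3) by (auto simp: tot_d_entry)
  next
    assume "\<exists>y\<in>vcycles (Suc p) q. \<exists>z\<in>vboundaries p q. x = dh p q y \<oplus>\<^bsub>D p q\<^esub> z"
    then obtain y w where y_w: "y \<in> vcycles (Suc p) q" "w \<in> carrier (D p (Suc q))"
        "x = dh p q y \<oplus>\<^bsub>D p q\<^esub> dv p q w"
      by (auto simp: complex_boundaries_def)
    let ?Y = "single (Suc p) q y \<oplus>\<^bsub>Total\<^esub> single p (Suc q) (signed (D p (Suc q)) p w)"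
    have y_closed: "y \<in> carrier (D (Suc p) q)" using y_w(1) by simp
    have "?Y \<in> Fil (int p + 1) (int p + int q + 1)"
      using y_closed y_w(2) d.M.submoduleE(5)[OF submodule_Fil] by (simp add: single_Fil)
    moreover have "?Y (Suc p, q) = y" "tot_d ?Y (p,q) = x"
      using y_closed y_w(2,3) by (simp_all add: Total_simps single_entry tot_d_entry dv.map_signed)
    ultimately show "\<exists>Y\<in>approx_cycles 1 (int p + 1) (int p + int q + 1). x = tot_d Y (p,q)"
      using y_w(1) cycles by (intro bexI[of _ ?Y]) simp_all
  qed
qed

end

locale vertical_homology_model = double_complex R D dh dv + C: chain_complex R C dC
  for R :: "'r ring" and D :: "nat \<Rightarrow> nat \<Rightarrow> ('r,'e) module" and dh dv
    and C :: "nat \<Rightarrow> ('r,'c) module" and dC +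
  fixes q :: nat and h :: "nat \<Rightarrow> 'e \<Rightarrow> 'c"
  assumes linear_map_h: "linear_map R ((D p q)\<lparr>carrier := vcycles p q\<rparr>) (C p) (h p)"
    and h_onto: "h p ` vcycles p q = carrier (C p)"
    and h_eq_zero_iff: "x \<in> vcycles p q \<Longrightarrow> h p x = \<zero>\<^bsub>C p\<^esub> \<longleftrightarrow> x \<in> vboundaries p q"
    and h_dh: "x \<in> vcycles (Suc p) q \<Longrightarrow> h p (dh p q x) = dC p (h (Suc p) x)"
begin

sublocale h: linear_map R "(D p q)\<lparr>carrier := vcycles p q\<rparr>" "C p" "h p" for p
  by (rule linear_map_h)

lemma h_closed: "x \<in> vcycles p q \<Longrightarrow> h p x \<in> carrier (C p)"
  using h.map_closed by simp

lemma dh_vcycles: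
  assumes "x \<in> vcycles (Suc p) q"
  shows "dh p q x \<in> vcycles p q"
proof (cases q)
  case (Suc l)
  then show ?thesis using assms dh_dv[of x p l] by (simp add: vertical.complex_cycles_Suc)
qed (use assms in \<open>simp add: complex_cycles_def\<close>)

lemma mem_page_cycles_2_iff:
  "x \<in> page_cycles 2 (int p) (int q) \<longleftrightarrow> x \<in> vcycles p q \<and> h p x \<in> complex_cycles C dC p"
proof (cases p)
  case 0
  then show ?thesis unfolding page_cycles_2_iff by (auto simp: complex_cycles_def[of C] h_closed)
next
  case (Suc k)
  have "dh k q x \<in> vboundaries k q \<longleftrightarrow> dC k (h p x) = \<zero>\<^bsub>C k\<^esub>" if "x \<in> vcycles p q"
    using that h_eq_zero_iff[OF dh_vcycles] h_dh by (simp add: Suc)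
  then show ?thesis unfolding page_cycles_2_iff by (auto simp: Suc C.complex_cycles_Suc h_closed)
qed

lemma mem_page_boundaries_2_iff:
  assumes x: "x \<in> vcycles p q"
  shows "x \<in> page_boundaries 2 (int p) (int q) \<longleftrightarrow> h p x \<in> complex_boundaries C dC p"
proof -
  have "(\<exists>z\<in>vboundaries p q. x = dh p q y \<oplus>\<^bsub>D p q\<^esub> z) \<longleftrightarrow> h p x = dC p (h (Suc p) y)"
    if y: "y \<in> vcycles (Suc p) q" for y
  proof -
    note dy = dh_vcycles[OF y]
    have closed: "x \<in> carrier (D p q)" "dh p q y \<in> carrier (D p q)" using x dy by simp_all
    have "(\<exists>z\<in>vboundaries p q. x = dh p q y \<oplus>\<^bsub>D p q\<^esub> z) \<longleftrightarrow> x \<ominus>\<^bsub>D p q\<^esub> dh p q y \<in> vboundaries p q"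
      (is "?L \<longleftrightarrow> _")
    proof
      assume ?L
      then obtain z where "z \<in> vboundaries p q" "x = dh p q y \<oplus>\<^bsub>D p q\<^esub> z" by blast
      then show "x \<ominus>\<^bsub>D p q\<^esub> dh p q y \<in> vboundaries p q"
        using closed(2) dh.N.submodule_mem_carrier[OF vertical.homology.submodule_B]
        by (simp add: dh.N.a_comm[of "dh p q y"] dh.N.plus_minus_cancel)
    next
      assume "x \<ominus>\<^bsub>D p q\<^esub> dh p q y \<in> vboundaries p q"
      moreover have "x = dh p q y \<oplus>\<^bsub>D p q\<^esub> (x \<ominus>\<^bsub>D p q\<^esub> dh p q y)"
        using closed by (simp add: dh.N.a_comm[of "dh p q y"] dh.N.minus_plus_cancel)
      ultimately show ?L by blast
    qed
    also have "\<dots> \<longleftrightarrow> h p (x \<ominus>\<^bsub>D p q\<^esub> dh p q y) = \<zero>\<^bsub>C p\<^esub>"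
      using h_eq_zero_iff dh.N.submodule_minus[OF vertical.homology.submodule_A x dy] by blast
    also have "\<dots> \<longleftrightarrow> h p x = h p (dh p q y)"
      using linear_map_restricted_minus[OF dh.N.module_axioms linear_map_h
          vertical.homology.submodule_A x dy] h_closed[OF x] h_closed[OF dy]
      by (simp add: C.d.N.minus_eq_zero_iff)
    finally show ?thesis by (simp add: h_dh[OF y])
  qed
  then have "x \<in> page_boundaries 2 (int p) (int q) \<longleftrightarrow>
      (\<exists>y\<in>vcycles (Suc p) q. h p x = dC p (h (Suc p) y))"
    by (simp add: page_boundaries_2_iff)
  then show ?thesis by (auto simp: complex_boundaries_def[of C] h_onto[symmetric])
qed

theorem page_2_iso_homology: "mod_iso R (page 2 (int p) (int q)) (complex_homology C dC p)"
proof -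
  let ?A = "page_cycles 2 (int p) (int q)"
  interpret S: subquotient R "D p q" ?A "page_boundaries 2 (int p) (int q)"
    using subquotient_page[of "int p" "int q"] by simp
  interpret span: subquotient_span R "D p q" ?A "page_boundaries 2 (int p) (int q)"
    "C p" "complex_cycles C dC p" "complex_boundaries C dC p" "(D p q)\<lparr>carrier := ?A\<rparr>" "\<lambda>x. x" "h p"
  proof (intro subquotient_span.intro subquotient_span_axioms.intro S.subquotient_axioms
    C.subquotient_homology)
    show "linear_map R ((D p q)\<lparr>carrier := ?A\<rparr>) (D p q) (\<lambda>x. x)"
      by (rule linear_map_inclusion[OF dh.N.module_axioms S.submodule_A])
    show "linear_map R ((D p q)\<lparr>carrier := ?A\<rparr>) (C p) (h p)"
      by (rule linear_map_restrict[OF dh.N.module_axioms linear_map_h S.submodule_A])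
        (auto simp: mem_page_cycles_2_iff)
  qed (auto simp: mem_page_cycles_2_iff mem_page_boundaries_2_iff)
  have "mod_iso R S.quot (quot_mod (C p) (complex_cycles C dC p) (complex_boundaries C dC p))"
  proof (rule span.mod_iso_quot)
    have "complex_cycles C dC p \<subseteq> h p ` vcycles p q" unfolding h_onto by auto
    then show "h p ` carrier ((D p q)\<lparr>carrier := ?A\<rparr>) = complex_cycles C dC p"
      by (auto simp: mem_page_cycles_2_iff)
  qed (auto simp: mem_page_cycles_2_iff mem_page_boundaries_2_iff)
  then show ?thesis by (simp add: page_def complex_homology_def)
qed

end

section \<open>Augmented double complexes with exact rows\<close>

locale augmented_double_complex = double_complex R D dh dv + S: chain_complex R S dS
  for R :: "'r ring" and D :: "nat \<Rightarrow> nat \<Rightarrow> ('r,'e) module" and dh dv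
    and S :: "nat \<Rightarrow> ('r,'s) module" and dS +
  fixes eps :: "nat \<Rightarrow> 'e \<Rightarrow> 's"
  assumes linear_map_eps: "linear_map R (D 0 q) (S q) (eps q)"
    and eps_onto: "eps q ` carrier (D 0 q) = carrier (S q)"
    and eps_dv: "x \<in> carrier (D 0 (Suc q)) \<Longrightarrow> eps q (dv 0 q x) = dS q (eps (Suc q) x)"
    and eps_dh: "x \<in> carrier (D (Suc 0) q) \<Longrightarrow> eps q (dh 0 q x) = \<zero>\<^bsub>S q\<^esub>"
    and exact_0: "\<lbrakk>x \<in> carrier (D 0 q); eps q x = \<zero>\<^bsub>S q\<^esub>\<rbrakk> \<Longrightarrow> \<exists>y\<in>carrier (D (Suc 0) q). dh 0 q y = x"
    and exact_Suc: "\<lbrakk>x \<in> carrier (D (Suc p) q); dh p q x = \<zero>\<^bsub>D p q\<^esub>\<rbrakk> \<Longrightarrow>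
      \<exists>y\<in>carrier (D (Suc (Suc p)) q). dh (Suc p) q y = x"
begin

sublocale eps: linear_map R "D 0 q" "S q" "eps q" for q
  by (rule linear_map_eps)

lemma eps_tot_d:
  assumes "x \<in> carrier Total"
  shows "eps q (tot_d x (0,q)) = dS q (eps (Suc q) (x (0, Suc q)))"
  using assms by (simp add: tot_d_entry eps.map_add eps_dh eps_dv)

lemma horizontal_lift:
  assumes w: "w \<in> carrier Total" "tot_d w = \<zero>\<^bsub>Total\<^esub>" and "\<And>i j. i < k \<Longrightarrow> w (i,j) = \<zero>\<^bsub>D i j\<^esub>"
    and "\<And>j. k = 0 \<Longrightarrow> eps j (w (0,j)) = \<zero>\<^bsub>S j\<^esub>"
  obtains v where "v \<in> carrier (D (Suc k) j)" "dh k j v = w (k,j)"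
proof (cases k)
  case 0
  then show thesis using that exact_0[of "w (0,j)" j] w(1) assms(4) by auto
next
  case (Suc i)
  have "tot_d w (i,j) = \<zero>\<^bsub>D i j\<^esub>" by (simp add: w(2) Total_simps)
  then have "dh i j (w (k,j)) = \<zero>\<^bsub>D i j\<^esub>" using w(1) assms(3)[of i] by (simp add: tot_d_entry Suc)
  then show thesis using that exact_Suc[of "w (k,j)" i j] w(1) Suc by auto
qed

text \<open>Lifting the entry in column \<open>k\<close> along the exact row moves the cycle into the columns
  beyond \<open>k\<close>.\<close>

lemma clear_column:
  assumes w: "w \<in> filtered_cycles m m" and lower: "\<And>i j. i < k \<Longrightarrow> w (i,j) = \<zero>\<^bsub>D i j\<^esub>"
    and "\<And>j. k = 0 \<Longrightarrow> eps j (w (0,j)) = \<zero>\<^bsub>S j\<^esub>" and k: "int k \<le> m"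
  obtains u where "u \<in> Fil (m + 1) (m + 1)" "\<And>i j. i \<le> k \<Longrightarrow> u (i,j) = \<zero>\<^bsub>D i j\<^esub>"
    "\<And>i j. i \<le> k \<Longrightarrow> (w \<ominus>\<^bsub>Total\<^esub> tot_d u) (i,j) = \<zero>\<^bsub>D i j\<^esub>"
proof -
  have w_cycle: "w \<in> Fil m m" "tot_d w = \<zero>\<^bsub>Total\<^esub>" using w by (auto simp: filtered_cycles_def)
  note w_total = Fil_carrier[OF w_cycle(1)]
  define j where "j = nat (m - int k)"
  have m: "m = int k + int j" using k by (simp add: j_def)
  obtain v where v: "v \<in> carrier (D (Suc k) j)" "dh k j v = w (k,j)"
    using horizontal_lift[OF w_total w_cycle(2) lower assms(3)] by blast
  let ?u = "single (Suc k) j v"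
  have u: "?u \<in> Fil (m + 1) (m + 1)" by (rule single_Fil[OF v(1)]) (simp_all add: m)
  have du_Fil: "tot_d ?u \<in> Fil m m" using d_filtered_cycles[OF u] by (simp add: filtered_cycles_def)
  have "w (i,l) = tot_d ?u (i,l)" if "i \<le> k" for i l
  proof -
    consider "i = k" "l = j" | "i = k" "l \<noteq> j" | "i < k" using \<open>i \<le> k\<close> by fastforce
    then show ?thesis
    proof cases
      case 1
      then show ?thesis
        using v entry_closed[OF w_total, of k j] by (simp add: tot_d_entry single_entry)
    next
      case 2
      then show ?thesis
        using Fil_zero_entry[OF w_cycle(1), of i l] Fil_zero_entry[OF du_Fil, of i l] by (simp add: m)
    next
      case 3
      then show ?thesis using lower by (simp add: tot_d_entry single_entry)
    qed
  qed
  then have "(w \<ominus>\<^bsub>Total\<^esub> tot_d ?u) (i,l) = \<zero>\<^bsub>D i l\<^esub>" if "i \<le> k" for i l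
    using that entry_closed[OF Fil_carrier[OF du_Fil], of i l]
    by (simp add: Total_minus w_total Fil_carrier[OF du_Fil] dh.N.minus_eq_zero_iff)
  then show thesis using that[OF u] by (simp add: single_entry)
qed

lemma augmentation_kernel_acyclic:
  assumes "w \<in> filtered_cycles m m" and "\<And>i j. i < k \<Longrightarrow> w (i,j) = \<zero>\<^bsub>D i j\<^esub>"
    and "\<And>j. k = 0 \<Longrightarrow> eps j (w (0,j)) = \<zero>\<^bsub>S j\<^esub>"
  shows "\<exists>y\<in>Fil (m + 1) (m + 1). tot_d y = w \<and> (\<forall>i j. i \<le> k \<longrightarrow> y (i,j) = \<zero>\<^bsub>D i j\<^esub>)"
  using assms
proof (induction "nat (m + 1 - int k)" arbitrary: w k)
  case 0
  have "w (i,j) = \<zero>\<^bsub>D i j\<^esub>" for i j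
    using 0 Fil_zero_entry[of w m m i j] by (cases "i < k") (auto simp: filtered_cycles_def)
  then have "w = \<zero>\<^bsub>Total\<^esub>" by (intro Total_eqI) (simp add: Total_simps)
  then show ?case
    using Fil_zero[of "m + 1" "m + 1"] by (intro bexI[of _ "\<zero>\<^bsub>Total\<^esub>"]) (simp_all add: Total_simps)
next
  case (Suc steps)
  have k: "int k \<le> m" using Suc.hyps(2) by linarith
  obtain u where u: "u \<in> Fil (m + 1) (m + 1)" "\<And>i j. i \<le> k \<Longrightarrow> u (i,j) = \<zero>\<^bsub>D i j\<^esub>"
    "\<And>i j. i \<le> k \<Longrightarrow> (w \<ominus>\<^bsub>Total\<^esub> tot_d u) (i,j) = \<zero>\<^bsub>D i j\<^esub>"
    using clear_column[OF Suc.prems k] by blast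
  have "tot_d u \<in> filtered_cycles m m" using d_filtered_cycles[OF u(1)] by simp
  then have "w \<ominus>\<^bsub>Total\<^esub> tot_d u \<in> filtered_cycles m m"
    by (rule d.M.submodule_minus[OF submodule_filtered_cycles Suc.prems(1)])
  moreover have "steps = nat (m + 1 - int (Suc k))" using Suc.hyps(2) by linarith
  ultimately obtain y where y: "y \<in> Fil (m + 1) (m + 1)" "tot_d y = w \<ominus>\<^bsub>Total\<^esub> tot_d u"
    "\<And>i j. i \<le> Suc k \<Longrightarrow> y (i,j) = \<zero>\<^bsub>D i j\<^esub>"
    using Suc.hyps(1)[of "Suc k" "w \<ominus>\<^bsub>Total\<^esub> tot_d u"] u(3) by auto
  have "tot_d (y \<oplus>\<^bsub>Total\<^esub> u) = w"
    using y(2) filtered_cycles_carrier[OF Suc.prems(1)] Fil_carrier[OF u(1)] Fil_carrier[OF y(1)]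
    by (simp add: d.map_add d.M.minus_plus_cancel)
  moreover have "y \<oplus>\<^bsub>Total\<^esub> u \<in> Fil (m + 1) (m + 1)"
    using d.M.submoduleE(5)[OF submodule_Fil] y(1) u(1) by blast
  ultimately show ?case
    using y(3) u(2) by (intro bexI[of _ "y \<oplus>\<^bsub>Total\<^esub> u"]) (simp_all add: Total_simps)
qed

definition augment :: "nat \<Rightarrow> (nat \<times> nat \<Rightarrow> 'e) \<Rightarrow> 's set" where
  "augment n x = complex_boundaries S dS n +>\<^bsub>S n\<^esub> eps n (x (0,n))"

lemma eps_filtered_cycles:
  assumes "x \<in> filtered_cycles (int n) (int n)"
  shows "eps n (x (0,n)) \<in> complex_cycles S dS n"
proof (cases n)
  case (Suc k)
  have "tot_d x (0,k) = \<zero>\<^bsub>D 0 k\<^esub>" using assms by (simp add: filtered_cycles_def Total_simps)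
  then show ?thesis
    using eps_tot_d[of x k] filtered_cycles_carrier[OF assms]
    by (simp add: Suc S.complex_cycles_Suc)
qed (use filtered_cycles_carrier[OF assms] in \<open>simp add: complex_cycles_def\<close>)

lemma linear_map_augment:
  "linear_map R (Total\<lparr>carrier := filtered_cycles (int n) (int n)\<rparr>) (complex_homology S dS n)
    (augment n)"
proof -
  let ?cycles = "Total\<lparr>carrier := filtered_cycles (int n) (int n)\<rparr>"
  let ?S_cycles = "(S n)\<lparr>carrier := complex_cycles S dS n\<rparr>"
  have "linear_map R ?cycles ?S_cycles (\<lambda>x. eps n (x (0,n)))"
    by (rule linear_mapI)
      (simp_all add: eps_filtered_cycles Total_simps(3,4) eps.map_add eps.map_smult
        filtered_cycles_carrier
        submodule.submodule_is_module[OF submodule_filtered_cycles d.M.module_axioms]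
        submodule.submodule_is_module[OF S.homology.submodule_A S.d.N.module_axioms])
  then show ?thesis
    using S.homology.linear_map_proj
    unfolding augment_def complex_homology_def by (rule linear_map_comp)
qed

lemma augment_onto:
  assumes s: "s \<in> complex_cycles S dS n"
  obtains x where "x \<in> filtered_cycles (int n) (int n)" "eps n (x (0,n)) = s"
proof -
  obtain v where v: "v \<in> carrier (D 0 n)" "eps n v = s"
    using s eps_onto[of n] by (metis S.homology.A_carrier imageE)
  let ?X = "single 0 n v"
  have X_Fil: "?X \<in> Fil (int n) (int n)" by (rule single_Fil[OF v(1)]) simp_all
  have X_total: "?X \<in> carrier Total" by (rule Fil_carrier[OF X_Fil])
  have "tot_d ?X \<in> filtered_cycles (int n - 1) (int n - 1)"
    by (rule d_filtered_cycles[OF X_Fil])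
  moreover have "eps j (tot_d ?X (0,j)) = \<zero>\<^bsub>S j\<^esub>" for j
    using s v by (simp add: eps_tot_d[OF X_total] single_entry) (metis S.complex_cycles_Suc)
  ultimately obtain y where y: "y \<in> Fil (int n) (int n)" "tot_d y = tot_d ?X" "\<And>j. y (0,j) = \<zero>\<^bsub>D 0 j\<^esub>"
    using augmentation_kernel_acyclic[of "tot_d ?X" "int n - 1" 0] by auto
  have y_total: "y \<in> carrier Total" by (rule Fil_carrier[OF y(1)])
  have "?X \<ominus>\<^bsub>Total\<^esub> y \<in> filtered_cycles (int n) (int n)"
    using Fil_minus[OF X_Fil y(1)] X_total y_total y(2)
    by (simp add: filtered_cycles_def d.map_minus d.M.minus_eq_zero_iff)
  moreover have "(?X \<ominus>\<^bsub>Total\<^esub> y) (0,n) = v"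
    using v(1) y(3) by (simp add: Total_minus X_total y_total single_entry)
  ultimately show thesis using v(2) by (intro that[of "?X \<ominus>\<^bsub>Total\<^esub> y"]) simp_all
qed

lemma tot_d_lift_of_eps_boundary:
  assumes x: "x \<in> filtered_cycles (int n) (int n)" and "eps n (x (0,n)) \<in> complex_boundaries S dS n"
  shows "x \<in> tot_d ` Fil (int n + 1) (int n + 1)"
proof -
  obtain v where v: "v \<in> carrier (D 0 (Suc n))" "eps n (x (0,n)) = dS n (eps (Suc n) v)"
    using assms(2) unfolding complex_boundaries_def eps_onto[symmetric] by blast
  let ?X = "single 0 (Suc n) v"
  have X_Fil: "?X \<in> Fil (int n + 1) (int n + 1)" by (rule single_Fil[OF v(1)]) simp_all
  have X_total: "?X \<in> carrier Total" by (rule Fil_carrier[OF X_Fil])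
  have x_total: "x \<in> carrier Total" by (rule filtered_cycles_carrier[OF x])
  have "x \<ominus>\<^bsub>Total\<^esub> tot_d ?X \<in> filtered_cycles (int n) (int n)"
    using d_filtered_cycles[OF X_Fil]
    by (intro d.M.submodule_minus[OF submodule_filtered_cycles x]) simp
  moreover have "eps j ((x \<ominus>\<^bsub>Total\<^esub> tot_d ?X) (0,j)) = \<zero>\<^bsub>S j\<^esub>" for j
  proof -
    have "eps j (x (0,j)) = eps j (tot_d ?X (0,j))"
    proof (cases "j = n")
      case True
      then show ?thesis by (simp add: eps_tot_d[OF X_total] single_entry v(2))
    next
      case False
      then have "x (0,j) = \<zero>\<^bsub>D 0 j\<^esub>" using x by (auto simp: filtered_cycles_def intro: Fil_zero_entry)
      then show ?thesis using False by (simp add: eps_tot_d[OF X_total] single_entry)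
    qed
    then show ?thesis
      using x_total d.map_closed[OF X_total]
        eps.map_closed[OF entry_closed[OF d.map_closed[OF X_total]], of j]
      by (simp add: Total_minus eps.map_minus S.d.N.minus_eq_zero_iff)
  qed
  ultimately obtain y where y: "y \<in> Fil (int n + 1) (int n + 1)" "tot_d y = x \<ominus>\<^bsub>Total\<^esub> tot_d ?X"
    using augmentation_kernel_acyclic[of "x \<ominus>\<^bsub>Total\<^esub> tot_d ?X" "int n" 0] by auto
  then have "tot_d (y \<oplus>\<^bsub>Total\<^esub> ?X) = x"
    using x_total X_total Fil_carrier by (simp add: d.map_add d.M.minus_plus_cancel)
  then show ?thesis using d.M.submoduleE(5)[OF submodule_Fil] y(1) X_Fil by blast
qed

lemma eps_mem_boundaries_iff:
  assumes "x \<in> filtered_cycles (int n) (int n)"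
  shows "eps n (x (0,n)) \<in> complex_boundaries S dS n \<longleftrightarrow> x \<in> tot_d ` Fil (int n + 1) (int n + 1)"
proof
  assume "x \<in> tot_d ` Fil (int n + 1) (int n + 1)"
  then obtain y where "y \<in> Fil (int n + 1) (int n + 1)" "x = tot_d y" by blast
  then show "eps n (x (0,n)) \<in> complex_boundaries S dS n"
    using Fil_carrier by (simp add: eps_tot_d complex_boundaries_def)
qed (rule tot_d_lift_of_eps_boundary[OF assms])

sublocale filtered_complex_homology R Total tot_d Fil "\<lambda>p q. D (nat p) (nat q)"
  "\<lambda>p q x. x (nat p, nat q)"
  "complex_homology S dS" augment
proof (intro filtered_complex_homology.intro filtered_complex_homology_axioms.intro
    filtered_complex_axioms linear_map_augment)
  fix n x
  have augment: "augment n x \<in> carrier (complex_homology S dS n)"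
    "augment n x = \<zero>\<^bsub>complex_homology S dS n\<^esub> \<longleftrightarrow> eps n (x (0,n)) \<in> complex_boundaries S dS n"
    if "x \<in> filtered_cycles (int n) (int n)" for x
    using that eps_filtered_cycles
    by (simp_all add: augment_def complex_homology_def S.homology.coset_eq_zero_iff)
  show "augment n ` filtered_cycles (int n) (int n) = carrier (complex_homology S dS n)"
  proof (intro subset_antisym subsetI)
    fix X assume "X \<in> carrier (complex_homology S dS n)"
    then obtain s where "s \<in> complex_cycles S dS n" "X = complex_boundaries S dS n +>\<^bsub>S n\<^esub> s"
      by (auto simp: complex_homology_def S.homology.carrier_quot)
    then show "X \<in> augment n ` filtered_cycles (int n) (int n)"
      by (auto simp: augment_def elim: augment_onto)
  qed (use augment(1) in auto)
  show "augment n x = \<zero>\<^bsub>complex_homology S dS n\<^esub> \<longleftrightarrow> x \<in> tot_d ` Fil (int n + 1) (int n + 1)"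
    if "x \<in> filtered_cycles (int n) (int n)"
    using augment(2)[OF that] eps_mem_boundaries_iff[OF that] by simp
qed

end

section \<open>Chain modules of a sheaf\<close>

lemma chain_mod_eq_prod_mod: "chain_mod Q G n = prod_mod (chains Q n) (\<lambda>\<sigma>. G (hd \<sigma>))"
  by (simp add: chain_mod_def prod_mod_def)

lemma gen_eq_prod_single: "gen Q G n = prod_single (chains Q n) (\<lambda>\<sigma>. G (hd \<sigma>))"
  by (simp add: gen_def prod_single_def fun_eq_iff)

lemmas chain_mod_simps =
  prod_mod_simps[where I = "chains Q n" and M = "\<lambda>\<sigma>. G (hd \<sigma>)",
    folded chain_mod_eq_prod_mod] for Q G n

lemma chain_mod_eqI:
  assumes "s \<in> carrier (chain_mod Q G n)" "t \<in> carrier (chain_mod Q G n)"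
    "\<And>\<sigma>. \<sigma> \<in> chains Q n \<Longrightarrow> s \<sigma> = t \<sigma>"
  shows "s = t"
  using assms unfolding chain_mod_eq_prod_mod by (rule prod_mod_eqI)

lemma chain_mod_zero_iff:
  assumes "s \<in> carrier (chain_mod Q G n)"
  shows "s = \<zero>\<^bsub>chain_mod Q G n\<^esub> \<longleftrightarrow> (\<forall>\<sigma>\<in>chains Q n. s \<sigma> = \<zero>\<^bsub>G (hd \<sigma>)\<^esub>)"
  using assms by (auto simp: chain_mod_simps fun_eq_iff)

lemma chains_altdef: "chains Q n = {\<sigma>. length \<sigma> = Suc n \<and> set \<sigma> \<subseteq> Q \<and> sorted_wrt (\<ge>) \<sigma>}"
proof -
  have "transp ((\<ge>) :: 'a \<Rightarrow> 'a \<Rightarrow> bool)" by (auto intro: transpI)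
  then show ?thesis by (auto simp: chains_def sorted_wrt_iff_nth_Suc_transp)
qed

lemma finite_chains: "finite Q \<Longrightarrow> finite (chains Q n)"
  by (rule finite_subset[OF _ finite_lists_length_eq[of Q "Suc n"]]) (auto simp: chains_altdef)

lemma chains_mono: "Q' \<subseteq> Q \<Longrightarrow> chains Q' n \<subseteq> chains Q n"
  by (auto simp: chains_altdef)

lemma chains_hd: "\<sigma> \<in> chains Q n \<Longrightarrow> hd \<sigma> \<in> Q"
  by (cases \<sigma>) (auto simp: chains_altdef)

lemma chains_le_hd: "\<lbrakk>\<sigma> \<in> chains Q n; x \<in> set \<sigma>\<rbrakk> \<Longrightarrow> x \<in> Q \<and> x \<le> hd \<sigma>"
  by (cases \<sigma>) (auto simp: chains_altdef)

lemma chains_last_le: "\<lbrakk>\<sigma> \<in> chains Q n; x \<in> set \<sigma>\<rbrakk> \<Longrightarrow> last \<sigma> \<in> set \<sigma> \<and> last \<sigma> \<le> x"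
  by (cases \<sigma> rule: rev_cases) (auto simp: chains_altdef sorted_wrt_append)

lemma chains_Cons_iff: "x # \<sigma> \<in> chains Q (Suc n) \<longleftrightarrow> x \<in> Q \<and> \<sigma> \<in> chains Q n \<and> hd \<sigma> \<le> x"
  by (cases \<sigma>) (auto simp: chains_altdef)

lemma chains_0: "chains Q 0 = (\<lambda>x. [x]) ` Q"
  by (auto simp: chains_altdef length_Suc_conv)

lemma chains_SucE:
  assumes "\<sigma> \<in> chains Q (Suc n)"
  obtains x y \<tau> where "\<sigma> = x # y # \<tau>" "x \<in> Q" "y \<in> Q" "y \<le> x"
  using assms by (auto simp: chains_altdef length_Suc_conv)

lemma face_0: "face 0 \<sigma> = tl \<sigma>"
  by (simp add: face_def drop_Suc)

lemma face_Suc_Cons: "face (Suc i) (x # \<sigma>) = x # face i \<sigma>"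
  by (simp add: face_def)

lemma chains_face:
  assumes "\<sigma> \<in> chains Q (Suc n)" "i \<le> Suc n"
  shows "face i \<sigma> \<in> chains Q n"
proof -
  have i: "i < length \<sigma>" using assms by (auto simp: chains_altdef)
  have "sorted_wrt (\<ge>) (take i \<sigma> @ \<sigma> ! i # drop (Suc i) \<sigma>)"
    using assms id_take_nth_drop[OF i] by (simp add: chains_altdef)
  moreover have "set (face i \<sigma>) \<subseteq> set \<sigma>"
    using set_take_subset set_drop_subset by (fastforce simp: face_def)
  ultimately show ?thesis using assms i
    by (auto simp: chains_altdef face_def sorted_wrt_append)
qed

lemma face_face:
  assumes "i < j" "j < length \<sigma>"
  shows "face i (face j \<sigma>) = face (j - 1) (face i \<sigma>)"
  using assms
proof (induction i arbitrary: j \<sigma>)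
  case 0
  then show ?case by (cases \<sigma>; cases j) (auto simp: face_0 face_Suc_Cons)
next
  case (Suc i)
  then obtain x \<tau> k where "\<sigma> = x # \<tau>" "j = Suc (Suc k)"
    by (metis Suc_lessE Suc_less_eq2 length_Suc_conv less_imp_Suc_add)
  then show ?case using Suc by (simp add: face_Suc_Cons)
qed

definition face_coeff :: "('a \<Rightarrow> 'a \<Rightarrow> 'm \<Rightarrow> 'm) \<Rightarrow> nat \<Rightarrow> 'a list \<Rightarrow> 'm \<Rightarrow> 'm" where
  "face_coeff rho i \<sigma> m = (if i = 0 then rho (\<sigma> ! 0) (\<sigma> ! 1) m else m)"

lemma face_coeff_simps [simp]:
  "face_coeff rho 0 \<sigma> m = rho (\<sigma> ! 0) (\<sigma> ! 1) m" "face_coeff rho (Suc i) \<sigma> m = m"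
  by (simp_all add: face_coeff_def)

lemma cycles_eq: "cycles Q G rho = complex_cycles (chain_mod Q G) (bdry Q G rho)"
  by (auto simp: cycles_def complex_cycles_def fun_eq_iff)

lemma boundaries_eq: "boundaries Q G rho = complex_boundaries (chain_mod Q G) (bdry Q G rho)"
  by (auto simp: boundaries_def complex_boundaries_def fun_eq_iff)

lemma HS_eq: "HS Q G rho = complex_homology (chain_mod Q G) (bdry Q G rho)"
  by (auto simp: HS_def complex_homology_def fun_eq_iff cycles_eq boundaries_eq)

locale poset_sheaf =
  fixes R :: "'r ring" and Q :: "'a::order set" and G :: "'a \<Rightarrow> ('r,'m) module" and rho
  assumes cring: "cring R" and finite: "finite Q" and sheaf: "is_sheaf R Q G rho"
begin

lemma module_stalk: "x \<in> Q \<Longrightarrow> module R (G x)"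
  and linear_map_rho: "\<lbrakk>x \<in> Q; y \<in> Q; x \<le> y\<rbrakk> \<Longrightarrow> linear_map R (G y) (G x) (rho y x)"
  and rho_id: "\<lbrakk>x \<in> Q; s \<in> carrier (G x)\<rbrakk> \<Longrightarrow> rho x x s = s"
  and rho_rho: "\<lbrakk>x \<in> Q; y \<in> Q; z \<in> Q; x \<le> y; y \<le> z; s \<in> carrier (G z)\<rbrakk> \<Longrightarrow>
    rho y x (rho z y s) = rho z x s"
  using sheaf unfolding is_sheaf_def by (auto intro!: linear_map.intro linear_map_axioms.intro)

sublocale prod: module_family R "chains Q n" "\<lambda>\<sigma>. G (hd \<sigma>)" for n
  by (rule module_family.intro[OF cring module_stalk[OF chains_hd]])

lemmas module_chain_mod = prod.module_prod[folded chain_mod_eq_prod_mod]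
  and linear_map_gen = prod.linear_map_prod_single[folded chain_mod_eq_prod_mod gen_eq_prod_single]
  and linear_map_chain_modI = prod.linear_map_prodI[folded chain_mod_eq_prod_mod]
  and linear_map_chain_entry = prod.linear_map_entry[folded chain_mod_eq_prod_mod]
  and finsum_chain_entry = prod.finsum_prod_entry[folded chain_mod_eq_prod_mod]
  and linear_map_chain_mod_eqI =
    prod.linear_map_prod_eqI[OF finite_chains[OF finite],
      folded chain_mod_eq_prod_mod gen_eq_prod_single]
  and finsum_gen = prod.finsum_prod_single[OF finite_chains[OF finite], folded gen_eq_prod_single]

lemma gen_closed: "\<lbrakk>\<sigma> \<in> chains Q n; m \<in> carrier (G (hd \<sigma>))\<rbrakk> \<Longrightarrow>
    gen Q G n \<sigma> m \<in> carrier (chain_mod Q G n)"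
  by (rule linear_map.map_closed[OF linear_map_gen])

lemma entry_closed: "\<lbrakk>s \<in> carrier (chain_mod Q G n); \<sigma> \<in> chains Q n\<rbrakk> \<Longrightarrow> s \<sigma> \<in> carrier (G (hd \<sigma>))"
  by (simp add: chain_mod_simps)

lemma linear_map_face_coeff:
  assumes \<sigma>: "\<sigma> \<in> chains Q (Suc n)"
  shows "linear_map R (G (hd \<sigma>)) (G (hd (face i \<sigma>))) (face_coeff rho i \<sigma>)"
proof -
  obtain x y \<tau> where "\<sigma> = x # y # \<tau>" "x \<in> Q" "y \<in> Q" "y \<le> x" using \<sigma> by (rule chains_SucE)
  then show ?thesis
    using linear_map_rho linear_map_id[OF module_stalk]
    by (cases i) (simp_all add: face_coeff_def[abs_def] face_0 face_Suc_Cons)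
qed

lemma face_coeff_closed:
  "\<lbrakk>\<sigma> \<in> chains Q (Suc n); m \<in> carrier (G (hd \<sigma>))\<rbrakk> \<Longrightarrow>
    face_coeff rho i \<sigma> m \<in> carrier (G (hd (face i \<sigma>)))"
  by (rule linear_map.map_closed[OF linear_map_face_coeff])

lemma face_coeff_face_coeff:
  assumes \<sigma>: "\<sigma> \<in> chains Q (Suc (Suc n))" and "i < j" and m: "m \<in> carrier (G (hd \<sigma>))"
  shows "face_coeff rho i (face j \<sigma>) (face_coeff rho j \<sigma> m)
    = face_coeff rho (j - 1) (face i \<sigma>) (face_coeff rho i \<sigma> m)"
proof (cases i)
  case 0
  obtain x y z \<tau> where "\<sigma> = x # y # z # \<tau>" "x \<in> Q" "y \<in> Q" "z \<in> Q" "y \<le> x" "z \<le> y"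
    using \<sigma> by (auto simp: chains_altdef length_Suc_conv)
  moreover obtain k where "j = Suc k" using \<open>i < j\<close> by (cases j) auto
  ultimately show ?thesis
    using rho_rho m by (cases k) (simp_all add: 0 face_0 face_Suc_Cons)
next
  case (Suc k)
  then show ?thesis using \<open>i < j\<close> by (cases j) (auto simp: face_coeff_def)
qed

definition gen_bdry :: "nat \<Rightarrow> 'a list \<Rightarrow> 'm \<Rightarrow> 'a list \<Rightarrow> 'm" where
  "gen_bdry n \<sigma> m = (\<Oplus>\<^bsub>chain_mod Q G n\<^esub>i\<in>{..Suc n}.
     signed (chain_mod Q G n) i (gen Q G n (face i \<sigma>) (face_coeff rho i \<sigma> m)))"

lemma linear_map_face_gen:
  assumes "\<sigma> \<in> chains Q (Suc n)" "i \<le> Suc n"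
  shows "linear_map R (G (hd \<sigma>)) (chain_mod Q G n)
    (\<lambda>m. gen Q G n (face i \<sigma>) (face_coeff rho i \<sigma> m))"
  by (rule linear_map_comp[OF linear_map_face_coeff[OF assms(1)]
    linear_map_gen[OF chains_face[OF assms]]])

lemma linear_map_gen_bdry:
  assumes "\<sigma> \<in> chains Q (Suc n)"
  shows "linear_map R (G (hd \<sigma>)) (chain_mod Q G n) (gen_bdry n \<sigma>)"
  unfolding gen_bdry_def[abs_def]
  by (intro linear_map_finsum module_stalk[OF chains_hd[OF assms]] module_chain_mod
      linear_map_comp[OF linear_map_face_gen[OF assms] linear_map_signed[OF module_chain_mod]]) simp

lemma linear_map_of_gen_bdry:
  assumes f: "linear_map R (chain_mod Q G n) M f"
    and \<sigma>: "\<sigma> \<in> chains Q (Suc n)" and m: "m \<in> carrier (G (hd \<sigma>))"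
  shows "f (gen_bdry n \<sigma> m) =
    (\<Oplus>\<^bsub>M\<^esub>i\<in>{..Suc n}. signed M i (f (gen Q G n (face i \<sigma>) (face_coeff rho i \<sigma> m))))"
proof -
  interpret f: linear_map R "chain_mod Q G n" M f by (rule f)
  have face_closed: "gen Q G n (face i \<sigma>) (face_coeff rho i \<sigma> m) \<in> carrier (chain_mod Q G n)"
      if "i \<le> Suc n" for i
    by (rule linear_map.map_closed[OF linear_map_face_gen[OF \<sigma> that] m])
  have "f (gen_bdry n \<sigma> m) = (\<Oplus>\<^bsub>M\<^esub>i\<in>{..Suc n}.
      f (signed (chain_mod Q G n) i (gen Q G n (face i \<sigma>) (face_coeff rho i \<sigma> m))))"
    unfolding gen_bdry_def by (rule f.map_finsum) (simp add: face_closed)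
  also have "\<dots> = (\<Oplus>\<^bsub>M\<^esub>i\<in>{..Suc n}. signed M i (f (gen Q G n (face i \<sigma>) (face_coeff rho i \<sigma> m))))"
    by (intro f.N.finsum_cong') (auto simp: face_closed f.map_signed)
  finally show ?thesis .
qed

lemma bdry_eq_finsum_gen_bdry:
  assumes s: "s \<in> carrier (chain_mod Q G (Suc n))"
  shows "bdry Q G rho n s = (\<Oplus>\<^bsub>chain_mod Q G n\<^esub>\<sigma>\<in>chains Q (Suc n). gen_bdry n \<sigma> (s \<sigma>))"
proof -
  interpret C: module R "chain_mod Q G n" by (rule module_chain_mod)
  have "gen Q G n (face 0 \<sigma>) (rho (\<sigma> ! 0) (\<sigma> ! 1) (s \<sigma>)) \<oplus>\<^bsub>chain_mod Q G n\<^esub>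
      (\<Oplus>\<^bsub>chain_mod Q G n\<^esub>i\<in>{1..Suc n}. if even i then gen Q G n (face i \<sigma>) (s \<sigma>)
         else \<ominus>\<^bsub>chain_mod Q G n\<^esub> gen Q G n (face i \<sigma>) (s \<sigma>)) = gen_bdry n \<sigma> (s \<sigma>)"
    if \<sigma>: "\<sigma> \<in> chains Q (Suc n)" for \<sigma>
  proof -
    let ?face = "\<lambda>i. signed (chain_mod Q G n) i (gen Q G n (face i \<sigma>) (face_coeff rho i \<sigma> (s \<sigma>)))"
    have face_closed: "?face i \<in> carrier (chain_mod Q G n)" if "i \<le> Suc n" for i
      using linear_map.map_closed[OF linear_map_face_gen[OF \<sigma> that] entry_closed[OF s \<sigma>]] by simp
    have "(\<Oplus>\<^bsub>chain_mod Q G n\<^esub>i\<in>{1..Suc n}. if even i then gen Q G n (face i \<sigma>) (s \<sigma>)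
        else \<ominus>\<^bsub>chain_mod Q G n\<^esub> gen Q G n (face i \<sigma>) (s \<sigma>)) = (\<Oplus>\<^bsub>chain_mod Q G n\<^esub>i\<in>{1..Suc n}. ?face i)"
      by (rule C.finsum_cong') (use face_closed in \<open>auto simp: signed_def face_coeff_def\<close>)
    moreover have "gen_bdry n \<sigma> (s \<sigma>)
        = ?face 0 \<oplus>\<^bsub>chain_mod Q G n\<^esub> (\<Oplus>\<^bsub>chain_mod Q G n\<^esub>i\<in>{1..Suc n}. ?face i)"
    proof -
      have "{..Suc n} = insert 0 {1..Suc n}" by auto
      then show ?thesis
        unfolding gen_bdry_def
        by (simp only:) (rule C.finsum_insert, use face_closed[of 0] face_closed in auto)
    qed
    ultimately show ?thesis by simp
  qed
  then show ?thesis
    unfolding bdry_def using linear_map.map_closed[OF linear_map_gen_bdry entry_closed[OF s]]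
    by (intro C.finsum_cong') auto
qed

lemma linear_map_bdry: "linear_map R (chain_mod Q G (Suc n)) (chain_mod Q G n) (bdry Q G rho n)"
  by (rule linear_map_cong[OF linear_map_finsum bdry_eq_finsum_gen_bdry])
    (auto intro: module_chain_mod linear_map_comp[OF linear_map_chain_entry linear_map_gen_bdry])

lemma bdry_gen:
  assumes "\<sigma> \<in> chains Q (Suc n)" "m \<in> carrier (G (hd \<sigma>))"
  shows "bdry Q G rho n (gen Q G (Suc n) \<sigma> m) = gen_bdry n \<sigma> m"
  using finsum_gen[OF linear_map_gen_bdry assms] bdry_eq_finsum_gen_bdry[OF gen_closed[OF assms]]
  by simp

lemma bdry_bdry:
  assumes "s \<in> carrier (chain_mod Q G (Suc (Suc n)))"
  shows "bdry Q G rho n (bdry Q G rho (Suc n) s) = \<zero>\<^bsub>chain_mod Q G n\<^esub>"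
proof (rule linear_map_chain_mod_eqI[OF linear_map_comp[OF linear_map_bdry linear_map_bdry]
      linear_map_zero[OF module_chain_mod module_chain_mod] _ assms])
  fix \<sigma> m
  assume \<sigma>: "\<sigma> \<in> chains Q (Suc (Suc n))" and m: "m \<in> carrier (G (hd \<sigma>))"
  let ?M = "chain_mod Q G n"
  define g where "g i j =
    (if i \<le> Suc n \<and> j \<le> Suc (Suc n)
     then gen Q G n (face i (face j \<sigma>)) (face_coeff rho i (face j \<sigma>) (face_coeff rho j \<sigma> m))
     else \<zero>\<^bsub>?M\<^esub>)" for i j
  interpret C: module R ?M by (rule module_chain_mod)
  have length: "length \<sigma> = Suc (Suc (Suc n))" using \<sigma> by (simp add: chains_altdef)
  have g_closed: "g i j \<in> carrier ?M" for i j
    unfolding g_def using \<sigma> m by (auto intro!: gen_closed face_coeff_closed chains_face)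
  have g_swap: "g i j = g (j - 1) i" if "i < j" "j \<le> Suc (Suc n)" for i j
  proof -
    have "j - 1 \<le> Suc n" "i \<le> Suc n" "i \<le> Suc (Suc n)" using that by auto
    then show ?thesis
      using that face_face[of i j \<sigma>] face_coeff_face_coeff[OF \<sigma> that(1) m] length
      by (simp add: g_def)
  qed
  have "bdry Q G rho n (gen Q G (Suc n) (face j \<sigma>) (face_coeff rho j \<sigma> m))
      = (\<Oplus>\<^bsub>?M\<^esub>i\<in>{..Suc n}. signed ?M i (g i j))" if j: "j \<le> Suc (Suc n)" for j
    unfolding bdry_gen[OF chains_face[OF \<sigma> j] face_coeff_closed[OF \<sigma> m]] gen_bdry_def
  proof (rule C.finsum_cong')
    show "(\<lambda>i. signed ?M i (g i j)) \<in> {..Suc n} \<rightarrow> carrier ?M" using g_closed by auto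
  qed (use j in \<open>simp_all add: g_def\<close>)
  then have "bdry Q G rho n (bdry Q G rho (Suc n) (gen Q G (Suc (Suc n)) \<sigma> m))
      = (\<Oplus>\<^bsub>?M\<^esub>j\<in>{..Suc (Suc n)}. signed ?M j (\<Oplus>\<^bsub>?M\<^esub>i\<in>{..Suc n}. signed ?M i (g i j)))"
    unfolding bdry_gen[OF \<sigma> m] linear_map_of_gen_bdry[OF linear_map_bdry \<sigma> m]
    using g_closed by (intro C.finsum_cong') auto
  also have "\<dots> = \<zero>\<^bsub>?M\<^esub>"
    by (rule alternating_double_sum_eq_zero[where R = R and g = g,
          OF module_chain_mod g_closed g_swap])
  finally show "bdry Q G rho n (bdry Q G rho (Suc n) (gen Q G (Suc (Suc n)) \<sigma> m)) = \<zero>\<^bsub>?M\<^esub>" .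
qed

sublocale chain_complex R "chain_mod Q G" "bdry Q G rho"
  by (intro chain_complex.intro linear_map_bdry bdry_bdry)

end

section \<open>Maps of chain modules\<close>

definition chain_map ::
    "'a::order set \<Rightarrow> 'a set \<Rightarrow> ('a \<Rightarrow> ('r,'n) module) \<Rightarrow> ('a \<Rightarrow> 'm \<Rightarrow> 'n) \<Rightarrow> nat \<Rightarrow>
      ('a list \<Rightarrow> 'm) \<Rightarrow> 'a list \<Rightarrow> 'n" where
  "chain_map Q Q' G' f n s = (\<lambda>\<sigma>. if \<sigma> \<in> chains Q' n
     then if \<sigma> \<in> chains Q n then f (hd \<sigma>) (s \<sigma>) else \<zero>\<^bsub>G' (hd \<sigma>)\<^esub> else undefined)"

text \<open>A morphism from a sheaf on \<open>Q\<close> to a sheaf on \<open>Q'\<close> which is only given on the overlap and zero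
  elsewhere.  It covers morphisms of sheaves on one poset, the extension of chains to a larger poset,
  and the restriction of chains to a lower subset on whose complement the coefficients are discarded.\<close>

locale sheaf_overlap_hom = A: poset_sheaf R Q G rho + B: poset_sheaf R Q' G' rho'
  for R :: "'r ring" and Q :: "'a::order set" and G :: "'a \<Rightarrow> ('r,'m) module" and rho
    and Q' and G' :: "'a \<Rightarrow> ('r,'n) module" and rho' +
  fixes f :: "'a \<Rightarrow> 'm \<Rightarrow> 'n"
  assumes linear_map_f: "\<lbrakk>x \<in> Q; x \<in> Q'\<rbrakk> \<Longrightarrow> linear_map R (G x) (G' x) (f x)"
    and overlap_lower: "\<lbrakk>x \<in> Q; y \<in> Q; y \<in> Q'; x \<le> y\<rbrakk> \<Longrightarrow> x \<in> Q'"
    and f_natural: "\<lbrakk>x \<in> Q; x \<in> Q'; y \<in> Q; x \<le> y; s \<in> carrier (G y)\<rbrakk> \<Longrightarrow>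
      f x (rho y x s) = (if y \<in> Q' then rho' y x (f y s) else \<zero>\<^bsub>G' x\<^esub>)"
begin

abbreviation overlap_map :: "nat \<Rightarrow> ('a list \<Rightarrow> 'm) \<Rightarrow> 'a list \<Rightarrow> 'n" where
  "overlap_map \<equiv> chain_map Q Q' G' f"

lemma chains_overlap_iff:
  assumes \<sigma>: "\<sigma> \<in> chains Q n"
  shows "\<sigma> \<in> chains Q' n \<longleftrightarrow> hd \<sigma> \<in> Q'"
proof
  assume hd: "hd \<sigma> \<in> Q'"
  have "x \<in> Q'" if "x \<in> set \<sigma>" for x
    using overlap_lower[OF _ chains_hd[OF \<sigma>] hd] chains_le_hd[OF \<sigma> that] by simp
  then show "\<sigma> \<in> chains Q' n" using \<sigma> by (auto simp: chains_altdef)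
qed (rule chains_hd)

lemma linear_map_chain_map: "linear_map R (chain_mod Q G n) (chain_mod Q' G' n) (overlap_map n)"
proof (rule B.linear_map_chain_modI[OF A.module_chain_mod])
  show "linear_map R (chain_mod Q G n) (G' (hd \<sigma>)) (\<lambda>s. overlap_map n s \<sigma>)"
      if \<sigma>: "\<sigma> \<in> chains Q' n" for \<sigma>
    using \<sigma> linear_map_comp[OF A.linear_map_chain_entry linear_map_f] chains_hd[of \<sigma>]
      linear_map_zero[OF A.module_chain_mod B.module_stalk]
    by (cases "\<sigma> \<in> chains Q n") (simp_all add: chain_map_def)
qed (simp add: chain_map_def)

lemma chain_map_gen:
  assumes \<sigma>: "\<sigma> \<in> chains Q n"
  shows "overlap_map n (gen Q G n \<sigma> m) =
    (if hd \<sigma> \<in> Q' then gen Q' G' n \<sigma> (f (hd \<sigma>) m) else \<zero>\<^bsub>chain_mod Q' G' n\<^esub>)"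
proof
  fix \<tau>
  have "f (hd \<tau>) \<zero>\<^bsub>G (hd \<tau>)\<^esub> = \<zero>\<^bsub>G' (hd \<tau>)\<^esub>" if "\<tau> \<in> chains Q n" "\<tau> \<in> chains Q' n"
    using that by (intro linear_map.map_zero[OF linear_map_f] chains_hd)
  then show "overlap_map n (gen Q G n \<sigma> m) \<tau> =
    (if hd \<sigma> \<in> Q' then gen Q' G' n \<sigma> (f (hd \<sigma>) m) else \<zero>\<^bsub>chain_mod Q' G' n\<^esub>) \<tau>"
    using \<sigma> chains_overlap_iff[OF \<sigma>] by (auto simp: chain_map_def gen_def chain_mod_simps)
qed

lemma chain_map_face_gen:
  assumes \<sigma>: "\<sigma> \<in> chains Q (Suc n)" and m: "m \<in> carrier (G (hd \<sigma>))" and i: "i \<le> Suc n"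
  shows "overlap_map n (gen Q G n (face i \<sigma>) (face_coeff rho i \<sigma> m)) =
    (if hd \<sigma> \<in> Q' then gen Q' G' n (face i \<sigma>) (face_coeff rho' i \<sigma> (f (hd \<sigma>) m))
     else \<zero>\<^bsub>chain_mod Q' G' n\<^esub>)"
proof -
  obtain x y \<tau> where s: "\<sigma> = x # y # \<tau>" "x \<in> Q" "y \<in> Q" "y \<le> x" using \<sigma> by (rule chains_SucE)
  show ?thesis
  proof (cases i)
    case 0
    have face: "y # \<tau> \<in> chains Q n" using chains_face[OF \<sigma> i] by (simp add: 0 s face_0)
    have "gen Q' G' n (y # \<tau>) \<zero>\<^bsub>G' y\<^esub> = \<zero>\<^bsub>chain_mod Q' G' n\<^esub>" by (auto simp: gen_def chain_mod_simps)
    then show ?thesis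
      using f_natural[of y x m] overlap_lower[of y x] s m
      by (auto simp: 0 face_0 chain_map_gen[OF face])
  next
    case (Suc k)
    then show ?thesis using chain_map_gen[OF chains_face[OF \<sigma> i]] by (simp add: s face_Suc_Cons)
  qed
qed

lemma chain_map_bdry:
  assumes "s \<in> carrier (chain_mod Q G (Suc n))"
  shows "overlap_map n (bdry Q G rho n s) = bdry Q' G' rho' n (overlap_map (Suc n) s)"
proof (rule A.linear_map_chain_mod_eqI[OF linear_map_comp[OF A.linear_map_bdry linear_map_chain_map]
      linear_map_comp[OF linear_map_chain_map B.linear_map_bdry] _ assms])
  fix \<sigma> m
  assume \<sigma>: "\<sigma> \<in> chains Q (Suc n)" and m: "m \<in> carrier (G (hd \<sigma>))"
  have "overlap_map n (bdry Q G rho n (gen Q G (Suc n) \<sigma> m)) =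
    (\<Oplus>\<^bsub>chain_mod Q' G' n\<^esub>i\<in>{..Suc n}. signed (chain_mod Q' G' n) i
      (overlap_map n (gen Q G n (face i \<sigma>) (face_coeff rho i \<sigma> m))))"
    by (simp add: A.bdry_gen[OF \<sigma> m] A.linear_map_of_gen_bdry[OF linear_map_chain_map \<sigma> m])
  also have "\<dots> = bdry Q' G' rho' n (overlap_map (Suc n) (gen Q G (Suc n) \<sigma> m))"
  proof (cases "hd \<sigma> \<in> Q'")
    case True
    then have \<sigma>': "\<sigma> \<in> chains Q' (Suc n)" using chains_overlap_iff[OF \<sigma>] by blast
    have fm: "f (hd \<sigma>) m \<in> carrier (G' (hd \<sigma>))"
      by (rule linear_map.map_closed[OF linear_map_f[OF chains_hd[OF \<sigma>] True] m])
    have "gen Q' G' n (face i \<sigma>) (face_coeff rho' i \<sigma> (f (hd \<sigma>) m)) \<in> carrier (chain_mod Q' G' n)"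
      if "i \<le> Suc n" for i
      by (rule B.gen_closed[OF chains_face[OF \<sigma>' that] B.face_coeff_closed[OF \<sigma>' fm]])
    then have "(\<Oplus>\<^bsub>chain_mod Q' G' n\<^esub>i\<in>{..Suc n}. signed (chain_mod Q' G' n) i
        (overlap_map n (gen Q G n (face i \<sigma>) (face_coeff rho i \<sigma> m))))
        = B.gen_bdry n \<sigma> (f (hd \<sigma>) m)"
      unfolding B.gen_bdry_def
      using True by (intro B.d.N.finsum_cong') (auto simp: chain_map_face_gen[OF \<sigma> m])
    then show ?thesis by (simp only: chain_map_gen[OF \<sigma>] True if_True B.bdry_gen[OF \<sigma>' fm])
  next
    case False
    have "(\<Oplus>\<^bsub>chain_mod Q' G' n\<^esub>i\<in>{..Suc n}. signed (chain_mod Q' G' n) i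
        (overlap_map n (gen Q G n (face i \<sigma>) (face_coeff rho i \<sigma> m)))) = \<zero>\<^bsub>chain_mod Q' G' n\<^esub>"
      using False linear_map.map_zero[OF linear_map_signed[OF B.module_chain_mod]]
      by (intro B.d.N.add.finprod_one_eqI) (simp add: chain_map_face_gen[OF \<sigma> m])
    then show ?thesis
      unfolding chain_map_gen[OF \<sigma>] using False linear_map.map_zero[OF B.linear_map_bdry] by simp
  qed
  finally show "overlap_map n (bdry Q G rho n (gen Q G (Suc n) \<sigma> m))
    = bdry Q' G' rho' n (overlap_map (Suc n) (gen Q G (Suc n) \<sigma> m))" .
qed

end

section \<open>Constant coefficients on a poset with a greatest element\<close>

locale constant_sheaf_greatest =
  fixes R :: "'r ring" and Q :: "'a::order set" and M :: "('r,'m) module" and t :: 'a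
  assumes module_M: "module R M" and finite_Q: "finite Q"
    and t_mem: "t \<in> Q" and le_t: "x \<in> Q \<Longrightarrow> x \<le> t"
begin

sublocale poset_sheaf R Q "\<lambda>_. M" "\<lambda>_ _ m. m"
proof (rule poset_sheaf.intro)
  show "cring R" by (rule module.axioms(1)[OF module_M])
  show "is_sheaf R Q (\<lambda>_. M) (\<lambda>_ _ m. m)"
    using module_M linear_map.lin_maps[OF linear_map_id[OF module_M]] by (simp add: is_sheaf_def)
qed (rule finite_Q)

abbreviation Ch :: "nat \<Rightarrow> ('r, 'a list \<Rightarrow> 'm) module" where "Ch n \<equiv> chain_mod Q (\<lambda>_. M) n"
abbreviation ch_gen :: "nat \<Rightarrow> 'a list \<Rightarrow> 'm \<Rightarrow> 'a list \<Rightarrow> 'm" where "ch_gen n \<equiv> gen Q (\<lambda>_. M) n"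
abbreviation ch_d :: "nat \<Rightarrow> ('a list \<Rightarrow> 'm) \<Rightarrow> 'a list \<Rightarrow> 'm" where
  "ch_d n \<equiv> bdry Q (\<lambda>_. M) (\<lambda>_ _ m. m) n"

definition augmentation :: "('a list \<Rightarrow> 'm) \<Rightarrow> 'm" where
  "augmentation s = (\<Oplus>\<^bsub>M\<^esub>\<sigma>\<in>chains Q 0. s \<sigma>)"

definition cone :: "nat \<Rightarrow> ('a list \<Rightarrow> 'm) \<Rightarrow> 'a list \<Rightarrow> 'm" where
  "cone n s = (\<lambda>\<sigma>. if \<sigma> \<in> chains Q (Suc n) then if hd \<sigma> = t then s (tl \<sigma>) else \<zero>\<^bsub>M\<^esub> else undefined)"

lemma cons_t_chain: "\<sigma> \<in> chains Q n \<Longrightarrow> t # \<sigma> \<in> chains Q (Suc n)"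
  using t_mem le_t chains_hd by (auto simp: chains_Cons_iff)

lemma linear_map_cone: "linear_map R (Ch n) (Ch (Suc n)) (cone n)"
proof (rule linear_map_chain_modI[OF module_chain_mod])
  show "linear_map R (Ch n) M (\<lambda>s. cone n s \<sigma>)" if "\<sigma> \<in> chains Q (Suc n)" for \<sigma>
    using that linear_map_chain_entry[OF chains_face[OF that, of 0]]
      linear_map_zero[OF module_chain_mod module_M]
    by (cases "hd \<sigma> = t") (simp_all add: cone_def face_0)
qed (simp add: cone_def)

lemma cone_gen:
  assumes "\<sigma> \<in> chains Q n"
  shows "cone n (ch_gen n \<sigma> m) = ch_gen (Suc n) (t # \<sigma>) m"
proof
  fix \<tau>
  have "\<tau> = t # \<sigma> \<longleftrightarrow> hd \<tau> = t \<and> tl \<tau> = \<sigma>" if "\<tau> \<in> chains Q (Suc n)"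
    using that by (elim chains_SucE) auto
  then show "cone n (ch_gen n \<sigma> m) \<tau> = ch_gen (Suc n) (t # \<sigma>) m \<tau>"
    using assms chains_face[of \<tau> Q n 0] by (auto simp: cone_def gen_def face_0)
qed

lemma bdry_cone_gen:
  assumes \<sigma>: "\<sigma> \<in> chains Q n" and m: "m \<in> carrier M"
  shows "ch_d n (ch_gen (Suc n) (t # \<sigma>) m) =
    ch_gen n \<sigma> m \<ominus>\<^bsub>Ch n\<^esub> (\<Oplus>\<^bsub>Ch n\<^esub>i\<in>{..n}. signed (Ch n) i (ch_gen n (t # face i \<sigma>) m))"
proof -
  let ?face = "\<lambda>i. ch_gen n (face i (t # \<sigma>)) (face_coeff (\<lambda>_ _ m. m) i (t # \<sigma>) m)"
  let ?tail = "\<lambda>i. ch_gen n (t # face i \<sigma>) m"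
  let ?sum = "\<Oplus>\<^bsub>Ch n\<^esub>i\<in>{..n}. signed (Ch n) i (?tail i)"
  note chain = cons_t_chain[OF \<sigma>]
  interpret uminus: linear_map R "Ch n" "Ch n" "\<lambda>x. \<ominus>\<^bsub>Ch n\<^esub> x"
    by (rule linear_map_uminus[OF module_chain_mod])
  have face_closed: "?face i \<in> carrier (Ch n)" if "i \<le> Suc n" for i
    using linear_map.map_closed[OF linear_map_face_gen[OF chain that]] m by simp
  have face_Suc: "?face (Suc i) = ?tail i" for i by (simp add: face_Suc_Cons)
  then have tail_closed: "?tail i \<in> carrier (Ch n)" if "i \<le> n" for i
    using face_closed[of "Suc i"] that by simp
  then have sum_closed: "?sum \<in> carrier (Ch n)" by (intro d.N.finsum_closed) auto
  have "ch_d n (ch_gen (Suc n) (t # \<sigma>) m) = (\<Oplus>\<^bsub>Ch n\<^esub>i\<in>{..Suc n}. signed (Ch n) i (?face i))"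
    by (simp only: bdry_gen[OF chain m] gen_bdry_def)
  also have "\<dots>
      = (\<Oplus>\<^bsub>Ch n\<^esub>i\<in>{..n}. signed (Ch n) (Suc i) (?face (Suc i))) \<oplus>\<^bsub>Ch n\<^esub> signed (Ch n) 0 (?face 0)"
    by (rule d.N.finsum_Suc2) (auto simp: face_closed)
  also have "(\<Oplus>\<^bsub>Ch n\<^esub>i\<in>{..n}. signed (Ch n) (Suc i) (?face (Suc i)))
    = (\<Oplus>\<^bsub>Ch n\<^esub>i\<in>{..n}. \<ominus>\<^bsub>Ch n\<^esub> signed (Ch n) i (?tail i))"
    unfolding face_Suc using tail_closed by (intro d.N.finsum_cong') (auto simp: d.N.signed_Suc)
  also have "\<dots> = \<ominus>\<^bsub>Ch n\<^esub> ?sum"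
    using tail_closed by (intro uminus.map_finsum[symmetric]) auto
  finally show ?thesis
    using gen_closed[OF \<sigma>] m sum_closed by (simp add: face_0 a_minus_def d.N.a_comm)
qed

lemma cone_homotopy:
  assumes "s \<in> carrier (Ch (Suc n))"
  shows "ch_d (Suc n) (cone (Suc n) s) \<oplus>\<^bsub>Ch (Suc n)\<^esub> cone n (ch_d n s) = s"
proof (rule linear_map_chain_mod_eqI[OF
        linear_map_plus[OF linear_map_comp[OF linear_map_cone linear_map_bdry]
        linear_map_comp[OF linear_map_bdry linear_map_cone]] linear_map_id[OF module_chain_mod]
          _ assms])
  fix \<sigma> m
  assume \<sigma>: "\<sigma> \<in> chains Q (Suc n)" and m: "m \<in> carrier M"
  let ?sum = "\<Oplus>\<^bsub>Ch (Suc n)\<^esub>i\<in>{..Suc n}. signed (Ch (Suc n)) i (ch_gen (Suc n) (t # face i \<sigma>) m)"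
  have cone_face: "cone n (ch_gen n (face i \<sigma>) (face_coeff (\<lambda>_ _ m. m) i \<sigma> m))
      = ch_gen (Suc n) (t # face i \<sigma>) m"
    if "i \<le> Suc n" for i
    using cone_gen[OF chains_face[OF \<sigma> that]] by (simp add: face_coeff_def)
  have term_closed: "ch_gen (Suc n) (t # face i \<sigma>) m \<in> carrier (Ch (Suc n))" if "i \<le> Suc n" for i
    using gen_closed[OF cons_t_chain[OF chains_face[OF \<sigma> that]]] m by simp
  have "cone n (ch_d n (ch_gen (Suc n) \<sigma> m)) = ?sum"
    unfolding bdry_gen[OF \<sigma> m] linear_map_of_gen_bdry[OF linear_map_cone \<sigma> m]
    using term_closed by (intro d.N.finsum_cong') (auto simp: cone_face)
  moreover have "ch_d (Suc n) (cone (Suc n) (ch_gen (Suc n) \<sigma> m))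
      = ch_gen (Suc n) \<sigma> m \<ominus>\<^bsub>Ch (Suc n)\<^esub> ?sum"
    unfolding cone_gen[OF \<sigma>] by (rule bdry_cone_gen[OF \<sigma> m])
  moreover have "?sum \<in> carrier (Ch (Suc n))" using term_closed by (intro d.N.finsum_closed) auto
  ultimately show "ch_d (Suc n) (cone (Suc n) (ch_gen (Suc n) \<sigma> m)) \<oplus>\<^bsub>Ch (Suc n)\<^esub>
      cone n (ch_d n (ch_gen (Suc n) \<sigma> m)) = ch_gen (Suc n) \<sigma> m"
    using gen_closed[OF \<sigma> m] by (simp only: d.N.minus_plus_cancel)
qed

lemma exact_Suc:
  assumes s: "s \<in> carrier (Ch (Suc n))" "ch_d n s = \<zero>\<^bsub>Ch n\<^esub>"
  shows "\<exists>y\<in>carrier (Ch (Suc (Suc n))). ch_d (Suc n) y = s"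
proof -
  interpret cone: linear_map R "Ch k" "Ch (Suc k)" "cone k" for k by (rule linear_map_cone)
  have "ch_d (Suc n) (cone (Suc n) s) = s" using cone_homotopy[OF s(1)] s by simp
  then show ?thesis using cone.map_closed[OF s(1)] by blast
qed

lemma linear_map_augmentation: "linear_map R (Ch 0) M augmentation"
  unfolding augmentation_def[abs_def]
  by (intro linear_map_finsum module_chain_mod module_M linear_map_chain_entry)

lemma augmentation_gen: "\<lbrakk>x \<in> Q; m \<in> carrier M\<rbrakk> \<Longrightarrow> augmentation (ch_gen 0 [x] m) = m"
  unfolding augmentation_def
  by (rule finsum_gen[OF linear_map_id[OF module_M]]) (auto simp: chains_0)

lemma augmentation_onto: "m \<in> carrier M \<Longrightarrow> \<exists>s\<in>carrier (Ch 0). augmentation s = m"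
  using t_mem
  by (intro bexI[of _ "ch_gen 0 [t] m"]) (auto simp: augmentation_gen chains_0 intro: gen_closed)

lemma augmentation_bdry:
  assumes "s \<in> carrier (Ch (Suc 0))"
  shows "augmentation (ch_d 0 s) = \<zero>\<^bsub>M\<^esub>"
proof (rule linear_map_chain_mod_eqI[OF linear_map_comp[OF linear_map_bdry linear_map_augmentation]
      linear_map_zero[OF module_chain_mod module_M] _ assms])
  fix \<sigma> m
  assume \<sigma>: "\<sigma> \<in> chains Q (Suc 0)" and m: "m \<in> carrier M"
  interpret M: module R M by (rule module_M)
  have "augmentation (ch_gen 0 (face i \<sigma>) (face_coeff (\<lambda>_ _ m. m) i \<sigma> m)) = m" if "i \<le> Suc 0" for i
    using chains_face[OF \<sigma> that] m by (auto simp: chains_0 augmentation_gen face_coeff_def)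
  then have "augmentation (gen_bdry 0 \<sigma> m) = (\<Oplus>\<^bsub>M\<^esub>i\<in>{..Suc 0}. signed M i m)"
    unfolding linear_map_of_gen_bdry[OF linear_map_augmentation \<sigma> m]
    using m by (intro M.finsum_cong') auto
  also have "\<dots> = \<zero>\<^bsub>M\<^esub>" using m by (simp add: M.signed_Suc M.l_neg)
  finally show "augmentation (ch_d 0 (ch_gen (Suc 0) \<sigma> m)) = \<zero>\<^bsub>M\<^esub>" by (simp only: bdry_gen[OF \<sigma> m])
qed

lemma exact_0:
  assumes s: "s \<in> carrier (Ch 0)" "augmentation s = \<zero>\<^bsub>M\<^esub>"
  shows "\<exists>y\<in>carrier (Ch (Suc 0)). ch_d 0 y = s"
proof -
  have t_chain: "[t] \<in> chains Q 0" using t_mem by (simp add: chains_0)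
  interpret base: linear_map R M "Ch 0" "ch_gen 0 [t]" using linear_map_gen[OF t_chain] by simp
  interpret cone: linear_map R "Ch k" "Ch (Suc k)" "cone k" for k by (rule linear_map_cone)
  have "ch_d 0 (cone 0 s) \<oplus>\<^bsub>Ch 0\<^esub> ch_gen 0 [t] (augmentation s) = s"
  proof (rule linear_map_chain_mod_eqI[OF
          linear_map_plus[OF linear_map_comp[OF linear_map_cone linear_map_bdry]
          linear_map_comp[OF linear_map_augmentation base.linear_map_axioms]]
        linear_map_id[OF module_chain_mod] _ s(1)])
    fix \<sigma> m
    assume \<sigma>: "\<sigma> \<in> chains Q 0" and m: "m \<in> carrier M"
    then obtain x where x: "\<sigma> = [x]" "x \<in> Q" by (auto simp: chains_0)
    show "ch_d 0 (cone 0 (ch_gen 0 \<sigma> m)) \<oplus>\<^bsub>Ch 0\<^esub> ch_gen 0 [t] (augmentation (ch_gen 0 \<sigma> m))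
        = ch_gen 0 \<sigma> m"
      unfolding cone_gen[OF \<sigma>] bdry_cone_gen[OF \<sigma> m]
      using gen_closed[OF \<sigma>] gen_closed[OF t_chain] m x
      by (simp add: augmentation_gen face_0 d.N.minus_plus_cancel)
  qed
  then have "ch_d 0 (cone 0 s) = s" using s by simp
  then show ?thesis using cone.map_closed[OF s(1)] by blast
qed

end

section \<open>Complexes of sheaves\<close>

lemma chain_map_same: "chain_map Q Q G' f n s
    = (\<lambda>\<sigma>. if \<sigma> \<in> chains Q n then f (hd \<sigma>) (s \<sigma>) else undefined)"
  by (simp add: chain_map_def fun_eq_iff)

lemma chain_map_image:
  "chain_map Q Q G' f n ` carrier (chain_mod Q G n) =
     {t. (\<forall>\<sigma>\<in>chains Q n. t \<sigma> \<in> f (hd \<sigma>) ` carrier (G (hd \<sigma>))) \<and>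
       (\<forall>\<sigma>. \<sigma> \<notin> chains Q n \<longrightarrow> t \<sigma> = undefined)}"
proof (intro subset_antisym subsetI)
  fix t
  assume "t \<in> {t. (\<forall>\<sigma>\<in>chains Q n. t \<sigma> \<in> f (hd \<sigma>) ` carrier (G (hd \<sigma>))) \<and>
    (\<forall>\<sigma>. \<sigma> \<notin> chains Q n \<longrightarrow> t \<sigma> = undefined)}"
  then have "\<forall>\<sigma>\<in>chains Q n. \<exists>m. m \<in> carrier (G (hd \<sigma>)) \<and> t \<sigma> = f (hd \<sigma>) m"
    and undefined: "\<And>\<sigma>. \<sigma> \<notin> chains Q n \<Longrightarrow> t \<sigma> = undefined" by auto
  then obtain m where m: "\<And>\<sigma>. \<sigma> \<in> chains Q n \<Longrightarrow> m \<sigma> \<in> carrier (G (hd \<sigma>)) \<and> t \<sigma> = f (hd \<sigma>) (m \<sigma>)"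
    by (metis bchoice)
  let ?s = "\<lambda>\<sigma>. if \<sigma> \<in> chains Q n then m \<sigma> else undefined"
  have "t = chain_map Q Q G' f n ?s" using m undefined by (auto simp: chain_map_same fun_eq_iff)
  moreover have "?s \<in> carrier (chain_mod Q G n)" using m by (simp add: chain_mod_simps)
  ultimately show "t \<in> chain_map Q Q G' f n ` carrier (chain_mod Q G n)" by blast
qed (auto simp: chain_map_same chain_mod_simps)

locale sheaf_complex =
  fixes R :: "'r ring" and Q :: "'a::order set" and G :: "nat \<Rightarrow> 'a \<Rightarrow> ('r,'m) module"
    and rho :: "nat \<Rightarrow> 'a \<Rightarrow> 'a \<Rightarrow> 'm \<Rightarrow> 'm" and b :: "nat \<Rightarrow> 'a \<Rightarrow> 'm \<Rightarrow> 'm"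
  assumes poset_sheaf: "poset_sheaf R Q (G q) (rho q)"
    and linear_map_b: "x \<in> Q \<Longrightarrow> linear_map R (G (Suc q) x) (G q x) (b q x)"
    and b_natural: "\<lbrakk>x \<in> Q; y \<in> Q; x \<le> y; s \<in> carrier (G (Suc q) y)\<rbrakk> \<Longrightarrow>
      b q x (rho (Suc q) y x s) = rho q y x (b q y s)"
    and b_b: "\<lbrakk>x \<in> Q; s \<in> carrier (G (Suc (Suc q)) x)\<rbrakk> \<Longrightarrow> b q x (b (Suc q) x s) = \<zero>\<^bsub>G q x\<^esub>"
begin

sublocale sheaf: poset_sheaf R Q "G q" "rho q" for q
  by (rule poset_sheaf)

sublocale b: sheaf_overlap_hom R Q "G (Suc q)" "rho (Suc q)" Q "G q" "rho q" "b q" for q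
  by (intro sheaf_overlap_hom.intro sheaf_overlap_hom_axioms.intro poset_sheaf linear_map_b)
    (simp_all add: b_natural)

lemma stalk_complex: "x \<in> Q \<Longrightarrow> chain_complex R (\<lambda>q. G q x) (\<lambda>q. b q x)"
  by (intro chain_complex.intro linear_map_b b_b)

sublocale double_complex R "\<lambda>p q. chain_mod Q (G q) p" "\<lambda>p q. bdry Q (G q) (rho q) p"
  "\<lambda>p q. chain_map Q Q (G q) (b q) p"
proof (intro double_complex.intro sheaf.linear_map_bdry b.linear_map_chain_map sheaf.bdry_bdry)
  fix p q x
  show "chain_map Q Q (G q) (b q) p (chain_map Q Q (G (Suc q)) (b (Suc q)) p x)
      = \<zero>\<^bsub>chain_mod Q (G q) p\<^esub>"
    if "x \<in> carrier (chain_mod Q (G (Suc (Suc q))) p)"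
    using that by (auto simp: chain_map_same chain_mod_simps fun_eq_iff chains_hd b_b)
qed (simp_all only: b.chain_map_bdry)

abbreviation stalk_cycles :: "nat \<Rightarrow> 'a \<Rightarrow> 'm set" where
  "stalk_cycles q x \<equiv> complex_cycles (\<lambda>q. G q x) (\<lambda>q. b q x) q"

abbreviation stalk_boundaries :: "nat \<Rightarrow> 'a \<Rightarrow> 'm set" where
  "stalk_boundaries q x \<equiv> complex_boundaries (\<lambda>q. G q x) (\<lambda>q. b q x) q"

definition cycle_sheaf :: "nat \<Rightarrow> 'a \<Rightarrow> ('r,'m) module" where
  "cycle_sheaf q x = (G q x)\<lparr>carrier := stalk_cycles q x\<rparr>"

definition homology_sheaf :: "nat \<Rightarrow> 'a \<Rightarrow> ('r,'m set) module" where
  "homology_sheaf q x = complex_homology (\<lambda>q. G q x) (\<lambda>q. b q x) q"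

definition homology_map :: "nat \<Rightarrow> 'a \<Rightarrow> 'a \<Rightarrow> 'm set \<Rightarrow> 'm set" where
  "homology_map q y x X = stalk_boundaries q x <+>\<^bsub>G q x\<^esub> rho q y x ` X"

definition homology_class :: "nat \<Rightarrow> 'a \<Rightarrow> 'm \<Rightarrow> 'm set" where
  "homology_class q x s = stalk_boundaries q x +>\<^bsub>G q x\<^esub> s"

lemma subquotient_stalk: "x \<in> Q \<Longrightarrow> subquotient R (G q x) (stalk_cycles q x) (stalk_boundaries q x)"
  by (rule chain_complex.subquotient_homology[OF stalk_complex])

lemma homology_sheaf_eq: "homology_sheaf q x
    = quot_mod (G q x) (stalk_cycles q x) (stalk_boundaries q x)"
  by (simp add: homology_sheaf_def complex_homology_def)

lemma stalk_cycles_carrier: "\<lbrakk>x \<in> Q; s \<in> stalk_cycles q x\<rbrakk> \<Longrightarrow> s \<in> carrier (G q x)"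
  by (rule subquotient.A_carrier[OF subquotient_stalk])

lemma carrier_homology_sheaf: "x \<in> Q \<Longrightarrow>
    carrier (homology_sheaf q x) = homology_class q x ` stalk_cycles q x"
  by (simp add: homology_sheaf_eq homology_class_def[abs_def]
    subquotient.carrier_quot[OF subquotient_stalk])

lemma linear_map_homology_class: "x \<in> Q \<Longrightarrow>
    linear_map R (cycle_sheaf q x) (homology_sheaf q x) (homology_class q x)"
  unfolding cycle_sheaf_def homology_sheaf_eq homology_class_def[abs_def]
  by (rule subquotient.linear_map_proj[OF subquotient_stalk])

lemma homology_class_eq_zero_iff:
  "\<lbrakk>x \<in> Q; s \<in> stalk_cycles q x\<rbrakk> \<Longrightarrow> homology_class q x s = \<zero>\<^bsub>homology_sheaf q x\<^esub> \<longleftrightarrow>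
    s \<in> stalk_boundaries q x"
  unfolding homology_sheaf_eq homology_class_def
  by (rule subquotient.coset_eq_zero_iff[OF subquotient_stalk])

lemma linear_map_cycle_inclusion: "x \<in> Q \<Longrightarrow> linear_map R (cycle_sheaf q x) (G q x) (\<lambda>s. s)"
  unfolding cycle_sheaf_def
  by (intro linear_map_inclusion sheaf.module_stalk subquotient.submodule_A[OF subquotient_stalk])

context
  fixes x y
  assumes x: "x \<in> Q" and y: "y \<in> Q" and x_le_y: "x \<le> y"
begin

lemma rho_stalk_cycles: "s \<in> stalk_cycles q y \<Longrightarrow> rho q y x s \<in> stalk_cycles q x"
  using linear_map.map_closed[OF sheaf.linear_map_rho[OF x y x_le_y]] b_natural[OF x y x_le_y]
    linear_map.map_zero[OF sheaf.linear_map_rho[OF x y x_le_y]]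
  by (cases q) (auto simp: complex_cycles_def)

lemma rho_stalk_boundaries: "s \<in> stalk_boundaries q y \<Longrightarrow> rho q y x s \<in> stalk_boundaries q x"
  using linear_map.map_closed[OF sheaf.linear_map_rho[OF x y x_le_y]]
    b_natural[OF x y x_le_y, symmetric]
  by (auto simp: complex_boundaries_def)

lemma homology_map_class:
  "s \<in> stalk_cycles q y \<Longrightarrow>
    homology_map q y x (homology_class q y s) = homology_class q x (rho q y x s)"
  unfolding homology_map_def homology_class_def
  by (rule linear_map.coset_image[OF sheaf.linear_map_rho[OF x y x_le_y]
        subquotient.submodule_B[OF subquotient_stalk[OF y]]
        subquotient.submodule_B[OF subquotient_stalk[OF x]] image_subsetI[OF rho_stalk_boundaries]
        stalk_cycles_carrier[OF y]])

lemma linear_map_rho_cycles: "linear_map R (cycle_sheaf q y) (cycle_sheaf q x) (rho q y x)"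
proof -
  interpret rho: linear_map R "G q y" "G q x" "rho q y x"
    by (rule sheaf.linear_map_rho[OF x y x_le_y])
  interpret X: subquotient R "G q x" "stalk_cycles q x" "stalk_boundaries q x"
    by (rule subquotient_stalk[OF x])
  interpret Y: subquotient R "G q y" "stalk_cycles q y" "stalk_boundaries q y"
    by (rule subquotient_stalk[OF y])
  show ?thesis
    unfolding cycle_sheaf_def
    by (intro linear_mapI submodule.submodule_is_module[OF X.submodule_A rho.N.module_axioms]
        submodule.submodule_is_module[OF Y.submodule_A rho.M.module_axioms])
      (simp_all add: rho_stalk_cycles rho.map_add rho.map_smult)
qed

lemma linear_map_homology_map:
  "linear_map R (homology_sheaf q y) (homology_sheaf q x) (homology_map q y x)"
proof -
  interpret span: subquotient_span R "G q y" "stalk_cycles q y" "stalk_boundaries q y"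
    "G q x" "stalk_cycles q x" "stalk_boundaries q x" "cycle_sheaf q y" "\<lambda>s. s" "rho q y x"
    by (intro subquotient_span.intro subquotient_span_axioms.intro subquotient_stalk x y
        linear_map_cycle_inclusion
        linear_map_comp[OF linear_map_cycle_inclusion sheaf.linear_map_rho] x_le_y) (use
        rho_stalk_cycles rho_stalk_boundaries in \<open>auto simp: cycle_sheaf_def\<close>)
  show ?thesis
    unfolding homology_sheaf_eq using homology_map_class[unfolded homology_class_def]
    by (intro span.linear_map_quotI) (simp add: cycle_sheaf_def)
qed

end

lemma poset_sheaf_cycle: "poset_sheaf R Q (cycle_sheaf q) (rho q)"
proof (intro poset_sheaf.intro sheaf.cring sheaf.finite)
  show "is_sheaf R Q (cycle_sheaf q) (rho q)"
    unfolding is_sheaf_def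
  proof (intro conjI ballI impI)
    show "module R (cycle_sheaf q x)" if "x \<in> Q" for x
      using linear_map_cycle_inclusion[OF that] by (rule linear_map.axioms)
    show "rho q y x \<in> lin_maps R (cycle_sheaf q y) (cycle_sheaf q x)"
        if "x \<in> Q" "y \<in> Q" "x \<le> y" for x y
      by (rule linear_map.lin_maps[OF linear_map_rho_cycles[OF that]])
  qed (auto simp: cycle_sheaf_def stalk_cycles_carrier sheaf.rho_id sheaf.rho_rho)
qed

lemma poset_sheaf_homology: "poset_sheaf R Q (homology_sheaf q) (homology_map q)"
proof (intro poset_sheaf.intro sheaf.cring sheaf.finite)
  show "is_sheaf R Q (homology_sheaf q) (homology_map q)"
    unfolding is_sheaf_def
  proof (intro conjI ballI impI)
    show "module R (homology_sheaf q x)" if "x \<in> Q" for x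
      using linear_map_homology_class[OF that] by (rule linear_map.axioms)
    show "homology_map q y x \<in> lin_maps R (homology_sheaf q y) (homology_sheaf q x)"
      if "x \<in> Q" "y \<in> Q" "x \<le> y" for x y
      by (rule linear_map.lin_maps[OF linear_map_homology_map[OF that]])
    show "homology_map q x x X = X" if "x \<in> Q" "X \<in> carrier (homology_sheaf q x)" for x X
      using that
      by (auto simp: carrier_homology_sheaf homology_map_class sheaf.rho_id stalk_cycles_carrier)
    show "homology_map q y x (homology_map q z y X) = homology_map q z x X"
      if "x \<in> Q" "y \<in> Q" "z \<in> Q" "x \<le> y" "y \<le> z" "X \<in> carrier (homology_sheaf q z)" for x y z X
      using that order_trans[OF that(4,5)]
      by (auto simp: carrier_homology_sheaf homology_map_class rho_stalk_cycles sheaf.rho_rho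
        stalk_cycles_carrier)
  qed
qed

sublocale cycle: poset_sheaf R Q "cycle_sheaf q" "rho q" for q
  by (rule poset_sheaf_cycle)

sublocale homology: poset_sheaf R Q "homology_sheaf q" "homology_map q" for q
  by (rule poset_sheaf_homology)

sublocale inclusion: sheaf_overlap_hom R Q "cycle_sheaf q" "rho q" Q "G q" "rho q" "\<lambda>_ s. s" for q
  by (intro sheaf_overlap_hom.intro sheaf_overlap_hom_axioms.intro poset_sheaf poset_sheaf_cycle
      linear_map_cycle_inclusion) auto

sublocale class_map: sheaf_overlap_hom R Q "cycle_sheaf q" "rho q" Q "homology_sheaf q"
  "homology_map q"
  "homology_class q" for q
  by (intro sheaf_overlap_hom.intro sheaf_overlap_hom_axioms.intro poset_sheaf_homology
    poset_sheaf_cycle linear_map_homology_class) (auto simp: homology_map_class cycle_sheaf_def)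

lemma vcycles_iff:
  "s \<in> vcycles p q \<longleftrightarrow>
    s \<in> carrier (chain_mod Q (G q) p) \<and> (\<forall>\<sigma>\<in>chains Q p. s \<sigma> \<in> stalk_cycles q (hd \<sigma>))"
proof (cases q)
  case 0
  then show ?thesis by (auto simp: complex_cycles_def chain_mod_simps)
next
  case (Suc k)
  have "chain_map Q Q (G k) (b k) p s = \<zero>\<^bsub>chain_mod Q (G k) p\<^esub> \<longleftrightarrow>
      (\<forall>\<sigma>\<in>chains Q p. b k (hd \<sigma>) (s \<sigma>) = \<zero>\<^bsub>G k (hd \<sigma>)\<^esub>)"
    by (auto simp: chain_map_same chain_mod_simps fun_eq_iff)
  then show ?thesis by (auto simp: Suc complex_cycles_def chain_mod_simps)
qed

lemma chain_mod_cycle_sheaf: "chain_mod Q (cycle_sheaf q) p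
    = (chain_mod Q (G q) p)\<lparr>carrier := vcycles p q\<rparr>"
proof -
  have "carrier (chain_mod Q (cycle_sheaf q) p) = vcycles p q"
    by (auto simp: vcycles_iff chain_mod_simps cycle_sheaf_def stalk_cycles_carrier chains_hd)
  then show ?thesis by (simp add: chain_mod_def cycle_sheaf_def cong: if_cong)
qed

lemma vboundaries_iff:
  "s \<in> vboundaries p q \<longleftrightarrow>
    s \<in> carrier (chain_mod Q (G q) p) \<and> (\<forall>\<sigma>\<in>chains Q p. s \<sigma> \<in> stalk_boundaries q (hd \<sigma>))"
proof -
  have "s \<in> carrier (chain_mod Q (G q) p)"
    if "s \<in> chain_map Q Q (G q) (b q) p ` carrier (chain_mod Q (G (Suc q)) p)"
    using that linear_map.map_closed[OF b.linear_map_chain_map] by blast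
  then show ?thesis unfolding complex_boundaries_def chain_map_image by (auto simp: chain_mod_simps)
qed

lemma bdry_cycle_sheaf:
  assumes "s \<in> vcycles (Suc p) q"
  shows "bdry Q (cycle_sheaf q) (rho q) p s = bdry Q (G q) (rho q) p s"
proof -
  have carrier: "carrier (chain_mod Q (cycle_sheaf q) n) = vcycles n q" for n
    by (simp add: chain_mod_cycle_sheaf)
  have inclusion: "chain_map Q Q (G q) (\<lambda>_ s. s) n u = u" if "u \<in> vcycles n q" for u n
    using that by (auto simp: chain_map_same vcycles_iff chain_mod_simps fun_eq_iff)
  have "bdry Q (cycle_sheaf q) (rho q) p s \<in> vcycles p q"
    using cycle.d.map_closed[of s q p] assms by (simp add: carrier)
  then show ?thesis using inclusion.chain_map_bdry[of s q p] assms by (simp add: inclusion carrier)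
qed

theorem page_2_iso:
  "mod_iso R (page 2 (int p) (int q)) (HS Q (homology_sheaf q) (homology_map q) p)"
proof -
  let ?class = "chain_map Q Q (homology_sheaf q) (homology_class q)"
  have carrier: "carrier (chain_mod Q (cycle_sheaf q) n) = vcycles n q" for n
    by (simp add: chain_mod_cycle_sheaf)
  have class_eq_zero_iff: "?class p x = \<zero>\<^bsub>chain_mod Q (homology_sheaf q) p\<^esub> \<longleftrightarrow> x \<in> vboundaries p q"
    if "x \<in> vcycles p q" for p x
    using that chain_mod_zero_iff[OF class_map.linear_map_chain_map[THEN linear_map.map_closed],
        of x q p]
    by (simp add: carrier vboundaries_iff vcycles_iff chain_map_same homology_class_eq_zero_iff
      chains_hd)
  have class_onto: "?class p ` vcycles p q = carrier (chain_mod Q (homology_sheaf q) p)" for p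
    unfolding carrier[symmetric] chain_map_image
    by (auto simp: chain_mod_simps carrier_homology_sheaf chains_hd cycle_sheaf_def)
  interpret vertical_homology_model R "\<lambda>p q. chain_mod Q (G q) p" "\<lambda>p q. bdry Q (G q) (rho q) p"
    "\<lambda>p q. chain_map Q Q (G q) (b q) p" "chain_mod Q (homology_sheaf q)"
    "bdry Q (homology_sheaf q) (homology_map q)" q ?class
    by (intro vertical_homology_model.intro vertical_homology_model_axioms.intro
      double_complex_axioms homology.chain_complex_axioms
      class_map.linear_map_chain_map[unfolded chain_mod_cycle_sheaf]
        class_onto class_eq_zero_iff)
      (simp_all add: class_map.chain_map_bdry[symmetric] bdry_cycle_sheaf carrier)
  show ?thesis using page_2_iso_homology by (simp add: HS_eq)
qed

end

section \<open>The double complex of a covering\<close>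

lemma ext_chain_eq_chain_map: "S' \<subseteq> S \<Longrightarrow> ext_chain S' S G n = chain_map S' S G (\<lambda>_ m. m) n"
  using chains_mono[of S' S n] by (auto simp: ext_chain_def chain_map_def fun_eq_iff)

lemma ext_chain_trans:
  "\<lbrakk>S'' \<subseteq> S'; S' \<subseteq> S\<rbrakk> \<Longrightarrow> ext_chain S' S G n (ext_chain S'' S' G n s) = ext_chain S'' S G n s"
  using chains_mono[of S'' S' n] chains_mono[of S' S n] by (auto simp: ext_chain_def fun_eq_iff)

lemma ext_chain_refl: "s \<in> carrier (chain_mod S G n) \<Longrightarrow> ext_chain S S G n s = s"
  by (auto simp: ext_chain_def chain_mod_simps fun_eq_iff)

context poset_sheaf
begin

lemma poset_sheaf_subset:
  assumes "S \<subseteq> Q"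
  shows "poset_sheaf R S G rho"
proof (intro poset_sheaf.intro cring finite_subset[OF assms finite])
  show "is_sheaf R S G rho" using sheaf assms unfolding is_sheaf_def by (meson subsetD)
qed

context
  fixes S S'
  assumes sub: "S' \<subseteq> S" "S \<subseteq> Q"
begin

interpretation extension: sheaf_overlap_hom R S' G rho S G rho "\<lambda>_ m. m"
  using sub by (intro sheaf_overlap_hom.intro sheaf_overlap_hom_axioms.intro poset_sheaf_subset)
    (auto intro: linear_map_id module_stalk)

lemma linear_map_ext_chain: "linear_map R (chain_mod S' G n) (chain_mod S G n) (ext_chain S' S G n)"
  unfolding ext_chain_eq_chain_map[OF sub(1)] by (rule extension.linear_map_chain_map)

lemma ext_chain_bdry:
  "s \<in> carrier (chain_mod S' G (Suc n)) \<Longrightarrow>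
    ext_chain S' S G n (bdry S' G rho n s) = bdry S G rho n (ext_chain S' S G (Suc n) s)"
  unfolding ext_chain_eq_chain_map[OF sub(1)] by (rule extension.chain_map_bdry)

end

end

lemma PX_antimono: "X \<subseteq> Y \<Longrightarrow> PX Pa Y \<subseteq> PX Pa X"
  by (auto simp: PX_def)

locale upper_covering = P: poset_sheaf R P F rho
  for R :: "'r ring" and P :: "'a::order set" and F :: "'a \<Rightarrow> ('r,'m) module" and rho +
  fixes K :: "'k set" and Pa :: "'k \<Rightarrow> 'a set"
  assumes finite_K: "finite K" and upper_convex: "\<alpha> \<in> K \<Longrightarrow> upper_convex P (Pa \<alpha>)"
    and cover: "P = (\<Union>\<alpha>\<in>K. Pa \<alpha>)"
begin

abbreviation N :: "'k set set" where "N \<equiv> nerve K Pa"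

abbreviation simplex_chains :: "nat \<Rightarrow> 'k set \<Rightarrow> ('r, 'a list \<Rightarrow> 'm) module" where
  "simplex_chains q X \<equiv> chain_mod (PX Pa X) F q"

abbreviation simplex_ext :: "nat \<Rightarrow> 'k set \<Rightarrow> 'k set \<Rightarrow> ('a list \<Rightarrow> 'm) \<Rightarrow> 'a list \<Rightarrow> 'm" where
  "simplex_ext q Y X \<equiv> ext_chain (PX Pa Y) (PX Pa X) F q"

abbreviation simplex_bdry :: "nat \<Rightarrow> 'k set \<Rightarrow> ('a list \<Rightarrow> 'm) \<Rightarrow> 'a list \<Rightarrow> 'm" where
  "simplex_bdry q X \<equiv> bdry (PX Pa X) F rho q"

abbreviation cover_mod :: "nat \<Rightarrow> nat \<Rightarrow> ('r, 'k set list \<Rightarrow> 'a list \<Rightarrow> 'm) module" where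
  "cover_mod p q \<equiv> chain_mod N (simplex_chains q) p"

abbreviation row_bdry ::
    "nat \<Rightarrow> nat \<Rightarrow> ('k set list \<Rightarrow> 'a list \<Rightarrow> 'm) \<Rightarrow> 'k set list \<Rightarrow> 'a list \<Rightarrow> 'm" where
  "row_bdry p q \<equiv> bdry N (simplex_chains q) (simplex_ext q) p"

abbreviation column_bdry ::
    "nat \<Rightarrow> nat \<Rightarrow> ('k set list \<Rightarrow> 'a list \<Rightarrow> 'm) \<Rightarrow> 'k set list \<Rightarrow> 'a list \<Rightarrow> 'm" where
  "column_bdry p q \<equiv> chain_map N N (simplex_chains q) (simplex_bdry q) p"

lemma finite_nerve: "finite N"
  by (rule finite_subset[of _ "Pow K"]) (auto simp: nerve_def finite_K)

lemma PX_subset: "X \<in> N \<Longrightarrow> PX Pa X \<subseteq> P"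
  using cover by (auto simp: nerve_def PX_def)

lemma poset_sheaf_PX: "X \<in> N \<Longrightarrow> poset_sheaf R (PX Pa X) F rho"
  by (rule P.poset_sheaf_subset[OF PX_subset])

sublocale sheaf_complex R N simplex_chains simplex_ext simplex_bdry
proof (rule sheaf_complex.intro)
  show "poset_sheaf R N (simplex_chains q) (simplex_ext q)" for q
  proof (intro poset_sheaf.intro P.cring finite_nerve)
    show "is_sheaf R N (simplex_chains q) (simplex_ext q)"
      unfolding is_sheaf_def
      by (auto intro: poset_sheaf.module_chain_mod[OF poset_sheaf_PX]
          linear_map.lin_maps[OF P.linear_map_ext_chain[OF PX_antimono PX_subset]]
          simp: ext_chain_refl ext_chain_trans[OF PX_antimono PX_antimono])
  qed
qed (auto intro: poset_sheaf.linear_map_bdry[OF poset_sheaf_PX]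
  poset_sheaf.bdry_bdry[OF poset_sheaf_PX] simp: P.ext_chain_bdry[OF PX_antimono PX_subset])

lemma Hsheaf_eq: "Hsheaf Pa F rho q = homology_sheaf q"
  by (simp add: fun_eq_iff Hsheaf_def homology_sheaf_def HS_eq)

lemma Hsheaf_map_eq: "Hsheaf_map Pa F rho q = homology_map q"
  by (simp add: fun_eq_iff Hsheaf_map_def HS_map_def homology_map_def boundaries_eq)

section \<open>The rows of the double complex of a covering\<close>

definition simplices_of :: "'a list \<Rightarrow> 'k set set" where
  "simplices_of \<sigma> = {X \<in> N. set \<sigma> \<subseteq> PX Pa X}"

definition greatest_simplex :: "'a list \<Rightarrow> 'k set" where
  "greatest_simplex \<sigma> = {\<alpha> \<in> K. set \<sigma> \<subseteq> Pa \<alpha>}"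

lemma simplices_of_subset: "simplices_of \<sigma> \<subseteq> N"
  by (auto simp: simplices_of_def)

lemma mem_simplices_of_iff: "\<lbrakk>\<sigma> \<in> chains P q; X \<in> N\<rbrakk> \<Longrightarrow> X \<in> simplices_of \<sigma> \<longleftrightarrow> \<sigma> \<in> chains (PX Pa X) q"
  by (auto simp: simplices_of_def chains_altdef)

lemma greatest_simplex_mem:
  assumes \<sigma>: "\<sigma> \<in> chains P q"
  shows "greatest_simplex \<sigma> \<in> simplices_of \<sigma>"
proof -
  have nonempty: "set \<sigma> \<noteq> {}" and subset: "set \<sigma> \<subseteq> P" using \<sigma> by (auto simp: chains_altdef)
  then have "last \<sigma> \<in> P" by auto
  then obtain \<alpha> where \<alpha>: "\<alpha> \<in> K" "last \<sigma> \<in> Pa \<alpha>" using cover by blast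
  then have "set \<sigma> \<subseteq> Pa \<alpha>"
    using upper_convex[OF \<alpha>(1)] subset chains_last_le[OF \<sigma>] unfolding upper_convex_def by blast
  then have "greatest_simplex \<sigma> \<noteq> {}" using \<alpha>(1) by (auto simp: greatest_simplex_def)
  moreover have "set \<sigma> \<subseteq> PX Pa (greatest_simplex \<sigma>)" by (auto simp: PX_def greatest_simplex_def)
  ultimately show ?thesis
    using nonempty unfolding simplices_of_def nerve_def by (auto simp: greatest_simplex_def)
qed

lemma constant_sheaf_simplices_of:
  assumes \<sigma>: "\<sigma> \<in> chains P q"
  shows "constant_sheaf_greatest R (simplices_of \<sigma>) (F (hd \<sigma>)) (greatest_simplex \<sigma>)"
proof (intro constant_sheaf_greatest.intro P.module_stalk[OF chains_hd[OF \<sigma>]]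
  greatest_simplex_mem[OF \<sigma>])
  show "finite (simplices_of \<sigma>)" by (rule finite_subset[OF simplices_of_subset finite_nerve])
qed (auto simp: simplices_of_def greatest_simplex_def nerve_def PX_def)

abbreviation slice_mod :: "'a list \<Rightarrow> nat \<Rightarrow> ('r, 'k set list \<Rightarrow> 'm) module" where
  "slice_mod \<sigma> p \<equiv> chain_mod (simplices_of \<sigma>) (\<lambda>_. F (hd \<sigma>)) p"

abbreviation slice_bdry :: "'a list \<Rightarrow> nat \<Rightarrow> ('k set list \<Rightarrow> 'm) \<Rightarrow> 'k set list \<Rightarrow> 'm" where
  "slice_bdry \<sigma> p \<equiv> bdry (simplices_of \<sigma>) (\<lambda>_. F (hd \<sigma>)) (\<lambda>_ _ m. m) p"

definition slice :: "'a list \<Rightarrow> nat \<Rightarrow> ('k set list \<Rightarrow> 'a list \<Rightarrow> 'm) \<Rightarrow> 'k set list \<Rightarrow> 'm" where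
  "slice \<sigma> = chain_map N (simplices_of \<sigma>) (\<lambda>_. F (hd \<sigma>)) (\<lambda>X u. u \<sigma>)"

lemma sheaf_overlap_hom_slice:
  assumes \<sigma>: "\<sigma> \<in> chains P q"
  shows "sheaf_overlap_hom R N (simplex_chains q) (simplex_ext q)
    (simplices_of \<sigma>) (\<lambda>_. F (hd \<sigma>)) (\<lambda>_ _ m. m) (\<lambda>X u. u \<sigma>)"
proof -
  interpret const: constant_sheaf_greatest R "simplices_of \<sigma>" "F (hd \<sigma>)" "greatest_simplex \<sigma>"
    by (rule constant_sheaf_simplices_of[OF \<sigma>])
  show ?thesis
  proof (intro sheaf_overlap_hom.intro sheaf_overlap_hom_axioms.intro poset_sheaf
    const.poset_sheaf_axioms)
    show "linear_map R (simplex_chains q X) (F (hd \<sigma>)) (\<lambda>u. u \<sigma>)"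
        if "X \<in> N" "X \<in> simplices_of \<sigma>" for X
      using that by (intro poset_sheaf.linear_map_chain_entry[OF poset_sheaf_PX])
        (simp_all add: mem_simplices_of_iff[OF \<sigma>])
    show "X \<in> simplices_of \<sigma>" if "X \<in> N" "Y \<in> simplices_of \<sigma>" "X \<le> Y" for X Y
      using that PX_antimono[of X Y Pa] by (auto simp: simplices_of_def)
    show "simplex_ext q Y X u \<sigma> = (if Y \<in> simplices_of \<sigma> then u \<sigma> else \<zero>\<^bsub>F (hd \<sigma>)\<^esub>)"
      if "X \<in> N" "X \<in> simplices_of \<sigma>" "Y \<in> N" for X Y u
      using that by (simp add: ext_chain_def mem_simplices_of_iff[OF \<sigma>])
  qed
qed

lemma slice_chain_iff:
  assumes "\<sigma> \<in> chains P q" "\<tau> \<in> chains N p"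
  shows "\<tau> \<in> chains (simplices_of \<sigma>) p \<longleftrightarrow> \<sigma> \<in> chains (PX Pa (hd \<tau>)) q"
  using sheaf_overlap_hom.chains_overlap_iff[OF sheaf_overlap_hom_slice[OF assms(1)] assms(2)]
    mem_simplices_of_iff[OF assms(1) chains_hd[OF assms(2)]]
  by simp

lemma slice_entry: "\<tau> \<in> chains (simplices_of \<sigma>) p \<Longrightarrow> slice \<sigma> p x \<tau> = x \<tau> \<sigma>"
  using chains_mono[OF simplices_of_subset] by (auto simp: slice_def chain_map_def)

lemma slice_eqI:
  assumes x: "x \<in> carrier (cover_mod p q)" and y: "y \<in> carrier (cover_mod p q)"
    and eq: "\<And>\<sigma>. \<sigma> \<in> chains P q \<Longrightarrow> slice \<sigma> p x = slice \<sigma> p y"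
  shows "x = y"
proof (rule chain_mod_eqI[OF x y])
  fix \<tau>
  assume \<tau>: "\<tau> \<in> chains N p"
  show "x \<tau> = y \<tau>"
  proof (rule chain_mod_eqI)
    show "x \<tau> \<in> carrier (simplex_chains q (hd \<tau>))" "y \<tau> \<in> carrier (simplex_chains q (hd \<tau>))"
      using x y \<tau> by (auto intro: sheaf.entry_closed)
    fix \<sigma>
    assume "\<sigma> \<in> chains (PX Pa (hd \<tau>)) q"
    moreover from this have \<sigma>: "\<sigma> \<in> chains P q"
      using chains_mono[OF PX_subset[OF chains_hd[OF \<tau>]]] by blast
    ultimately have "\<tau> \<in> chains (simplices_of \<sigma>) p" using slice_chain_iff \<tau> by blast
    then show "x \<tau> \<sigma> = y \<tau> \<sigma>" using eq[OF \<sigma>] by (metis slice_entry)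
  qed
qed

lemma slice_glue:
  assumes y: "\<And>\<sigma>. \<sigma> \<in> chains P q \<Longrightarrow> y \<sigma> \<in> carrier (slice_mod \<sigma> p)"
  shows "\<exists>x\<in>carrier (cover_mod p q). \<forall>\<sigma>\<in>chains P q. slice \<sigma> p x = y \<sigma>"
proof -
  define x where "x = (\<lambda>\<tau>. if \<tau> \<in> chains N p
    then (\<lambda>\<sigma>. if \<sigma> \<in> chains (PX Pa (hd \<tau>)) q then y \<sigma> \<tau> else undefined) else undefined)"
  have "y \<sigma> \<tau> \<in> carrier (F (hd \<sigma>))" if "\<tau> \<in> chains N p" "\<sigma> \<in> chains (PX Pa (hd \<tau>)) q" for \<tau> \<sigma>
  proof -
    have \<sigma>: "\<sigma> \<in> chains P q" using that chains_mono[OF PX_subset[OF chains_hd[OF that(1)]]] by blast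
    then show ?thesis
      using y[OF \<sigma>] slice_chain_iff[OF \<sigma> that(1)] that(2) by (simp add: chain_mod_simps)
  qed
  then have "x \<in> carrier (cover_mod p q)" by (simp add: x_def chain_mod_simps)
  moreover have "slice \<sigma> p x = y \<sigma>" if \<sigma>: "\<sigma> \<in> chains P q" for \<sigma>
  proof
    show "slice \<sigma> p x \<tau> = y \<sigma> \<tau>" for \<tau>
    proof (cases "\<tau> \<in> chains (simplices_of \<sigma>) p")
      case True
      then have "\<tau> \<in> chains N p" using chains_mono[OF simplices_of_subset] by blast
      then show ?thesis using True slice_chain_iff[OF \<sigma>] by (simp add: slice_entry x_def)
    next
      case False
      then show ?thesis using y[OF \<sigma>] by (simp add: slice_def chain_map_def chain_mod_simps)
    qed
  qed
  ultimately show ?thesis by blast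
qed

definition eps :: "nat \<Rightarrow> ('k set list \<Rightarrow> 'a list \<Rightarrow> 'm) \<Rightarrow> 'a list \<Rightarrow> 'm" where
  "eps q x = (\<Oplus>\<^bsub>chain_mod P F q\<^esub>\<tau>\<in>chains N 0. ext_chain (PX Pa (hd \<tau>)) P F q (x \<tau>))"

lemma linear_map_ext_simplex:
  "\<tau> \<in> chains N p \<Longrightarrow>
    linear_map R (simplex_chains q (hd \<tau>)) (chain_mod P F q) (ext_chain (PX Pa (hd \<tau>)) P F q)"
  by (rule P.linear_map_ext_chain[OF PX_subset[OF chains_hd] order_refl])

lemma linear_map_eps: "linear_map R (cover_mod 0 q) (chain_mod P F q) (eps q)"
  unfolding eps_def[abs_def]
  by (intro linear_map_finsum sheaf.module_chain_mod P.module_chain_mod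
      linear_map_comp[OF sheaf.linear_map_chain_entry linear_map_ext_simplex])

lemma eps_dv:
  assumes x: "x \<in> carrier (cover_mod 0 (Suc q))"
  shows "eps q (column_bdry 0 q x) = bdry P F rho q (eps (Suc q) x)"
proof -
  have ext_closed: "ext_chain (PX Pa (hd \<tau>)) P F (Suc q) (x \<tau>) \<in> carrier (chain_mod P F (Suc q))"
      if "\<tau> \<in> chains N 0" for \<tau>
    by (rule linear_map.map_closed[OF linear_map_ext_simplex[OF that]
      sheaf.entry_closed[OF x that]])
  have "eps q (column_bdry 0 q x) =
    (\<Oplus>\<^bsub>chain_mod P F q\<^esub>\<tau>\<in>chains N 0. bdry P F rho q (ext_chain (PX Pa (hd \<tau>)) P F (Suc q) (x \<tau>)))"
    unfolding eps_def
    using P.ext_chain_bdry[OF PX_subset[OF chains_hd] order_refl sheaf.entry_closed[OF x]]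
      P.d.map_closed[OF ext_closed]
    by (intro P.d.N.finsum_cong') (auto simp: chain_map_same)
  also have "\<dots> = bdry P F rho q (eps (Suc q) x)"
    unfolding eps_def by (rule P.d.map_finsum[OF ext_closed, symmetric])
  finally show ?thesis .
qed

context
  fixes \<sigma> q
  assumes \<sigma>: "\<sigma> \<in> chains P q"
begin

interpretation const: constant_sheaf_greatest R "simplices_of \<sigma>" "F (hd \<sigma>)" "greatest_simplex \<sigma>"
  by (rule constant_sheaf_simplices_of[OF \<sigma>])

interpretation slice: sheaf_overlap_hom R N "simplex_chains q" "simplex_ext q"
  "simplices_of \<sigma>" "\<lambda>_. F (hd \<sigma>)" "\<lambda>_ _ m. m" "\<lambda>X u. u \<sigma>"
  by (rule sheaf_overlap_hom_slice[OF \<sigma>])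

lemma linear_map_slice: "linear_map R (cover_mod p q) (slice_mod \<sigma> p) (slice \<sigma> p)"
  unfolding slice_def by (rule slice.linear_map_chain_map)

lemma slice_bdry:
  "x \<in> carrier (cover_mod (Suc p) q) \<Longrightarrow>
    slice \<sigma> p (row_bdry p q x) = slice_bdry \<sigma> p (slice \<sigma> (Suc p) x)"
  unfolding slice_def by (rule slice.chain_map_bdry)

lemma eps_entry:
  assumes x: "x \<in> carrier (cover_mod 0 q)"
  shows "eps q x \<sigma> = const.augmentation (slice \<sigma> 0 x)"
proof -
  interpret F: module R "F (hd \<sigma>)" by (rule P.module_stalk[OF chains_hd[OF \<sigma>]])
  let ?ext = "\<lambda>\<tau>. ext_chain (PX Pa (hd \<tau>)) P F q (x \<tau>)"
  have ext_closed: "?ext \<tau> \<in> carrier (chain_mod P F q)" if "\<tau> \<in> chains N 0" for \<tau>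
    by (rule linear_map.map_closed[OF linear_map_ext_simplex[OF that]
      sheaf.entry_closed[OF x that]])
  have "eps q x \<sigma> = (\<Oplus>\<^bsub>F (hd \<sigma>)\<^esub>\<tau>\<in>chains N 0. ?ext \<tau> \<sigma>)"
    unfolding eps_def by (rule P.finsum_chain_entry[OF ext_closed \<sigma>])
  also have "\<dots> = (\<Oplus>\<^bsub>F (hd \<sigma>)\<^esub>\<tau>\<in>chains (simplices_of \<sigma>) 0. slice \<sigma> 0 x \<tau>)"
  proof (rule F.add.finprod_mono_neutral_cong_left[symmetric])
    show "finite (chains N 0)" by (rule finite_chains[OF finite_nerve])
    show "chains (simplices_of \<sigma>) 0 \<subseteq> chains N 0" by (rule chains_mono[OF simplices_of_subset])
    show "?ext \<tau> \<sigma> = \<zero>\<^bsub>F (hd \<sigma>)\<^esub>" if "\<tau> \<in> chains N 0 - chains (simplices_of \<sigma>) 0" for \<tau>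
      using that slice_chain_iff[OF \<sigma>] \<sigma> by (auto simp: ext_chain_def)
    show "slice \<sigma> 0 x \<tau> = ?ext \<tau> \<sigma>" if "\<tau> \<in> chains (simplices_of \<sigma>) 0" for \<tau>
      using that slice_chain_iff[OF \<sigma>, of \<tau> 0] chains_mono[OF simplices_of_subset, of \<sigma> 0]
      by (auto simp: slice_entry ext_chain_def)
    show "(\<lambda>\<tau>. ?ext \<tau> \<sigma>) \<in> chains N 0 \<rightarrow> carrier (F (hd \<sigma>))"
      using ext_closed P.entry_closed[OF _ \<sigma>] by auto
  qed
  finally show ?thesis by (simp add: const.augmentation_def)
qed

lemma eps_dh_entry:
  "x \<in> carrier (cover_mod (Suc 0) q) \<Longrightarrow>
    eps q (row_bdry 0 q x) \<sigma> = \<zero>\<^bsub>F (hd \<sigma>)\<^esub>"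
  using linear_map.map_closed[OF linear_map_slice]
  by (simp add: eps_entry slice_bdry const.augmentation_bdry)

lemma slice_lift_0:
  assumes "x \<in> carrier (cover_mod 0 q)" "eps q x \<sigma> = \<zero>\<^bsub>F (hd \<sigma>)\<^esub>"
  shows "\<exists>y\<in>carrier (slice_mod \<sigma> (Suc 0)). slice_bdry \<sigma> 0 y = slice \<sigma> 0 x"
  using assms linear_map.map_closed[OF linear_map_slice]
  by (intro const.exact_0) (simp_all add: eps_entry)

lemma slice_lift_Suc:
  assumes "x \<in> carrier (cover_mod (Suc p) q)"
    "row_bdry p q x = \<zero>\<^bsub>cover_mod p q\<^esub>"
  shows "\<exists>y\<in>carrier (slice_mod \<sigma> (Suc (Suc p))). slice_bdry \<sigma> (Suc p) y = slice \<sigma> (Suc p) x"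
  using assms linear_map.map_closed[OF linear_map_slice] linear_map.map_zero[OF linear_map_slice]
    slice_bdry[OF assms(1)]
  by (intro const.exact_Suc) simp_all

lemma slice_lift_augmentation:
  assumes "m \<in> carrier (F (hd \<sigma>))"
  shows "\<exists>y\<in>carrier (slice_mod \<sigma> 0). \<forall>x\<in>carrier (cover_mod 0 q). slice \<sigma> 0 x = y \<longrightarrow> eps q x \<sigma> = m"
  using const.augmentation_onto[OF assms] eps_entry by metis

end

lemma lift_along_bdry:
  assumes x: "x \<in> carrier (cover_mod p q)"
    and "\<And>\<sigma>. \<sigma> \<in> chains P q \<Longrightarrow> \<exists>y\<in>carrier (slice_mod \<sigma> (Suc p)). slice_bdry \<sigma> p y = slice \<sigma> p x"
  shows "\<exists>y\<in>carrier (cover_mod (Suc p) q). row_bdry p q y = x"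
proof -
  obtain lift where lift: "\<And>\<sigma>. \<sigma> \<in> chains P q \<Longrightarrow> lift \<sigma> \<in> carrier (slice_mod \<sigma> (Suc p))"
    "\<And>\<sigma>. \<sigma> \<in> chains P q \<Longrightarrow> slice_bdry \<sigma> p (lift \<sigma>) = slice \<sigma> p x"
    using assms(2) by metis
  obtain y where y: "y \<in> carrier (cover_mod (Suc p) q)"
    "\<And>\<sigma>. \<sigma> \<in> chains P q \<Longrightarrow> slice \<sigma> (Suc p) y = lift \<sigma>"
    using slice_glue[of q lift "Suc p"] lift(1) by blast
  have "row_bdry p q y = x"
    by (rule slice_eqI[OF sheaf.d.map_closed[OF y(1)] x])
      (simp add: slice_bdry[OF _ y(1)] y(2) lift(2))
  then show ?thesis using y(1) by blast
qed

lemma eps_onto: "eps q ` carrier (cover_mod 0 q) = carrier (chain_mod P F q)"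
proof (intro subset_antisym subsetI)
  fix s
  assume s: "s \<in> carrier (chain_mod P F q)"
  let ?lifts = "\<lambda>\<sigma> y. y \<in> carrier (slice_mod \<sigma> 0) \<and>
    (\<forall>x\<in>carrier (cover_mod 0 q). slice \<sigma> 0 x = y \<longrightarrow> eps q x \<sigma> = s \<sigma>)"
  have "\<forall>\<sigma>\<in>chains P q. \<exists>y. ?lifts \<sigma> y"
    using slice_lift_augmentation[OF _ P.entry_closed[OF s]] by fast
  then obtain lift where lift: "\<forall>\<sigma>\<in>chains P q. ?lifts \<sigma> (lift \<sigma>)" by (rule bchoice[THEN exE])
  then have "lift \<sigma> \<in> carrier (slice_mod \<sigma> 0)" if "\<sigma> \<in> chains P q" for \<sigma> using that by blast
  then obtain x where x: "x \<in> carrier (cover_mod 0 q)" "\<And>\<sigma>. \<sigma> \<in> chains P q \<Longrightarrow> slice \<sigma> 0 x = lift \<sigma>"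
    using slice_glue[of q lift 0] by blast
  have "eps q x = s"
    by (rule chain_mod_eqI[OF linear_map.map_closed[OF linear_map_eps x(1)] s])
      (use lift x in blast)
  then show "s \<in> eps q ` carrier (cover_mod 0 q)" using x(1) by blast
qed (use linear_map.map_closed[OF linear_map_eps] in blast)

sublocale augmented_double_complex R cover_mod row_bdry column_bdry
  "chain_mod P F" "bdry P F rho" eps
proof (intro augmented_double_complex.intro augmented_double_complex_axioms.intro
  double_complex_axioms P.chain_complex_axioms linear_map_eps eps_onto eps_dv)
  fix p q x
  show "eps q (row_bdry 0 q x) = \<zero>\<^bsub>chain_mod P F q\<^esub>"
    if x: "x \<in> carrier (cover_mod (Suc 0) q)"
    using eps_dh_entry[OF _ x] linear_map.map_closed[OF linear_map_eps sheaf.d.map_closed[OF x]]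
    by (simp add: chain_mod_zero_iff)
  show "\<exists>y\<in>carrier (cover_mod (Suc 0) q). row_bdry 0 q y = x"
    if x: "x \<in> carrier (cover_mod 0 q)" "eps q x = \<zero>\<^bsub>chain_mod P F q\<^esub>"
  proof (rule lift_along_bdry[OF x(1) slice_lift_0[OF _ x(1)]])
    show "eps q x \<sigma> = \<zero>\<^bsub>F (hd \<sigma>)\<^esub>" if "\<sigma> \<in> chains P q" for \<sigma>
      using that by (simp add: x(2) chain_mod_simps(2))
  qed
  show "\<exists>y\<in>carrier (cover_mod (Suc (Suc p)) q). row_bdry (Suc p) q y = x"
    if "x \<in> carrier (cover_mod (Suc p) q)"
      "row_bdry p q x = \<zero>\<^bsub>cover_mod p q\<^esub>"
    using that by (intro lift_along_bdry slice_lift_Suc)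
qed

theorem converging_ss_covering:
  "converging_ss R page dpage (\<lambda>p q. HS N (Hsheaf Pa F rho q) (Hsheaf_map Pa F rho q) p)
    (HS P F rho)"
  unfolding Hsheaf_eq Hsheaf_map_eq HS_eq[of P] by (rule converging_ss_page[OF page_2_iso])

end

theorem theorem2:
  fixes R :: "'r ring" and P :: "'a::order set"
    and F :: "'a \<Rightarrow> ('r,'m) module" and rho :: "'a \<Rightarrow> 'a \<Rightarrow> 'm \<Rightarrow> 'm"
    and K :: "'k set" and Pa :: "'k \<Rightarrow> 'a set"
  assumes "cring R"
    and "finite P"
    and "is_sheaf R P F rho"
    and "finite K"
    and "\<forall>\<alpha>\<in>K. upper_convex P (Pa \<alpha>)"
    and "P = (\<Union>\<alpha>\<in>K. Pa \<alpha>)"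
  shows "\<exists>(E :: nat \<Rightarrow> int \<Rightarrow> int \<Rightarrow> ('r, ('k set list \<Rightarrow> 'a list \<Rightarrow> 'm) set) module) d.
           converging_ss R E d
             (\<lambda>p q. HS (nerve K Pa) (Hsheaf Pa F rho q) (Hsheaf_map Pa F rho q) p)
             (\<lambda>n. HS P F rho n)"
proof -
  interpret upper_covering R P F rho K Pa
    using assms by (intro upper_covering.intro upper_covering_axioms.intro poset_sheaf.intro) auto
  show ?thesis using converging_ss_covering by blast
qed

end
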